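(* Let $V\subset\mathbf{P}^N(\mathbf{C})$ be a complex projective algebraic variety. Let $f:\mathbf{C}\to V$ be a holomorphic curve satisfying $\|f'(z)\|=O(|z|^\sigma)$ as $|z|\to\infty$ for some real $\sigma>-1$. Let $D_1,\ldots,D_q$ be hypersurfaces of degrees $d_1,\ldots,d_q$ in $\mathbf{P}^N(\mathbf{C})$. Let $\Omega=\Omega(\theta,\epsilon)$ ($0\le\theta\le2\pi$, $0<\epsilon<\pi$) be any angular domain in $\mathbf{C}$. Then the following hold as $r\to\infty$. (i) Let $m\in\mathbb{N}$ with $\dim V\le m$. If $D_1,\ldots,D_q$ are located in $m$-subgeneral position in $V$, then $$(q-m+1)\,T_f(r,\Omega)\le\sum_{1\le i\le q}\frac1{d_i}N_f(r,\Omega,D_i)+o(r^{2\sigma+2}).$$ (ii) If $V\cap\mathrm{Supp}\,D_1\cap\cdots\cap\mathrm{Supp}\,D_q=\emptyset$, then $$2\,T_f(r,\Omega)\le\sum_{1\le i\le q}\frac1{d_i}N_f(r,\Omega,D_i)+o(r^{2\sigma+2}).$$ (iii) If $\dim(V\cap\mathrm{Supp}\,D_1\cap\cdots\cap\mathrm{Supp}\,D_q)=0$, then $$T_f(r,\Omega)\le\sum_{1\le i\le q}\frac1{d_i}N_f(r,\Omega,D_i)+o(r^{2\sigma+2}).$$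
   Context: A holomorphic curve $f:\mathbf{C}\to V\subset\mathbf{P}^N(\mathbf{C})$ is a holomorphic map with image in $V$; $\mathbf{f}=(f_0,\ldots,f_N)$ denotes a homogeneous representation (entire functions without common zeros, $f=[f_0:\cdots:f_N]$). The Fubini-Study derivative is given by $$\|f'\|^2=\frac{\sum_{i<j}|f_i'f_j-f_if_j'|^2}{\big(\sum_{j=0}^N|f_j|^2\big)^2}.$$ Put $u=\log\sqrt{|f_0|^2+\cdots+|f_N|^2}$, a subharmonic function, and let $\triangle u$ be its Riesz measure, i.e. the measure with density $\frac1\pi\|f'\|^2$ with respect to area. Angular domain: $\Omega(\theta,\epsilon)=\{z\in\mathbf{C}:\theta-\epsilon<\arg z<\theta+\epsilon\}$. With $t\mathbb{D}=\{|z|<t\}$, the Ahlfors-Shimizu characteristic over a domain $\Omega$ is $$T_f(r,\Omega)=\int_1^r\frac{\triangle u(\Omega\cap t\mathbb{D})}{t}\,dt+O(1).$$ A hypersurface $D$ of degree $d$ is defined by a homogeneous polynomial $Q$ of degree $d\ge1$, with $\mathrm{Supp}\,D=\{Q=0\}$. Let $n_f(t,\Omega,D)$ be the number of zeros of $Q\circ\mathbf{f}$ in $\{|z|<t\}\cap\Omega$, counted with multiplicity, and let $n_f(0,\Omega,D)$ be the multiplicity of the zero of $Q\circ\mathbf f$ at $0$ if $0\in\Omega$ and $0$ otherwise (so it is $0$ for angular domains). The counting function is $$N_f(r,\Omega,D)=\int_0^r\frac{n_f(t,\Omega,D)-n_f(0,\Omega,D)}{t}\,dt+n_f(0,\Omega,D)\log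 r,$$ with $N_f(r,\Omega,D)=+\infty$ if $Q\circ\mathbf{f}\equiv0$. Hypersurfaces $D_1,\ldots,D_q$ are in $m$-subgeneral position in $V$ ($\dim V\le m\in\mathbb{N}$) if for every nonempty subset $I\subset\{1,\ldots,q\}$ with $\sharp I\le m+1$ one has $\dim\big(\bigcap_{i\in I}\mathrm{Supp}\,D_i\cap V\big)\le m-\sharp I$ (a set of negative dimension being empty). *)

theory Defs
  imports
    "HOL-Complex_Analysis.Complex_Analysis"
    "HOL-Library.Poly_Mapping"
    "HOL-Library.Landau_Symbols"
begin

section \<open>Projective algebraic sets\<close>

text \<open>
  The projective space \<open>P\<^sup>N(C)\<close> is the set of lines through the origin of \<open>C\<^sup>N\<^sup>+\<^sup>1\<close>;
  the homogeneous coordinates are indexed by \<open>'n\<close>, so that \<open>CARD('n) = N + 1\<close>.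
\<close>

typedef ('n::finite) pspace = "{vec.span {v} | v :: complex ^ 'n. v \<noteq> 0}"
  morphisms line_of Abs_pspace
proof -
  have "vec 1 \<noteq> (0 :: complex ^ 'n)" by (simp add: vec_eq_iff)
  then show ?thesis by blast
qed

definition proj :: "complex ^ 'n \<Rightarrow> ('n::finite) pspace" where
  "proj v = Abs_pspace (vec.span {v})"

text \<open>Polynomials in the variables \<open>'n\<close>: finitely supported families of coefficients, indexed by
  exponent vectors.\<close>

type_synonym 'n cpoly = "('n \<Rightarrow>\<^sub>0 nat) \<Rightarrow>\<^sub>0 complex"

definition eval_cpoly :: "('n::finite) cpoly \<Rightarrow> complex ^ 'n \<Rightarrow> complex" where
  "eval_cpoly Q x =
     (\<Sum>a\<in>Poly_Mapping.keys Q. Poly_Mapping.lookup Q a * (\<Prod>i\<in>UNIV. (x $ i) ^ Poly_Mapping.lookup a i))"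

text \<open>The zero polynomial is homogeneous of every degree.\<close>

definition homogeneous :: "nat \<Rightarrow> ('n::finite) cpoly \<Rightarrow> bool" where
  "homogeneous d Q \<longleftrightarrow>
     (\<forall>a\<in>Poly_Mapping.keys Q. (\<Sum>i\<in>UNIV. Poly_Mapping.lookup a i) = d)"

definition hypersurface_eq :: "nat \<Rightarrow> ('n::finite) cpoly \<Rightarrow> bool" where
  "hypersurface_eq d Q \<longleftrightarrow> d \<ge> 1 \<and> Q \<noteq> 0 \<and> homogeneous d Q"

definition pzeros :: "('n::finite) cpoly \<Rightarrow> 'n pspace set" where
  "pzeros Q = {p. \<forall>v\<in>line_of p. eval_cpoly Q v = 0}"

text \<open>Algebraic sets need not be irreducible.\<close>

definition palgebraic :: "('n::finite) pspace set \<Rightarrow> bool" where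
  "palgebraic X \<longleftrightarrow> (\<exists>S. (\<forall>Q\<in>S. \<exists>d. homogeneous d Q) \<and> X = (\<Inter>Q\<in>S. pzeros Q))"

definition pirreducible :: "('n::finite) pspace set \<Rightarrow> bool" where
  "pirreducible X \<longleftrightarrow> palgebraic X \<and> X \<noteq> {} \<and>
     (\<forall>A B. palgebraic A \<and> palgebraic B \<and> X = A \<union> B \<longrightarrow> X = A \<or> X = B)"

text \<open>The dimension of an algebraic set as a Zariski topological space, i.e. the supremum of the
  lengths of chains of irreducible algebraic subsets. The supremum is taken in the extended reals,
  so the empty set has dimension \<open>-\<infinity>\<close>, and a dimension bounded by a negative number means that
  the set is empty.\<close>

definition pdim :: "('n::finite) pspace set \<Rightarrow> ereal" where
  "pdim X = (SUP k \<in> {k. \<exists>Z. (\<forall>i\<le>k. pirreducible (Z i) \<and> Z i \<subseteq> X) \<and> (\<forall>i<k. Z i \<subset> Z (Suc i))}.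
               ereal (real k))"

definition subgeneral_position ::
    "nat \<Rightarrow> ('n::finite) pspace set \<Rightarrow> nat \<Rightarrow> (nat \<Rightarrow> 'n cpoly) \<Rightarrow> bool" where
  "subgeneral_position m V q Q \<longleftrightarrow>
     (\<forall>I. I \<subseteq> {1..q} \<and> I \<noteq> {} \<and> card I \<le> m + 1 \<longrightarrow>
        pdim ((\<Inter>i\<in>I. pzeros (Q i)) \<inter> V) \<le> ereal (real m - real (card I)))"


section \<open>Holomorphic curves\<close>

definition homogeneous_rep :: "(complex \<Rightarrow> complex ^ 'n) \<Rightarrow> (complex \<Rightarrow> ('n::finite) pspace) \<Rightarrow> bool" where
  "homogeneous_rep F f \<longleftrightarrow>
     (\<forall>j. (\<lambda>z. F z $ j) holomorphic_on UNIV) \<and> (\<forall>z. F z \<noteq> 0 \<and> f z = proj (F z))"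

definition fs_deriv :: "(complex \<Rightarrow> complex ^ ('n::{finite,linorder})) \<Rightarrow> complex \<Rightarrow> real" where
  "fs_deriv F z = sqrt
     ((\<Sum>(i, j) \<in> {(i, j). i < j}.
         (cmod (deriv (\<lambda>w. F w $ i) z * F z $ j - F z $ i * deriv (\<lambda>w. F w $ j) z))\<^sup>2)
      / (\<Sum>j\<in>UNIV. (cmod (F z $ j))\<^sup>2)\<^sup>2)"

text \<open>The Riesz measure of the subharmonic function \<open>log \<parallel>F\<parallel>\<close>, given by its density.\<close>

definition riesz_measure :: "(complex \<Rightarrow> complex ^ ('n::{finite,linorder})) \<Rightarrow> complex measure" where
  "riesz_measure F = density lborel (\<lambda>z. ennreal ((fs_deriv F z)\<^sup>2 / pi))"

text \<open>All values of the argument of \<open>z\<close> are admitted. The origin, for which \<^const>\<open>is_Arg\<close> holds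
  with every angle, does not belong to the domain.\<close>

definition angular_domain :: "real \<Rightarrow> real \<Rightarrow> complex set" where
  "angular_domain \<theta> \<epsilon> = {z. z \<noteq> 0 \<and> (\<exists>t. is_Arg z t \<and> \<theta> - \<epsilon> < t \<and> t < \<theta> + \<epsilon>)}"

text \<open>The Ahlfors-Shimizu characteristic is only defined up to a bounded term; this is the
  representative without that term.\<close>

definition char_T ::
    "(complex \<Rightarrow> complex ^ ('n::{finite,linorder})) \<Rightarrow> complex set \<Rightarrow> real \<Rightarrow> real" where
  "char_T F \<Omega> r = integral {1..r} (\<lambda>t. measure (riesz_measure F) (\<Omega> \<inter> ball 0 t) / t)"

text \<open>For entire \<open>g\<close> not identically zero, \<^const>\<open>zorder\<close> is the multiplicity of a zero, and it is
  \<open>0\<close> where \<open>g\<close> does not vanish.\<close>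

definition zero_count :: "(complex \<Rightarrow> complex) \<Rightarrow> complex set \<Rightarrow> real \<Rightarrow> nat" where
  "zero_count g \<Omega> t = (\<Sum>z \<in> {z \<in> \<Omega>. cmod z < t \<and> g z = 0}. nat (zorder g z))"

definition zero_count0 :: "(complex \<Rightarrow> complex) \<Rightarrow> complex set \<Rightarrow> nat" where
  "zero_count0 g \<Omega> = (if 0 \<in> \<Omega> then nat (zorder g 0) else 0)"

definition counting_N ::
    "(complex \<Rightarrow> complex ^ ('n::finite)) \<Rightarrow> complex set \<Rightarrow> 'n cpoly \<Rightarrow> real \<Rightarrow> ereal" where
  "counting_N F \<Omega> Q r =
     (let g = (\<lambda>z. eval_cpoly Q (F z)) in
      if \<forall>z. g z = 0 then \<infinity>
      else ereal (integral {0..r} (\<lambda>t. (real (zero_count g \<Omega> t) - real (zero_count0 g \<Omega>)) / t)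
                  + real (zero_count0 g \<Omega>) * ln r))"

end

theory Submission
  imports Defs
begin

text \<open>
  Write \<open>u = log \<parallel>F\<parallel>\<close> and \<open>u\<^sub>i = (log \<bar>Q\<^sub>i \<circ> F\<bar>) / d\<^sub>i\<close>. All three parts say that \<open>k\<close> times the Riesz
  measure of \<open>u\<close> is dominated by the sum of those of the \<open>u\<^sub>i\<close>, where \<open>k\<close> is such that whenever fewer
  than \<open>k\<close> of the hypersurfaces are left out, the others meet \<open>V\<close> in a set on which some form \<open>P\<close>
  has no zeros. After rescaling an annulus of radius \<open>r\<close> to unit size, the Laplacian of \<open>u\<close> is bounded
  by \<open>C L\<close> with \<open>L = r\<^bsup>2\<sigma>+2\<^esup>\<close>, and \<open>w\<^sub>i = u - u\<^sub>i\<close> is bounded below. Where fewer than \<open>k\<close> of the \<open>w\<^sub>i\<close> are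
  \<open>o(L)\<close>, the curve is near the zero set of the remaining forms, so that \<open>u\<close> differs by a bounded
  amount from the harmonic function \<open>(log \<bar>P \<circ> F\<bar>) / deg P\<close> and carries no mass. Elsewhere at least \<open>k\<close>
  of the \<open>u\<^sub>i\<close> agree with \<open>u\<close> up to \<open>o(L)\<close>, hence have nearly the same Laplacian.

  To make this quantitative without normal families, cut the annulus into small squares and call a
  square white for \<open>i\<close> if \<open>w\<^sub>i\<close> is small somewhere in it. If all subsquares of a square are white, the
  mean inequality (recall that the Laplacian of \<open>w\<^sub>i\<close> is at most \<open>C L\<close>) shows that \<open>w\<^sub>i\<close> is small on
  average, and Green's formula compares the Laplacians. By the pigeonhole principle there is a scale,
  among finitely many, at which few white squares have a subsquare that is not white.
\<close>

text \<open>The number \<open>k\<close> enters through the hypothesis \<open>gap\<close> below. For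
  (i), \<open>m\<close> of the forms meet \<open>V\<close> in finitely many points, which some
  linear form avoids; for (iii) the same holds for all of them; for (ii), \<open>P\<close> is the
  one form left out.

  The obstacle is that the Laplacian of \<open>w i\<close> has no lower bound uniform in the curve,
  because of the zeros, so that smallness at a point does not bound \<open>w i\<close> nearby. Its
  upper bound controls means. On a square of side \<open>1/N\<close> Green's formula costs a factor
  \<open>N^2\<close>; the mean inequality on its \<open>m^2\<close> subsquares leaves an error of
  order \<open>L/(N m)^2\<close> per square, hence \<open>L/m^2\<close> in all. This is what the
  subsquares are for.

  All constants and scales are chosen before the curve, so one threshold for \<open>L\<close> serves
  every annulus. Since \<open>ln (cmod (g z))\<close> is not smooth at zeros of \<open>g\<close>, it
  is replaced by \<open>ln ((cmod (g z))^2 + e^2) / 2\<close>; here \<open>e\<close> may depend on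
  the curve, as finitely many squares are to be compared with zero counts. The errors on the annuli
  of radii \<open>t\<close>, \<open>t/2\<close>, \<open>t/4\<close>, ... form a geometric series
  because \<open>2 * \<sigma> + 2 > 0\<close>.\<close>

unbundle no fps_syntax

section \<open>Projective algebraic sets and forms\<close>

lemma nat_sequence_mono_subseq:
  fixes f :: "nat \<Rightarrow> nat"
  shows "\<exists>r::nat \<Rightarrow> nat. strict_mono r \<and> incseq (\<lambda>k. f (r k))"
proof -
  obtain g where g: "strict_mono g" "monoseq (\<lambda>n. f (g n))"
    using seq_monosub by blast
  show ?thesis
  proof (cases "incseq (\<lambda>n. f (g n))")
    case True
    then show ?thesis using g(1) by blast
  next
    case False
    with g(2) have dec: "decseq (\<lambda>n. f (g n))"
      by (simp add: monoseq_iff)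
    \<comment> \<open>A decreasing sequence of naturals stays constant once it has reached its least
      value.\<close>
    define m where "m = (LEAST x. x \<in> range (\<lambda>n. f (g n)))"
    have "m \<in> range (\<lambda>n. f (g n))"
      unfolding m_def by (rule LeastI_ex) blast
    then obtain n0 where n0: "m = f (g n0)" by auto
    have le: "m \<le> f (g n)" for n
      unfolding m_def by (rule Least_le) auto
    have "f (g (n0 + n)) = m" for n
      using decseqD[OF dec, of n0 "n0 + n"] le[of "n0 + n"] n0 by simp
    moreover have "strict_mono (\<lambda>n. g (n0 + n))"
      using g(1) by (simp add: strict_mono_def)
    ultimately show ?thesis
      by (intro exI[of _ "\<lambda>n. g (n0 + n)"]) (simp add: mono_def)
  qed
qed

lemma dickson_subseq:
  fixes f :: "nat \<Rightarrow> 'a \<Rightarrow> nat"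
  assumes "finite A"
  shows "\<exists>r::nat \<Rightarrow> nat. strict_mono r \<and> (\<forall>i\<in>A. incseq (\<lambda>k. f (r k) i))"
  using assms
proof (induction A rule: finite_induct)
  case empty
  show ?case by (intro exI[of _ id]) (simp add: strict_mono_def)
next
  case (insert a A)
  then obtain r where r: "strict_mono r" "\<forall>i\<in>A. incseq (\<lambda>k. f (r k) i)" by blast
  obtain t where t: "strict_mono t" "incseq (\<lambda>k. f (r (t k)) a)"
    using nat_sequence_mono_subseq[of "\<lambda>k. f (r k) a"] by blast
  have tm: "mono t" using t(1) by (rule strict_mono_mono)
  have "strict_mono (\<lambda>k. r (t k))"
    using r(1) t(1) by (simp add: strict_mono_def)
  moreover have "incseq (\<lambda>k. f (r (t k)) i)" if "i \<in> A" for i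
    using r(2) that tm by (simp add: mono_def)
  ultimately show ?case using t(2) by (intro exI[of _ "\<lambda>k. r (t k)"]) auto
qed

text \<open>Two members of a subsequence that increases in every coordinate are comparable, so the
  truncated subtraction of their exponents is exact.\<close>

lemma dickson:
  fixes s :: "nat \<Rightarrow> ('n::finite \<Rightarrow>\<^sub>0 nat)"
  shows "\<exists>i j c. i < j \<and> s j = s i + c"
proof -
  obtain r where r: "strict_mono r" "\<forall>i\<in>UNIV. incseq (\<lambda>k. Poly_Mapping.lookup (s (r k)) i)"
    using dickson_subseq[of UNIV "\<lambda>k. Poly_Mapping.lookup (s k)"] by auto
  have "Poly_Mapping.lookup (s (r 0)) k \<le> Poly_Mapping.lookup (s (r 1)) k" for k
    using r(2) by (auto simp: mono_def)
  then have "s (r 1) = s (r 0) + (s (r 1) - s (r 0))"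
    by (intro poly_mapping_eqI) (simp add: lookup_add lookup_minus)
  moreover have "r 0 < r 1" using r(1) by (simp add: strict_mono_def)
  ultimately show ?thesis by blast
qed

text \<open>The order on exponent vectors is the lexicographic one, decided by the first variable
  with different exponents. With its compatibility with addition and \<open>wf_monomials\<close> it
  is a monomial order.\<close>

lemma monomial_nonneg: "0 \<le> (c :: 'n::{finite,linorder} \<Rightarrow>\<^sub>0 nat)"
proof (rule ccontr)
  assume "\<not> 0 \<le> c"
  then have "c < 0" by simp
  then show False by (auto simp: less_poly_mapping_def less_fun_def)
qed

text \<open>By Dickson's lemma an infinite descent would contain \<open>s j = s i + c\<close> with
  \<open>i < j\<close>, but adding \<open>c \<ge> 0\<close> does not decrease.\<close>

lemma wf_monomials: "wf {(x, y :: 'n::{finite,linorder} \<Rightarrow>\<^sub>0 nat). x < y}"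
proof (rule ccontr)
  assume "\<not> ?thesis"
  then obtain s :: "nat \<Rightarrow> ('n \<Rightarrow>\<^sub>0 nat)" where s: "\<And>i. s (Suc i) < s i"
    by (auto simp: wf_iff_no_infinite_down_chain)
  obtain i j c where ij: "i < j" "s j = s i + c" using dickson by blast
  have "s j < s i" using ij(1) 
  proof (induction j)
    case (Suc j)
    then show ?case using s[of j] by (cases "i = j") (auto intro: less_trans)
  qed simp
  moreover have "s i \<le> s j" using ij(2) monomial_nonneg[of c] by (simp add: add_increasing2)
  ultimately show False by simp
qed

lemma eval_cpoly_superset:
  assumes "finite A" "Poly_Mapping.keys P \<subseteq> A"
  shows "eval_cpoly P x = (\<Sum>a\<in>A. Poly_Mapping.lookup P a * (\<Prod>i\<in>UNIV. (x $ i) ^ Poly_Mapping.lookup a i))"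
  unfolding eval_cpoly_def using assms
  by (intro sum.mono_neutral_left) (auto simp: in_keys_iff)

lemma eval_cpoly_add: "eval_cpoly (P + R) x = eval_cpoly P x + eval_cpoly R x"
proof -
  let ?A = "Poly_Mapping.keys P \<union> Poly_Mapping.keys R"
  have "Poly_Mapping.keys (P + R) \<subseteq> ?A" by (rule keys_add)
  then show ?thesis
    by (simp add: eval_cpoly_superset[of ?A] lookup_add sum.distrib algebra_simps)
qed

lemma eval_cpoly_diff: "eval_cpoly (P - R) x = eval_cpoly P x - eval_cpoly R x"
  using eval_cpoly_add[of "P - R" R x] by simp

lemma eval_cpoly_0 [simp]: "eval_cpoly 0 x = 0"
  by (simp add: eval_cpoly_def)

lemma eval_cpoly_sum: "eval_cpoly (\<Sum>i\<in>A. P i) x = (\<Sum>i\<in>A. eval_cpoly (P i) x)"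
  by (induction A rule: infinite_finite_induct) (simp_all add: eval_cpoly_add)

lemma eval_cpoly_linear_monomial:
  "eval_cpoly (Poly_Mapping.single (Poly_Mapping.single i 1) c) x = c * x $ i"
proof -
  have "(\<Prod>j\<in>UNIV. (x $ j) ^ Poly_Mapping.lookup (Poly_Mapping.single i 1) j)
      = (\<Prod>j\<in>UNIV. if j = i then x $ i else 1)"
    by (intro prod.cong) (auto simp: lookup_single when_def)
  then show ?thesis
    by (subst eval_cpoly_superset[of "{Poly_Mapping.single i 1}"]) auto
qed

lemma lookup_single_times:
  fixes P :: "('n::finite) cpoly"
  shows "Poly_Mapping.lookup (Poly_Mapping.single a c * P) (a + b) = c * Poly_Mapping.lookup P b"
proof -
  have "Poly_Mapping.lookup (Poly_Mapping.single a c * P) (a + b)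
     = (\<Sum>l. (c when a = l) * (\<Sum>q. Poly_Mapping.lookup P q when a + b = l + q))"
    by (simp add: lookup_mult lookup_single)
  also have "\<dots> = (\<Sum>l. (c * (\<Sum>q. Poly_Mapping.lookup P q when a + b = a + q)) when l = a)"
    by (intro Sum_any.cong) (auto simp: when_def)
  also have "\<dots> = c * (\<Sum>q. Poly_Mapping.lookup P q when b = q)"
    by simp
  also have "\<dots> = c * Poly_Mapping.lookup P b"
    by (simp add: eq_commute[of b])
  finally show ?thesis .
qed

lemma keys_single_times:
  "Poly_Mapping.keys (Poly_Mapping.single a c * P) \<subseteq> (+) a ` Poly_Mapping.keys P"
  for P :: "('n::finite) cpoly"
proof
  fix x assume "x \<in> Poly_Mapping.keys (Poly_Mapping.single a c * P)"
  then obtain u v where "x = u + v" "u \<in> Poly_Mapping.keys (Poly_Mapping.single a c)" "v \<in> Poly_Mapping.keys P"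
    using keys_mult[of "Poly_Mapping.single a c" P] by blast
  then show "x \<in> (+) a ` Poly_Mapping.keys P" by (auto split: if_splits)
qed

lemma eval_cpoly_single_times:
  fixes P :: "('n::finite) cpoly"
  shows "eval_cpoly (Poly_Mapping.single a c * P) x
     = c * (\<Prod>i\<in>UNIV. (x $ i) ^ Poly_Mapping.lookup a i) * eval_cpoly P x"
proof -
  have "eval_cpoly (Poly_Mapping.single a c * P) x
    = (\<Sum>b\<in>(+) a ` Poly_Mapping.keys P. Poly_Mapping.lookup (Poly_Mapping.single a c * P) b *
         (\<Prod>i\<in>UNIV. (x $ i) ^ Poly_Mapping.lookup b i))"
    by (intro eval_cpoly_superset finite_imageI finite_keys keys_single_times)
  also have "\<dots> = (\<Sum>b\<in>Poly_Mapping.keys P. c * Poly_Mapping.lookup P b *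
         ((\<Prod>i\<in>UNIV. (x $ i) ^ Poly_Mapping.lookup a i) * (\<Prod>i\<in>UNIV. (x $ i) ^ Poly_Mapping.lookup b i)))"
    by (subst sum.reindex) (auto simp: lookup_single_times lookup_add power_add prod.distrib)
  finally show ?thesis
    by (simp add: eval_cpoly_def sum_distrib_left mult_ac)
qed

text \<open>Hilbert's basis theorem in the form of the ascending chain condition: take a polynomial of
  least leading monomial in each gap of the chain and apply Dickson's lemma to these monomials.\<close>

lemma ideal_chain_stationary:
  fixes I :: "nat \<Rightarrow> ('n::{finite,linorder}) cpoly set"
  assumes zero: "\<And>n. 0 \<in> I n"
    and mono: "\<And>n. I n \<subseteq> I (Suc n)"
    and diff: "\<And>n P R. P \<in> I n \<Longrightarrow> R \<in> I n \<Longrightarrow> P - R \<in> I n"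
    and mult: "\<And>n P a c. P \<in> I n \<Longrightarrow> Poly_Mapping.single a c * P \<in> I n"
  shows "\<exists>n. I (Suc n) = I n"
proof (rule ccontr)
  assume "\<not> ?thesis"
  then have ne: "I (Suc n) - I n \<noteq> {}" for n using mono by blast
  define lm :: "'n cpoly \<Rightarrow> _" where "lm P = Max (Poly_Mapping.keys P)" for P
  have "\<exists>P. P \<in> I (Suc n) - I n \<and> (\<forall>R\<in>I (Suc n) - I n. \<not> lm R < lm P)" for n
  proof -
    obtain P0 where "P0 \<in> I (Suc n) - I n" using ne by blast
    then have "lm P0 \<in> lm ` (I (Suc n) - I n)" by blast
    from wfE_min[OF wf_monomials this] obtain z
      where z: "z \<in> lm ` (I (Suc n) - I n)"
        "\<And>y. (y, z) \<in> {(x, y). x < y} \<Longrightarrow> y \<notin> lm ` (I (Suc n) - I n)" by blast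
    then obtain P where "P \<in> I (Suc n) - I n" "z = lm P" by blast
    then show ?thesis using z(2) by (intro exI[of _ P]) blast
  qed
  then obtain P where "\<forall>n. P n \<in> I (Suc n) - I n \<and> (\<forall>R\<in>I (Suc n) - I n. \<not> lm R < lm (P n))"
    using choice[of "\<lambda>n P. P \<in> I (Suc n) - I n \<and> (\<forall>R\<in>I (Suc n) - I n. \<not> lm R < lm P)"] by blast
  then have P: "\<And>n. P n \<in> I (Suc n) - I n"
      "\<And>n R. R \<in> I (Suc n) - I n \<Longrightarrow> \<not> lm R < lm (P n)" by blast+
  have nz: "Poly_Mapping.keys (P n) \<noteq> {}" for n
    using P(1)[of n] zero[of n] by auto
  obtain i j a where ij: "i < j" and a: "lm (P j) = lm (P i) + a"
    using dickson[of "\<lambda>n. lm (P n)"] by blast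
  have "I (Suc i) \<subseteq> I j"
    using ij by (intro lift_Suc_mono_le[of I, OF mono]) auto
  then have Pi: "P i \<in> I j" using P(1)[of i] by auto
  \<comment> \<open>The leading term of \<open>P j\<close> is cancelled by a monomial multiple
    \<open>T\<close> of \<open>P i\<close>. As \<open>i < j\<close>, \<open>T\<close> lies in
    \<open>I j\<close>, so the remainder is still in the gap, with a leading monomial below the
    least one.\<close>
  define c where "c = Poly_Mapping.lookup (P j) (lm (P j)) / Poly_Mapping.lookup (P i) (lm (P i))"
  define T where "T = Poly_Mapping.single a c * P i"
  define R where "R = P j - T"
  have T: "T \<in> I j" unfolding T_def using Pi by (rule mult)
  have R: "R \<in> I (Suc j) - I j"
  proof -
    have "R \<in> I (Suc j)"
      unfolding R_def using T mono[of j] P(1)[of j] by (intro diff) auto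
    moreover have "R \<notin> I j"
    proof
      assume "R \<in> I j"
      moreover have "P j = R - (0 - T)" by (simp add: R_def)
      ultimately have "P j \<in> I j" using T zero diff by metis
      then show False using P(1)[of j] by simp
    qed
    ultimately show ?thesis by simp
  qed
  have lmi: "lm (P n) \<in> Poly_Mapping.keys (P n)" for n
    unfolding lm_def by (rule Max_in) (use nz in auto)
  have "Poly_Mapping.lookup T (lm (P j)) = c * Poly_Mapping.lookup (P i) (lm (P i))"
    using lookup_single_times[of a c "P i" "lm (P i)"] a by (simp add: T_def add.commute)
  also have "\<dots> = Poly_Mapping.lookup (P j) (lm (P j))"
    using lmi[of i] by (simp add: c_def in_keys_iff)
  finally have "lm (P j) \<notin> Poly_Mapping.keys R"
    by (simp add: R_def lookup_minus in_keys_iff)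
  moreover have "b \<le> lm (P j)" if "b \<in> Poly_Mapping.keys R" for b
  proof -
    have "Poly_Mapping.lookup (P j) b \<noteq> 0 \<or> Poly_Mapping.lookup T b \<noteq> 0"
      using that by (auto simp: R_def lookup_minus in_keys_iff)
    then show ?thesis
    proof
      assume "Poly_Mapping.lookup (P j) b \<noteq> 0"
      then show ?thesis by (simp add: lm_def in_keys_iff)
    next
      assume "Poly_Mapping.lookup T b \<noteq> 0"
      then have "b \<in> (+) a ` Poly_Mapping.keys (P i)"
        using keys_single_times[of a c "P i"] by (auto simp: T_def in_keys_iff)
      then obtain b' where "b' \<in> Poly_Mapping.keys (P i)" "b = a + b'" by blast
      then show ?thesis using a by (simp add: lm_def add.commute)
    qed
  qed
  moreover have "Poly_Mapping.keys R \<noteq> {}" using R zero[of j] by auto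
  then have "lm R \<in> Poly_Mapping.keys R" unfolding lm_def by (intro Max_in) auto
  ultimately have "lm R < lm (P j)" by (metis order_le_imp_less_or_eq)
  then show False using P(2)[OF R] by blast
qed

section \<open>Zariski closed sets and their dimension\<close>

lemma line_of_proj: "v \<noteq> 0 \<Longrightarrow> line_of (proj v) = vec.span {v}"
  unfolding proj_def by (intro Abs_pspace_inverse) blast

lemma pspace_cases:
  obtains v where "v \<noteq> 0" "p = proj v"
proof -
  obtain v where "line_of p = vec.span {v}" "v \<noteq> 0" using line_of[of p] by auto
  then have "p = proj v" by (metis line_of_inverse proj_def)
  with \<open>v \<noteq> 0\<close> show ?thesis using that by blast
qed

lemma eval_cpoly_homogeneous:
  assumes "homogeneous d P"
  shows "eval_cpoly P (c *s x) = c ^ d * eval_cpoly P x"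
proof -
  have "(\<Prod>i\<in>UNIV. ((c *s x) $ i) ^ Poly_Mapping.lookup a i) = c ^ d * (\<Prod>i\<in>UNIV. (x $ i) ^ Poly_Mapping.lookup a i)"
    if "a \<in> Poly_Mapping.keys P" for a
    using assms that by (simp add: homogeneous_def power_mult_distrib prod.distrib flip: power_sum)
  then show ?thesis
    unfolding eval_cpoly_def sum_distrib_left by (intro sum.cong) auto
qed

lemma proj_in_pzeros_iff:
  assumes "homogeneous d P" "v \<noteq> 0"
  shows "proj v \<in> pzeros P \<longleftrightarrow> eval_cpoly P v = 0"
proof -
  have "\<forall>w\<in>vec.span {v}. eval_cpoly P w = 0" if "eval_cpoly P v = 0"
    using that eval_cpoly_homogeneous[OF assms(1), of _ v] by (auto simp: vec.span_singleton)
  moreover have "v \<in> vec.span {v}" by (simp add: vec.span_base)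
  ultimately show ?thesis
    by (auto simp: pzeros_def line_of_proj[OF assms(2)])
qed

text \<open>From a strictly decreasing chain take points \<open>p i\<close> of \<open>X i\<close>
  outside \<open>X (Suc i)\<close>, represented by \<open>v i\<close>, and forms \<open>P i\<close>
  that vanish on \<open>X (Suc i)\<close> but not at \<open>v i\<close>. The ideals of all
  polynomials vanishing at every \<open>v m\<close> with \<open>m \<ge> n\<close> then increase
  strictly with \<open>n\<close>. Evaluating at chosen vectors avoids relating algebraic sets to
  their vanishing ideals.\<close>

lemma palgebraic_dcc: "wf {(A, B). palgebraic A \<and> palgebraic B \<and> A \<subset> (B :: 'n::{finite,linorder} pspace set)}"
proof (rule ccontr)
  assume "\<not> ?thesis"
  then obtain X :: "nat \<Rightarrow> 'n pspace set"
    where "\<forall>i. palgebraic (X i) \<and> palgebraic (X (Suc i)) \<and> X (Suc i) \<subset> X i"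
    by (auto simp: wf_iff_no_infinite_down_chain)
  then have X: "\<And>i. palgebraic (X i)" "\<And>i. X (Suc i) \<subset> X i" by blast+
  have "\<exists>P v p. v \<in> line_of p \<and> p \<in> X i \<and> X (Suc i) \<subseteq> pzeros P \<and> eval_cpoly P v \<noteq> 0" for i
  proof -
    obtain p where p: "p \<in> X i" "p \<notin> X (Suc i)" using X(2)[of i] by blast
    obtain S where S: "X (Suc i) = (\<Inter>P\<in>S. pzeros P)" using X(1)[of "Suc i"] by (auto simp: palgebraic_def)
    then obtain P where "P \<in> S" "p \<notin> pzeros P" using p(2) by blast
    then obtain v where "v \<in> line_of p" "eval_cpoly P v \<noteq> 0" by (auto simp: pzeros_def)
    moreover have "X (Suc i) \<subseteq> pzeros P" using S \<open>P \<in> S\<close> by blast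
    ultimately show ?thesis using p(1) by blast
  qed
  then obtain P v p where P: "\<And>i. v i \<in> line_of (p i)" "\<And>i. p i \<in> X i"
      "\<And>i. X (Suc i) \<subseteq> pzeros (P i)" "\<And>i. eval_cpoly (P i) (v i) \<noteq> 0"
    by metis
  have van: "eval_cpoly (P i) (v m) = 0" if "i < m" for i m
  proof -
    have "X m \<subseteq> X (Suc i)"
      using that X(2) by (intro lift_Suc_antimono_le[of X, OF psubset_imp_subset]) auto
    then have "p m \<in> pzeros (P i)" using P(2)[of m] P(3)[of i] by blast
    then show ?thesis using P(1)[of m] by (simp add: pzeros_def)
  qed
  define I where "I n = {R. \<forall>m\<ge>n. eval_cpoly R (v m) = 0}" for n
  have "\<exists>n. I (Suc n) = I n"
    by (rule ideal_chain_stationary) (auto simp: I_def eval_cpoly_diff eval_cpoly_single_times)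
  then obtain n where "I (Suc n) = I n" by blast
  moreover have "P n \<in> I (Suc n)" using van by (auto simp: I_def)
  moreover have "P n \<notin> I n" using P(4)[of n] by (auto simp: I_def)
  ultimately show False by simp
qed

lemma palgebraic_Inter:
  assumes "\<And>X. X \<in> \<X> \<Longrightarrow> palgebraic X"
  shows "palgebraic (\<Inter>\<X>)"
proof -
  obtain S where S: "\<And>X. X \<in> \<X> \<Longrightarrow> (\<forall>Q\<in>S X. \<exists>d. homogeneous d Q) \<and> X = (\<Inter>Q\<in>S X. pzeros Q)"
    using assms unfolding palgebraic_def by metis
  have "\<Inter>\<X> = (\<Inter>Q\<in>(\<Union>X\<in>\<X>. S X). pzeros Q)" using S by auto
  moreover have "\<forall>Q\<in>(\<Union>X\<in>\<X>. S X). \<exists>d. homogeneous d Q" using S by blast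
  ultimately show ?thesis unfolding palgebraic_def by blast
qed

lemma palgebraic_pzeros: "homogeneous d P \<Longrightarrow> palgebraic (pzeros P)"
  unfolding palgebraic_def by (intro exI[of _ "{P}"]) auto

definition linear_form :: "complex ^ 'n \<Rightarrow> ('n::finite) cpoly" where
  "linear_form a = (\<Sum>i\<in>UNIV. Poly_Mapping.single (Poly_Mapping.single i 1) (a $ i))"

lemma eval_linear_form: "eval_cpoly (linear_form a) x = (\<Sum>i\<in>UNIV. a $ i * x $ i)"
  unfolding linear_form_def by (simp only: eval_cpoly_sum eval_cpoly_linear_monomial)

lemma homogeneous_linear_form: "homogeneous 1 (linear_form a)"
proof -
  have "Poly_Mapping.keys (linear_form a) \<subseteq> (\<Union>i. Poly_Mapping.keys (Poly_Mapping.single (Poly_Mapping.single i (1::nat)) (a $ i)))"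
    unfolding linear_form_def by (rule keys_sum)
  then show ?thesis
    by (auto simp: homogeneous_def lookup_single when_def split: if_splits)
qed

text \<open>The linear forms are the \<open>2 \<times> 2\<close> minors of the matrix with rows
  \<open>v\<close> and \<open>x\<close>; they vanish together exactly on the line of
  \<open>v\<close>.\<close>

lemma palgebraic_singleton: "palgebraic {p :: ('n::finite) pspace}"
proof -
  obtain v where v: "v \<noteq> 0" "p = proj v" by (rule pspace_cases)
  define L where "L i j = linear_form (axis i (v $ j) - axis j (v $ i))" for i j
  have ev: "eval_cpoly (L i j) x = v $ j * x $ i - v $ i * x $ j" for i j x
    by (simp add: L_def eval_linear_form algebra_simps sum_subtractf axis_def if_distrib[of "\<lambda>c. _ * c"] cong: if_cong)
  have hom: "homogeneous 1 (L i j)" for i j unfolding L_def by (rule homogeneous_linear_form)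
  obtain k where k: "v $ k \<noteq> 0" using v(1) by (auto simp: vec_eq_iff)
  have "{p} = (\<Inter>(i, j)\<in>UNIV. pzeros (L i j))"
  proof (intro equalityI subsetI)
    fix x assume "x \<in> {p}"
    then show "x \<in> (\<Inter>(i, j)\<in>UNIV. pzeros (L i j))"
      by (auto simp: v proj_in_pzeros_iff[OF hom v(1)] ev)
  next
    fix x assume x: "x \<in> (\<Inter>(i, j)\<in>UNIV. pzeros (L i j))"
    obtain w where w: "w \<noteq> 0" "x = proj w" by (rule pspace_cases)
    have eq: "v $ j * w $ i = v $ i * w $ j" for i j
      using x proj_in_pzeros_iff[OF hom w(1)] by (auto simp: w ev)
    define c where "c = w $ k / v $ k"
    have wc: "w = c *s v"
      using eq[of k] k by (auto simp: vec_eq_iff c_def field_simps)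
    then have "c \<noteq> 0" using w by auto
    have "vec.span {w} = vec.span {v}"
    proof (intro equalityI vec.span_minimal)
      show "{w} \<subseteq> vec.span {v}" using wc by (simp add: vec.span_base vec.span_scale)
      have "v = inverse c *s w" using wc \<open>c \<noteq> 0\<close> by simp
      then show "{v} \<subseteq> vec.span {w}" by (metis empty_subsetI insert_subset insertI1 vec.span_base vec.span_scale)
    qed auto
    then show "x \<in> {p}" by (simp add: w v proj_def)
  qed
  moreover have "palgebraic (\<Inter>(i, j)\<in>UNIV. pzeros (L i j))"
    by (intro palgebraic_Inter) (auto intro: palgebraic_pzeros[OF hom])
  ultimately show ?thesis by simp
qed

lemma pirreducible_singleton: "pirreducible {p :: ('n::finite) pspace}"
  unfolding pirreducible_def
proof (intro conjI allI impI)
  fix A B assume AB: "palgebraic A \<and> palgebraic B \<and> {p} = A \<union> B"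
  then have "A \<subseteq> {p}" "B \<subseteq> {p}" "p \<in> A \<or> p \<in> B" by blast+
  then show "{p} = A \<or> {p} = B" by blast
qed (use palgebraic_singleton in auto)

text \<open>Among the infinite algebraic subsets take a minimal one, \<open>Z\<close>. It is
  irreducible, because one part of any decomposition is infinite and hence all of \<open>Z\<close>.
  A point of \<open>Z\<close> together with \<open>Z\<close> is a chain of length 1, which dimension
  at most 0 forbids.\<close>

lemma finite_if_pdim_nonpos:
  fixes X :: "('n::{finite,linorder}) pspace set"
  assumes "palgebraic X" "pdim X \<le> 0"
  shows "finite X"
proof (rule ccontr)
  assume inf: "infinite X"
  define \<X> where "\<X> = {Y. palgebraic Y \<and> Y \<subseteq> X \<and> infinite Y}"
  have "X \<in> \<X>" using assms inf by (simp add: \<X>_def)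
  from wfE_min[OF palgebraic_dcc this] obtain Z where Z: "Z \<in> \<X>"
    "\<And>Y. (Y, Z) \<in> {(A, B). palgebraic A \<and> palgebraic B \<and> A \<subset> B} \<Longrightarrow> Y \<notin> \<X>" by blast
  have Z': "palgebraic Z" "Z \<subseteq> X" "infinite Z" using Z(1) by (auto simp: \<X>_def)
  have min: "Y = Z" if "palgebraic Y" "Y \<subseteq> Z" "infinite Y" for Y
    using Z(2)[of Y] that Z' by (auto simp: \<X>_def)
  have "pirreducible Z"
    unfolding pirreducible_def
  proof (intro conjI allI impI)
    fix A B assume AB: "palgebraic A \<and> palgebraic B \<and> Z = A \<union> B"
    then have "infinite A \<or> infinite B" using Z'(3) by auto
    then show "Z = A \<or> Z = B" using min[of A] min[of B] AB by auto
  qed (use Z' in auto)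
  obtain p where p: "p \<in> Z" using Z'(3) by fastforce
  define C where "C i = (if i = 0 then {p} else Z)" for i :: nat
  have "{p} \<subset> Z" using p Z'(3) by (metis finite.emptyI finite_insert empty_subsetI insert_subset psubsetI)
  then have "(\<forall>i\<le>1. pirreducible (C i) \<and> C i \<subseteq> X) \<and> (\<forall>i<1. C i \<subset> C (Suc i))"
    using \<open>pirreducible Z\<close> pirreducible_singleton[of p] Z' p by (auto simp: C_def)
  then have "ereal (real 1) \<le> pdim X"
    unfolding pdim_def by (intro SUP_upper) blast
  also note assms(2)
  finally show False by simp
qed

text \<open>Inductively, to a form avoiding \<open>X\<close> a multiple of a form that is nonzero at
  \<open>p\<close> is added; the latter has the conjugate coordinates of \<open>p\<close> as
  coefficients. A point where it is nonzero rules out one value of the multiple, and at the other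
  points the first form is nonzero.\<close>

lemma linear_form_avoiding_finite:
  fixes X :: "('n::finite) pspace set"
  assumes "finite X"
  shows "\<exists>a. X \<inter> pzeros (linear_form a) = {}"
  using assms
proof (induction X rule: finite_induct)
  case (insert p X)
  then obtain a where a: "X \<inter> pzeros (linear_form a) = {}" by blast
  have "\<exists>v. v \<noteq> 0 \<and> x = proj v" for x :: "'n pspace" by (metis pspace_cases)
  then obtain v where v: "\<And>x::'n pspace. v x \<noteq> 0" "\<And>x::'n pspace. x = proj (v x)" by metis
  have iff: "x \<in> pzeros (linear_form b) \<longleftrightarrow> (\<Sum>i\<in>UNIV. b $ i * v x $ i) = 0" for x b
    using proj_in_pzeros_iff[OF homogeneous_linear_form v(1)] v(2) by (metis eval_linear_form)
  define b where "b = (\<chi> i. cnj (v p $ i))"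
  have "(\<Sum>i\<in>UNIV. b $ i * v p $ i) = of_real (\<Sum>i\<in>UNIV. (cmod (v p $ i))\<^sup>2)"
    unfolding b_def of_real_sum by (intro sum.cong) (simp_all add: complex_norm_square mult.commute del: of_real_power)
  moreover have "(\<Sum>i\<in>UNIV. (cmod (v p $ i))\<^sup>2) \<noteq> 0"
    using v(1)[of p] by (auto simp: sum_nonneg_eq_0_iff vec_eq_iff)
  ultimately have bp: "(\<Sum>i\<in>UNIV. b $ i * v p $ i) \<noteq> 0" by (metis of_real_eq_0_iff)
  define \<beta> where "\<beta> x = (\<Sum>i\<in>UNIV. b $ i * v x $ i)" for x
  define \<alpha> where "\<alpha> x = (\<Sum>i\<in>UNIV. a $ i * v x $ i)" for x
  have "finite ((\<lambda>x. - \<alpha> x / \<beta> x) ` insert p X)" using insert(1) by simp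
  then obtain c where c: "c \<notin> insert 0 ((\<lambda>x. - \<alpha> x / \<beta> x) ` insert p X)"
    by (meson ex_new_if_finite finite_insert infinite_UNIV_char_0)
  have "\<alpha> x + c * \<beta> x \<noteq> 0" if "x \<in> insert p X" for x
  proof (cases "\<beta> x = 0")
    case True
    then have "x \<noteq> p" using bp by (auto simp: \<beta>_def)
    then have "\<alpha> x \<noteq> 0" using that a iff[of x a] by (auto simp: \<alpha>_def)
    then show ?thesis using True by simp
  next
    case False
    show ?thesis
    proof
      assume "\<alpha> x + c * \<beta> x = 0"
      then have "c * \<beta> x = - \<alpha> x" by (simp add: add_eq_0_iff)
      then have "c = - \<alpha> x / \<beta> x" using False by (simp add: field_simps)
      then show False using c that by blast
    qed
  qed
  moreover have "(\<Sum>i\<in>UNIV. (a + c *s b) $ i * v x $ i) = \<alpha> x + c * \<beta> x" for x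
    by (simp add: \<alpha>_def \<beta>_def algebra_simps sum.distrib sum_distrib_left)
  ultimately show ?case
    by (intro exI[of _ "a + c *s b"]) (auto simp: iff)
qed auto

section \<open>Compactness estimates for forms on the cone over \<open>V\<close>\<close>

lemma continuous_on_eval_cpoly: "continuous_on S (eval_cpoly P)"
proof -
  have "continuous_on S (\<lambda>x. \<Sum>a\<in>Poly_Mapping.keys P. Poly_Mapping.lookup P a *
      (\<Prod>i\<in>UNIV. (x $ i) ^ Poly_Mapping.lookup a i))"
    by (intro continuous_intros)
  then show ?thesis by (simp add: eval_cpoly_def[abs_def])
qed

lemma cone_normalize:
  fixes x :: "complex ^ ('n::finite)"
  assumes "x \<noteq> 0"
  obtains y c where "norm y = 1" "x = c *s y" "norm c = norm x" "proj y = proj x"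
proof
  let ?c = "complex_of_real (norm x)"
  let ?y = "inverse ?c *s x"
  have sc: "norm (a *s z) = norm a * norm z" for a :: complex and z :: "complex ^ 'n"
    by (simp add: norm_vec_def norm_mult L2_set_right_distrib)
  have c: "?c \<noteq> 0" using assms by simp
  show "norm ?y = 1" using assms by (simp add: sc norm_inverse)
  show xe: "x = ?c *s ?y" using c by simp
  show "norm ?c = norm x" by simp
  have "vec.span {?y} = vec.span {x}"
  proof (intro equalityI vec.span_minimal)
    show "{?y} \<subseteq> vec.span {x}" by (simp add: vec.span_base vec.span_scale)
    show "{x} \<subseteq> vec.span {?y}"
      by (subst xe) (metis empty_subsetI insert_subset insertI1 vec.span_base vec.span_scale)
  qed auto
  then show "proj ?y = proj x" by (simp add: proj_def)
qed

lemma homogeneous_upper_bound: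
  fixes P :: "('n::finite) cpoly"
  assumes "homogeneous d P"
  shows "\<exists>A>0. \<forall>x. cmod (eval_cpoly P x) \<le> A * norm x ^ d"
proof -
  have "compact (eval_cpoly P ` sphere 0 1)"
    by (intro compact_continuous_image continuous_on_eval_cpoly compact_sphere)
  then obtain A where A: "A > 0" "\<And>x. x \<in> sphere 0 1 \<Longrightarrow> cmod (eval_cpoly P x) \<le> A"
    by (force dest: compact_imp_bounded simp: bounded_pos)
  \<comment> \<open>The second term covers degree 0 at the origin, where \<open>norm x ^ d\<close>
    equals 1.\<close>
  define B where "B = A + cmod (eval_cpoly P 0)"
  have "cmod (eval_cpoly P x) \<le> B * norm x ^ d" for x
  proof (cases "x = 0")
    case True
    have "eval_cpoly P (0 *s 0) = 0 ^ d * eval_cpoly P 0" by (rule eval_cpoly_homogeneous[OF assms])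
    then show ?thesis using True A(1) by (cases d) (auto simp: B_def)
  next
    case False
    then obtain y c where y: "norm y = 1" "x = c *s y" "norm c = norm x" by (rule cone_normalize)
    have "cmod (eval_cpoly P (c *s y)) = norm c ^ d * cmod (eval_cpoly P y)"
      by (simp add: eval_cpoly_homogeneous[OF assms] norm_mult norm_power)
    then have "cmod (eval_cpoly P x) = norm x ^ d * cmod (eval_cpoly P y)"
      using y(2,3) by metis
    also have "\<dots> \<le> norm x ^ d * B"
      using A(2)[of y] y(1) by (intro mult_left_mono) (auto simp: B_def add_increasing2)
    finally show ?thesis by (simp add: mult.commute)
  qed
  moreover have "B > 0" using A(1) by (simp add: B_def add_pos_nonneg)
  ultimately show ?thesis by blast
qed

text \<open>On the unit vectors over \<open>V\<close>, a compact set, the moduli of \<open>P\<close>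
  and of all \<open>Q j\<close> have a sum with positive minimum \<open>m\<close>. Where the
  \<open>Q j\<close> together contribute at most \<open>m / 2\<close>, \<open>P\<close> contributes
  the rest. For a curve this means that near the common zeros of the \<open>Q j\<close> the
  logarithm of \<open>P\<close> differs by a bounded amount from \<open>e\<close> times that of the
  norm.\<close>

lemma homogeneous_lower_bound_near:
  fixes V :: "('n::finite) pspace set"
  assumes V: "palgebraic V" and J: "finite J"
    and Q: "\<And>j. j \<in> J \<Longrightarrow> homogeneous (d j) (Q j)" and P: "homogeneous e P"
    and disj: "V \<inter> (\<Inter>j\<in>J. pzeros (Q j)) \<inter> pzeros P = {}"
  shows "\<exists>\<delta>>0. \<exists>c>0. \<forall>x. x \<noteq> 0 \<longrightarrow> proj x \<in> V \<longrightarrow>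
     (\<forall>j\<in>J. cmod (eval_cpoly (Q j) x) \<le> \<delta> * norm x ^ d j) \<longrightarrow> c * norm x ^ e \<le> cmod (eval_cpoly P x)"
proof -
  obtain S where S: "\<forall>R\<in>S. \<exists>d. homogeneous d R" "V = (\<Inter>R\<in>S. pzeros R)"
    using V by (auto simp: palgebraic_def)
  define K where "K = sphere 0 1 \<inter> (\<Inter>R\<in>S. {x. eval_cpoly R x = 0})"
  define h where "h x = cmod (eval_cpoly P x) + (\<Sum>j\<in>J. cmod (eval_cpoly (Q j) x))" for x
  have inV: "proj x \<in> V \<longleftrightarrow> (\<forall>R\<in>S. eval_cpoly R x = 0)" if "x \<noteq> 0" for x
    using S proj_in_pzeros_iff[OF _ that] by (metis INT_iff)
  have "closed {x. eval_cpoly R x = 0}" for R :: "'n cpoly"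
    by (intro closed_Collect_eq continuous_on_eval_cpoly continuous_on_const)
  then have "compact K" unfolding K_def by (intro compact_Int_closed compact_sphere closed_INT) auto
  have hpos: "h x > 0" if "x \<in> K" for x
  proof (rule ccontr)
    assume "\<not> h x > 0"
    moreover have "0 \<le> (\<Sum>j\<in>J. cmod (eval_cpoly (Q j) x))" by (intro sum_nonneg) auto
    moreover have "0 \<le> cmod (eval_cpoly P x)" by simp
    ultimately have "cmod (eval_cpoly P x) = 0" and "(\<Sum>j\<in>J. cmod (eval_cpoly (Q j) x)) = 0"
      unfolding h_def by linarith+
    then have z: "eval_cpoly P x = 0" "\<And>j. j \<in> J \<Longrightarrow> eval_cpoly (Q j) x = 0"
      using J by (auto simp: sum_nonneg_eq_0_iff)
    have x0: "x \<noteq> 0" using that by (auto simp: K_def)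
    have "proj x \<in> V" using that inV[OF x0] by (auto simp: K_def)
    moreover have "proj x \<in> pzeros (Q j)" if "j \<in> J" for j
      using proj_in_pzeros_iff[OF Q[OF that] x0] z(2)[OF that] by simp
    moreover have "proj x \<in> pzeros P"
      using proj_in_pzeros_iff[OF P x0] z by simp
    ultimately show False using disj by blast
  qed
  have "\<exists>m>0. \<forall>x\<in>K. m \<le> h x"
  proof (cases "K = {}")
    case True
    then show ?thesis by (intro exI[of _ 1]) auto
  next
    case False
    have "continuous_on K h"
      unfolding h_def by (intro continuous_intros continuous_on_eval_cpoly)
    from continuous_attains_inf[OF \<open>compact K\<close> False this] show ?thesis using hpos by blast
  qed
  then obtain m where m: "m > 0" "\<And>x. x \<in> K \<Longrightarrow> m \<le> h x" by blast
  define \<delta> where "\<delta> = m / (2 * (card J + 1))"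
  have \<delta>: "\<delta> > 0" "card J * \<delta> \<le> m / 2"
    using m by (simp_all add: \<delta>_def field_simps)
  have "m / 2 * norm x ^ e \<le> cmod (eval_cpoly P x)"
    if x: "x \<noteq> 0" "proj x \<in> V" "\<forall>j\<in>J. cmod (eval_cpoly (Q j) x) \<le> \<delta> * norm x ^ d j" for x
  proof -
    obtain y c where y: "norm y = 1" "x = c *s y" "norm c = norm x" "proj y = proj x" using x(1) by (rule cone_normalize)
    have sc: "cmod (eval_cpoly R x) = norm x ^ n * cmod (eval_cpoly R y)" if "homogeneous n R" for n R
    proof -
      have "cmod (eval_cpoly R (c *s y)) = norm c ^ n * cmod (eval_cpoly R y)"
        by (simp add: eval_cpoly_homogeneous[OF that] norm_mult norm_power)
      then show ?thesis using y(2,3) by metis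
    qed
    have y0: "y \<noteq> 0" using y(1) by auto
    have "y \<in> K" using y(1,4) inV[OF y0] x(2) by (auto simp: K_def)
    have "cmod (eval_cpoly (Q j) y) \<le> \<delta>" if "j \<in> J" for j
    proof -
      have "norm x ^ d j * cmod (eval_cpoly (Q j) y) \<le> norm x ^ d j * \<delta>"
        using bspec[OF x(3) that] sc[OF Q[OF that]] by (simp add: mult.commute)
      then show ?thesis using x(1) by simp
    qed
    then have "(\<Sum>j\<in>J. cmod (eval_cpoly (Q j) y)) \<le> card J * \<delta>"
      by (rule sum_bounded_above)
    then have "m / 2 \<le> cmod (eval_cpoly P y)"
      using m(2)[OF \<open>y \<in> K\<close>] \<delta>(2) unfolding h_def by linarith
    then have "m / 2 * norm x ^ e \<le> cmod (eval_cpoly P y) * norm x ^ e"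
      by (intro mult_right_mono) auto
    also have "\<dots> = cmod (eval_cpoly P x)"
      using sc[OF P] by (simp add: mult.commute)
    finally show ?thesis .
  qed
  then show ?thesis using \<delta>(1) m(1) by (intro exI[of _ \<delta>] conjI exI[of _ "m/2"]) auto
qed

section \<open>Laplacians and Green's formula on rectangles\<close>

lemma Complex_pair_measurable [measurable]:
  "(\<lambda>(x, y). Complex x y) \<in> borel_measurable (lborel \<Otimes>\<^sub>M lborel)"
proof -
  have "(\<lambda>p::real \<times> real. of_real (fst p) + \<i> * of_real (snd p)) \<in> borel_measurable (borel \<Otimes>\<^sub>M borel)"
    by measurable
  then show ?thesis by (simp add: complex_eq_iff[symmetric] Complex_eq case_prod_beta)
qed

text \<open>Fubini's theorem on complex rectangles rests on this; the two measures agree on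
  boxes.\<close>

lemma lborel_complex: "(lborel :: complex measure) = distr (lborel \<Otimes>\<^sub>M lborel) borel (\<lambda>(x, y). Complex x y)"
proof (rule lborel_eqI)
  fix l u :: complex
  assume le: "\<And>b. b \<in> Basis \<Longrightarrow> l \<bullet> b \<le> u \<bullet> b"
  have "(\<lambda>(x, y). Complex x y) -` box l u = {Re l<..<Re u} \<times> {Im l<..<Im u}"
    by (auto simp: in_box_complex_iff)
  then have "emeasure (distr (lborel \<Otimes>\<^sub>M lborel) borel (\<lambda>(x, y). Complex x y)) (box l u)
      = emeasure (lborel \<Otimes>\<^sub>M lborel) ({Re l<..<Re u} \<times> {Im l<..<Im u})"
    by (subst emeasure_distr) (auto simp: space_pair_measure)
  also have "\<dots> = ennreal (Re u - Re l) * ennreal (Im u - Im l)"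
    using le[of 1] le[of \<i>] by (subst lborel.emeasure_pair_measure_Times) (auto simp: Basis_complex_def)
  also have "\<dots> = ennreal (\<Prod>b\<in>Basis. (u - l) \<bullet> b)"
    using le[of 1] le[of \<i>] by (simp add: Basis_complex_def ennreal_mult)
  finally show "emeasure (distr (lborel \<Otimes>\<^sub>M lborel) borel (\<lambda>(x, y). Complex x y)) (box l u)
      = ennreal (\<Prod>b\<in>Basis. (u - l) \<bullet> b)" by (simp add: prod_ennreal)
qed simp

lemma set_integrable_continuous_cbox:
  fixes f :: "complex \<Rightarrow> real"
  assumes "continuous_on (cbox p q) f"
  shows "set_integrable lborel (cbox p q) f"
  using borel_integrable_compact[OF compact_cbox assms] by (simp add: set_integrable_def indicator_def if_distrib cong: if_cong)

lemma set_integral_cbox_iterated: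
  fixes f :: "complex \<Rightarrow> real"
  assumes "continuous_on (cbox p q) f"
  shows "(LINT z:cbox p q|lborel. f z) = (LBINT y:{Im p..Im q}. LBINT x:{Re p..Re q}. f (Complex x y))"
    and "(LINT z:cbox p q|lborel. f z) = (LBINT x:{Re p..Re q}. LBINT y:{Im p..Im q}. f (Complex x y))"
proof -
  define g where "g z = indicat_real (cbox p q) z * f z" for z
  have "integrable lborel g"
    using set_integrable_continuous_cbox[OF assms] by (simp add: set_integrable_def g_def[abs_def])
  then have [measurable]: "g \<in> borel_measurable borel" by (simp add: borel_measurable_integrable)
  from \<open>integrable lborel g\<close> have int: "integrable (lborel \<Otimes>\<^sub>M lborel) (\<lambda>(x, y). g (Complex x y))"
    by (subst (asm) lborel_complex) (subst (asm) integrable_distr_eq, auto simp: case_prod_beta')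
  have eq: "(LINT z:cbox p q|lborel. f z) = integral\<^sup>L (lborel \<Otimes>\<^sub>M lborel) (\<lambda>(x, y). g (Complex x y))"
    using \<open>integrable lborel g\<close> unfolding set_lebesgue_integral_def
    by (subst lborel_complex) (subst integral_distr, auto simp: case_prod_beta' g_def[abs_def])
  have g: "g (Complex x y) = indicator {Im p..Im q} y * (indicator {Re p..Re q} x * f (Complex x y))" for x y
    by (auto simp: g_def indicator_def in_cbox_complex_iff)
  show "(LINT z:cbox p q|lborel. f z) = (LBINT y:{Im p..Im q}. LBINT x:{Re p..Re q}. f (Complex x y))"
    unfolding eq lborel_pair.integral_snd[OF int, symmetric] by (simp add: g set_lebesgue_integral_def)
  have g': "g (Complex x y) = indicator {Re p..Re q} x * (indicator {Im p..Im q} y * f (Complex x y))" for x y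
    by (simp add: g)
  show "(LINT z:cbox p q|lborel. f z) = (LBINT x:{Re p..Re q}. LBINT y:{Im p..Im q}. f (Complex x y))"
    unfolding eq lborel_pair.integral_fst[OF int, symmetric] by (simp add: g' set_lebesgue_integral_def)
qed

text \<open>The form in which the divergence theorem is used: the integrands are derivatives in one
  coordinate direction of functions that vanish at both ends of each segment.\<close>

lemma set_integral_cbox_zero_if_lines:
  fixes f :: "complex \<Rightarrow> real"
  assumes "continuous_on (cbox p q) f"
    and "(\<forall>y\<in>{Im p..Im q}. (LBINT x:{Re p..Re q}. f (Complex x y)) = 0)
       \<or> (\<forall>x\<in>{Re p..Re q}. (LBINT y:{Im p..Im q}. f (Complex x y)) = 0)"
  shows "(LINT z:cbox p q|lborel. f z) = 0"
  using assms(2)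
proof
  assume *: "\<forall>y\<in>{Im p..Im q}. (LBINT x:{Re p..Re q}. f (Complex x y)) = 0"
  have "(LINT z:cbox p q|lborel. f z) = (LBINT y:{Im p..Im q}. 0)"
    unfolding set_integral_cbox_iterated(1)[OF assms(1)] using * by (intro set_lebesgue_integral_cong) auto
  then show ?thesis by simp
next
  assume *: "\<forall>x\<in>{Re p..Re q}. (LBINT y:{Im p..Im q}. f (Complex x y)) = 0"
  have "(LINT z:cbox p q|lborel. f z) = (LBINT x:{Re p..Re q}. 0)"
    unfolding set_integral_cbox_iterated(2)[OF assms(1)] using * by (intro set_lebesgue_integral_cong) auto
  then show ?thesis by simp
qed

text \<open>\<open>l\<close> is the Laplacian of the \<open>C\<^sup>2\<close> function \<open>v\<close> on \<open>S\<close>; \<open>G\<close> is the gradient of \<open>v\<close>, seen as a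
  complex number, so that the two summands of \<open>l\<close> are the pure second partial derivatives.\<close>

definition laplacian_on :: "complex set \<Rightarrow> (complex \<Rightarrow> real) \<Rightarrow> (complex \<Rightarrow> real) \<Rightarrow> bool" where
  "laplacian_on S v l \<longleftrightarrow> (\<exists>G G'.
     (\<forall>z\<in>S. (v has_derivative (\<lambda>h. G z \<bullet> h)) (at z) \<and> (G has_derivative G' z) (at z)
        \<and> l z = Re (G' z 1) + Im (G' z \<i>))
     \<and> continuous_on S (\<lambda>z. G' z 1) \<and> continuous_on S (\<lambda>z. G' z \<i>))"

lemma laplacian_on_subset: "laplacian_on S v l \<Longrightarrow> T \<subseteq> S \<Longrightarrow> laplacian_on T v l"
  unfolding laplacian_on_def by (meson continuous_on_subset subsetD)

lemma laplacian_on_cong: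
  "laplacian_on S v l \<Longrightarrow> (\<And>z. z \<in> S \<Longrightarrow> l z = l' z) \<Longrightarrow> laplacian_on S v l'"
  unfolding laplacian_on_def by simp

lemma laplacian_on_continuous:
  assumes "laplacian_on S v l"
  shows "continuous_on S v" "continuous_on S l"
proof -
  obtain G G' where
    *: "\<forall>z\<in>S. (v has_derivative (\<lambda>h. G z \<bullet> h)) (at z) \<and> l z = Re (G' z 1) + Im (G' z \<i>)"
    and c: "continuous_on S (\<lambda>z. G' z 1)" "continuous_on S (\<lambda>z. G' z \<i>)"
    using assms unfolding laplacian_on_def by blast
  show "continuous_on S v"
    using * by (meson continuous_at_imp_continuous_on has_derivative_continuous)
  have "continuous_on S (\<lambda>z. Re (G' z 1) + Im (G' z \<i>))"
    by (intro continuous_intros c)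
  then show "continuous_on S l" using * by (simp cong: continuous_on_cong_simp)
qed

lemma laplacian_on_add_cmult:
  assumes "laplacian_on S v l" "laplacian_on S w k"
  shows "laplacian_on S (\<lambda>z. v z + c * w z + b) (\<lambda>z. l z + c * k z)"
proof -
  obtain G G' where
    G: "\<And>z. z \<in> S \<Longrightarrow> (v has_derivative (\<lambda>h. G z \<bullet> h)) (at z)" "\<And>z. z \<in> S \<Longrightarrow> (G has_derivative G' z) (at z)"
      "\<And>z. z \<in> S \<Longrightarrow> l z = Re (G' z 1) + Im (G' z \<i>)"
    and c: "continuous_on S (\<lambda>z. G' z 1)" "continuous_on S (\<lambda>z. G' z \<i>)"
    using assms(1) unfolding laplacian_on_def by metis
  obtain H H' where
    H: "\<And>z. z \<in> S \<Longrightarrow> (w has_derivative (\<lambda>h. H z \<bullet> h)) (at z)" "\<And>z. z \<in> S \<Longrightarrow> (H has_derivative H' z) (at z)"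
      "\<And>z. z \<in> S \<Longrightarrow> k z = Re (H' z 1) + Im (H' z \<i>)"
    and d: "continuous_on S (\<lambda>z. H' z 1)" "continuous_on S (\<lambda>z. H' z \<i>)"
    using assms(2) unfolding laplacian_on_def by metis
  show ?thesis
    unfolding laplacian_on_def
  proof (intro exI[of _ "\<lambda>z. G z + c *\<^sub>R H z"] exI[of _ "\<lambda>z h. G' z h + c *\<^sub>R H' z h"] conjI ballI)
    fix z assume z: "z \<in> S"
    show "((\<lambda>z. v z + c * w z + b) has_derivative (\<lambda>h. (G z + c *\<^sub>R H z) \<bullet> h)) (at z)"
      by (rule has_derivative_eq_rhs, (rule derivative_intros G(1)[OF z] H(1)[OF z])+) (simp add: inner_add_left)
    show "((\<lambda>z. G z + c *\<^sub>R H z) has_derivative (\<lambda>h. G' z h + c *\<^sub>R H' z h)) (at z)"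
      by (intro derivative_intros G(2) H(2) z)
    show "l z + c * k z = Re (G' z 1 + c *\<^sub>R H' z 1) + Im (G' z \<i> + c *\<^sub>R H' z \<i>)"
      by (simp add: G(3) H(3) z algebra_simps)
  qed (intro continuous_intros c d)+
qed

lemma has_real_derivative_Complex_Re:
  assumes "(v has_derivative D) (at (Complex x y))"
  shows "((\<lambda>t. v (Complex t y)) has_real_derivative D 1) (at x within S)"
proof -
  have "((\<lambda>t. Complex t y) has_derivative (\<lambda>h. of_real h)) (at x within S)"
    by (subst Complex_eq, rule has_derivative_eq_rhs, (rule derivative_intros)+) auto
  from has_derivative_compose[OF this assms]
  have "((\<lambda>t. v (Complex t y)) has_derivative (\<lambda>h. D (of_real h))) (at x within S)" .
  moreover have "D (of_real h) = h * D 1" for h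
    using linear_scale[OF has_derivative_linear[OF assms], of h 1] by (simp add: of_real_def)
  ultimately show ?thesis by (simp add: has_field_derivative_def mult_commute_abs)
qed

lemma has_real_derivative_Complex_Im:
  assumes "(v has_derivative D) (at (Complex x y))"
  shows "((\<lambda>t. v (Complex x t)) has_real_derivative D \<i>) (at y within S)"
proof -
  have "((\<lambda>t. Complex x t) has_derivative (\<lambda>h. \<i> * of_real h)) (at y within S)"
    by (subst Complex_eq, rule has_derivative_eq_rhs, (rule derivative_intros)+) auto
  from has_derivative_compose[OF this assms]
  have "((\<lambda>t. v (Complex x t)) has_derivative (\<lambda>h. D (\<i> * of_real h))) (at y within S)" .
  moreover have "D (\<i> * of_real h) = h * D \<i>" for h
    using linear_scale[OF has_derivative_linear[OF assms], of h \<i>] by (simp add: scaleR_conv_of_real mult.commute)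
  ultimately show ?thesis by (simp add: has_field_derivative_def mult_commute_abs)
qed

lemma set_integral_derivative_zero:
  fixes F f :: "real \<Rightarrow> real"
  assumes "\<And>x. x \<in> {a..b} \<Longrightarrow> (F has_real_derivative f x) (at x within {a..b})"
    and "continuous_on {a..b} f" and "F a = F b"
  shows "(LBINT x:{a..b}. f x) = 0"
proof (cases "a \<le> b")
  case True
  have "(LBINT x. indicator {a..b} x *\<^sub>R f x) = F b - F a"
    using True assms(1,2) by (intro integral_FTC_Icc) (auto simp: has_real_derivative_iff_has_vector_derivative)
  then show ?thesis using assms(3) by (simp add: set_lebesgue_integral_def)
qed (simp add: set_lebesgue_integral_def)

text \<open>The weight \<open>\<alpha> (Re z) * \<beta> (Im z)\<close> vanishes on the boundary
  together with its normal derivative, so integrating by parts twice leaves no boundary term. Its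
  product form lets each second derivative be moved along lines.\<close>

lemma green_cbox:
  fixes \<alpha> \<alpha>' \<alpha>'' \<beta> \<beta>' \<beta>'' :: "real \<Rightarrow> real"
  assumes lap: "laplacian_on (cbox p q) v l"
    and \<alpha>: "\<And>x. (\<alpha> has_real_derivative \<alpha>' x) (at x)" "\<And>x. (\<alpha>' has_real_derivative \<alpha>'' x) (at x)"
      "continuous_on UNIV \<alpha>''"
    and \<beta>: "\<And>x. (\<beta> has_real_derivative \<beta>' x) (at x)" "\<And>x. (\<beta>' has_real_derivative \<beta>'' x) (at x)"
      "continuous_on UNIV \<beta>''"
    and zero: "\<alpha> (Re p) = 0" "\<alpha> (Re q) = 0" "\<alpha>' (Re p) = 0" "\<alpha>' (Re q) = 0"
      "\<beta> (Im p) = 0" "\<beta> (Im q) = 0" "\<beta>' (Im p) = 0" "\<beta>' (Im q) = 0"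
  shows "(LINT z:cbox p q|lborel. \<alpha> (Re z) * \<beta> (Im z) * l z)
       = (LINT z:cbox p q|lborel. (\<alpha>'' (Re z) * \<beta> (Im z) + \<alpha> (Re z) * \<beta>'' (Im z)) * v z)"
proof -
  obtain G G' where
    G: "\<And>z. z \<in> cbox p q \<Longrightarrow> (v has_derivative (\<lambda>h. G z \<bullet> h)) (at z)"
       "\<And>z. z \<in> cbox p q \<Longrightarrow> (G has_derivative G' z) (at z)"
       "\<And>z. z \<in> cbox p q \<Longrightarrow> l z = Re (G' z 1) + Im (G' z \<i>)"
    and c: "continuous_on (cbox p q) (\<lambda>z. G' z 1)" "continuous_on (cbox p q) (\<lambda>z. G' z \<i>)"
    using lap unfolding laplacian_on_def by metis
  have cv: "continuous_on (cbox p q) v" using laplacian_on_continuous[OF lap] by simp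
  have c\<alpha>: "continuous_on UNIV \<alpha>" "continuous_on UNIV \<beta>"
    using \<alpha>(1) \<beta>(1) by (meson DERIV_continuous continuous_at_imp_continuous_on)+
  have comp: "continuous_on (cbox p q) (\<lambda>z. \<alpha> (Re z))" "continuous_on (cbox p q) (\<lambda>z. \<alpha>'' (Re z))"
     "continuous_on (cbox p q) (\<lambda>z. \<beta> (Im z))" "continuous_on (cbox p q) (\<lambda>z. \<beta>'' (Im z))"
    using continuous_on_compose2[OF c\<alpha>(1), of "cbox p q" Re] continuous_on_compose2[OF c\<alpha>(2), of "cbox p q" Im]
      continuous_on_compose2[OF \<alpha>(3), of "cbox p q" Re] continuous_on_compose2[OF \<beta>(3), of "cbox p q" Im]
    by (simp_all add: continuous_on_Re continuous_on_Im)
  \<comment> \<open>\<open>f1\<close> is the x-derivative of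
    \<open>\<beta> (\<alpha> v_x - \<alpha>' v)\<close> and \<open>f2\<close> the y-derivative of
    \<open>\<alpha> (\<beta> v_y - \<beta>' v)\<close>; the two sides of the claim differ by the
    integral of \<open>f1 + f2\<close>.\<close>
  define f1 where "f1 z = \<beta> (Im z) * (\<alpha> (Re z) * Re (G' z 1) - \<alpha>'' (Re z) * v z)" for z
  define f2 where "f2 z = \<alpha> (Re z) * (\<beta> (Im z) * Im (G' z \<i>) - \<beta>'' (Im z) * v z)" for z
  have cf: "continuous_on (cbox p q) f1" "continuous_on (cbox p q) f2"
    unfolding f1_def f2_def by (intro continuous_intros comp c cv)+
  have lx: "continuous_on {Re p..Re q} (\<lambda>x. f (Complex x y))" if "continuous_on (cbox p q) f" "y \<in> {Im p..Im q}" for f :: "complex \<Rightarrow> real" and y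
    by (rule continuous_on_compose2[OF that(1)]) (use that(2) in \<open>auto simp: in_cbox_complex_iff Complex_eq intro!: continuous_intros\<close>)
  have ly: "continuous_on {Im p..Im q} (\<lambda>y. f (Complex x y))" if "continuous_on (cbox p q) f" "x \<in> {Re p..Re q}" for f :: "complex \<Rightarrow> real" and x
    by (rule continuous_on_compose2[OF that(1)]) (use that(2) in \<open>auto simp: in_cbox_complex_iff Complex_eq intro!: continuous_intros\<close>)
  have "(LINT z:cbox p q|lborel. f1 z) = 0"
  proof (rule set_integral_cbox_zero_if_lines[OF cf(1)], rule disjI1, rule ballI, rule set_integral_derivative_zero)
    fix y x assume y: "y \<in> {Im p..Im q}" and x: "x \<in> {Re p..Re q}"
    have z: "Complex x y \<in> cbox p q" using x y by (simp add: in_cbox_complex_iff)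
    have d1: "((\<lambda>t. v (Complex t y)) has_real_derivative Re (G (Complex x y))) (at x within {Re p..Re q})"
      using has_real_derivative_Complex_Re[OF G(1)[OF z]] by (simp add: inner_complex_def)
    have d2: "((\<lambda>t. Re (G (Complex t y))) has_real_derivative Re (G' (Complex x y) 1)) (at x within {Re p..Re q})"
      by (rule has_real_derivative_Complex_Re[where v = "\<lambda>z. Re (G z)" and D = "\<lambda>h. Re (G' (Complex x y) h)"])
         (intro derivative_intros G(2)[OF z])
    show "((\<lambda>x. \<beta> y * (\<alpha> x * Re (G (Complex x y)) - \<alpha>' x * v (Complex x y))) has_real_derivative f1 (Complex x y)) (at x within {Re p..Re q})"
      unfolding f1_def
      by (rule DERIV_cong[OF DERIV_cmult[OF DERIV_diff[OF
            DERIV_mult'[OF has_field_derivative_at_within[OF \<alpha>(1)] d2]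
            DERIV_mult'[OF has_field_derivative_at_within[OF \<alpha>(2)] d1]], of "\<beta> y"]]) (simp add: algebra_simps)
  next
    fix y assume y: "y \<in> {Im p..Im q}"
    show "continuous_on {Re p..Re q} (\<lambda>x. f1 (Complex x y))" using lx[OF cf(1) y] .
  qed (use zero in auto)
  moreover have "(LINT z:cbox p q|lborel. f2 z) = 0"
  proof (rule set_integral_cbox_zero_if_lines[OF cf(2)], rule disjI2, rule ballI, rule set_integral_derivative_zero)
    fix x y assume y: "y \<in> {Im p..Im q}" and x: "x \<in> {Re p..Re q}"
    have z: "Complex x y \<in> cbox p q" using x y by (simp add: in_cbox_complex_iff)
    have d1: "((\<lambda>t. v (Complex x t)) has_real_derivative Im (G (Complex x y))) (at y within {Im p..Im q})"
      using has_real_derivative_Complex_Im[OF G(1)[OF z]] by (simp add: inner_complex_def)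
    have d2: "((\<lambda>t. Im (G (Complex x t))) has_real_derivative Im (G' (Complex x y) \<i>)) (at y within {Im p..Im q})"
      by (rule has_real_derivative_Complex_Im[where v = "\<lambda>z. Im (G z)" and D = "\<lambda>h. Im (G' (Complex x y) h)"])
         (intro derivative_intros G(2)[OF z])
    show "((\<lambda>y. \<alpha> x * (\<beta> y * Im (G (Complex x y)) - \<beta>' y * v (Complex x y))) has_real_derivative f2 (Complex x y)) (at y within {Im p..Im q})"
      unfolding f2_def
      by (rule DERIV_cong[OF DERIV_cmult[OF DERIV_diff[OF
            DERIV_mult'[OF has_field_derivative_at_within[OF \<beta>(1)] d2]
            DERIV_mult'[OF has_field_derivative_at_within[OF \<beta>(2)] d1]], of "\<alpha> x"]]) (simp add: algebra_simps)
  next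
    fix x assume x: "x \<in> {Re p..Re q}"
    show "continuous_on {Im p..Im q} (\<lambda>y. f2 (Complex x y))" using ly[OF cf(2) x] .
  qed (use zero in auto)
  ultimately have "(LINT z:cbox p q|lborel. f1 z + f2 z) = 0"
    using cf by (subst set_integral_add) (auto intro: set_integrable_continuous_cbox)
  also have "(LINT z:cbox p q|lborel. f1 z + f2 z) = (LINT z:cbox p q|lborel. \<alpha> (Re z) * \<beta> (Im z) * l z
      - (\<alpha>'' (Re z) * \<beta> (Im z) + \<alpha> (Re z) * \<beta>'' (Im z)) * v z)"
    by (intro set_lebesgue_integral_cong) (auto simp: f1_def f2_def G(3) algebra_simps)
  also have "\<dots> = (LINT z:cbox p q|lborel. \<alpha> (Re z) * \<beta> (Im z) * l z)
       - (LINT z:cbox p q|lborel. (\<alpha>'' (Re z) * \<beta> (Im z) + \<alpha> (Re z) * \<beta>'' (Im z)) * v z)"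
    by (intro set_integral_diff set_integrable_continuous_cbox continuous_intros comp cv laplacian_on_continuous(2)[OF lap])
  finally show ?thesis by simp
qed

section \<open>A mean inequality for functions with Laplacian bounded above\<close>

lemma lborel_integral_affine_complex:
  fixes f :: "complex \<Rightarrow> real"
  assumes [measurable]: "f \<in> borel_measurable borel" and c: "c \<noteq> 0"
  shows "(LINT z|lborel. f z) = c\<^sup>2 * (LINT y|lborel. f (t + c *\<^sub>R y))"
  by (subst lborel_affine[OF c, of t]) (simp add: integral_density integral_distr)

text \<open>Let \<open>A r\<close> be the integral of \<open>w (z0 + r *\<^sub>R y)\<close> against
  the weight \<open>4 * \<kappa> y\<close>. Its derivative in \<open>r\<close> is \<open>r\<close>
  times an integral of the Laplacian with weight in \<open>[0, 1]\<close>, hence at most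
  \<open>4 * M * r\<close>. Going from \<open>r = 0\<close>, where
  \<open>A 0 \<le> 16 * w z0\<close>, to \<open>r = R\<close> bounds the mean of \<open>w\<close> by
  its value at the centre. Smallness at a point thus becomes smallness on average, from the
  one-sided bounds on \<open>l\<close> and \<open>w\<close> alone.\<close>

lemma laplacian_mean_inequality:
  fixes z0 :: complex
  defines "e \<equiv> Complex 1 1"
  assumes lap: "laplacian_on UNIV w l" and R: "R > 0" and M: "M \<ge> 0"
    and l: "\<And>z. z \<in> cbox (z0 - R *\<^sub>R e) (z0 + R *\<^sub>R e) \<Longrightarrow> l z \<le> M"
    and w: "\<And>z. z \<in> cbox (z0 - R *\<^sub>R e) (z0 + R *\<^sub>R e) \<Longrightarrow> 0 \<le> w z"
  shows "(LINT z:cbox (z0 - (R/2) *\<^sub>R e) (z0 + (R/2) *\<^sub>R e)|lborel. w z) \<le> R\<^sup>2 * (8 * w z0 + M * R\<^sup>2)"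
proof -
  obtain G G' where
    G: "\<And>z. (w has_derivative (\<lambda>h. G z \<bullet> h)) (at z)"
       "\<And>z. (G has_derivative G' z) (at z)"
       "\<And>z. l z = Re (G' z 1) + Im (G' z \<i>)"
    and c: "continuous_on UNIV (\<lambda>z. G' z 1)" "continuous_on UNIV (\<lambda>z. G' z \<i>)"
    using lap unfolding laplacian_on_def by auto
  have cw: "continuous_on UNIV w" and cl: "continuous_on UNIV l" using laplacian_on_continuous[OF lap] by auto
  have cG: "continuous_on UNIV G"
    using G(2) by (meson continuous_at_imp_continuous_on has_derivative_continuous)
  define B where "B = cbox (- e) e"
  have Bin: "y \<in> B \<longleftrightarrow> \<bar>Re y\<bar> \<le> 1 \<and> \<bar>Im y\<bar> \<le> 1" for y
    by (auto simp: B_def e_def in_cbox_complex_iff)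
  \<comment> \<open>The weights are chosen so that the gradient of \<open>H\<close> at
    \<open>y\<close> is \<open>- 4 * \<kappa> y\<close> times \<open>y\<close>: the radial
    derivative of \<open>w\<close> tested against \<open>4 * \<kappa>\<close> becomes the Laplacian
    tested against \<open>H\<close>. Both weights vanish outside the unit disc.\<close>
  define \<kappa> where "\<kappa> y = max 0 (1 - (Re y)\<^sup>2 - (Im y)\<^sup>2)" for y
  define H where "H y = (\<kappa> y)\<^sup>2" for y
  have c\<kappa>: "continuous_on S \<kappa>" for S unfolding \<kappa>_def by (intro continuous_intros)
  have cH: "continuous_on S H" for S unfolding H_def by (intro continuous_intros c\<kappa>)
  have \<kappa>01: "0 \<le> \<kappa> y" "\<kappa> y \<le> 1" for y by (auto simp: \<kappa>_def)
  have H01: "0 \<le> H y" "H y \<le> 1" for y using \<kappa>01[of y] by (auto simp: H_def power_le_one)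
  define A where "A r = integral B (\<lambda>y. w (z0 + r *\<^sub>R y) * (4 * \<kappa> y))" for r
  have cr: "continuous_on B (\<lambda>y. f (z0 + r *\<^sub>R y))" if "continuous_on UNIV f" for f :: "complex \<Rightarrow> 'x::topological_space" and r
    by (rule continuous_on_compose2[OF that]) (auto intro!: continuous_intros)
  have conv: "integral B f = (LINT z:B|lborel. f z)" if "continuous_on B f" for f :: "complex \<Rightarrow> real"
    using set_borel_integral_eq_integral(2)[OF set_integrable_continuous_cbox] that by (simp add: B_def)
  have dA: "(A has_real_derivative integral B (\<lambda>y. (G (z0 + r *\<^sub>R y) \<bullet> y) * (4 * \<kappa> y))) (at r)" for r
  proof -
    have "(A has_real_derivative integral B (\<lambda>y. (G (z0 + r *\<^sub>R y) \<bullet> y) * (4 * \<kappa> y))) (at r within UNIV)"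
      unfolding A_def B_def
    proof (rule leibniz_rule_field_derivative)
      fix r y
      have "((\<lambda>r. z0 + r *\<^sub>R y) has_derivative (\<lambda>h. h *\<^sub>R y)) (at r)"
        by (auto intro!: derivative_eq_intros)
      from has_derivative_compose[OF this G(1)]
      have "((\<lambda>r. w (z0 + r *\<^sub>R y)) has_real_derivative (G (z0 + r *\<^sub>R y) \<bullet> y)) (at r)"
        by (simp add: has_field_derivative_def mult_commute_abs)
      then show "((\<lambda>r. w (z0 + r *\<^sub>R y) * (4 * \<kappa> y)) has_real_derivative (G (z0 + r *\<^sub>R y) \<bullet> y) * (4 * \<kappa> y)) (at r within UNIV)"
        using DERIV_cmult_right by blast
    next
      fix r show "(\<lambda>y. w (z0 + r *\<^sub>R y) * (4 * \<kappa> y)) integrable_on cbox (- e) e"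
        using cr[OF cw] unfolding B_def by (intro integrable_continuous continuous_intros c\<kappa>) auto
    next
      have "continuous_on (UNIV \<times> cbox (- e) e) (\<lambda>p. (G (z0 + fst p *\<^sub>R snd p) \<bullet> snd p) * (4 * \<kappa> (snd p)))"
        by (intro continuous_intros continuous_on_compose2[OF cG] continuous_on_compose2[OF c\<kappa>[of UNIV]]) auto
      then show "continuous_on (UNIV \<times> cbox (- e) e) (\<lambda>(r, y). (G (z0 + r *\<^sub>R y) \<bullet> y) * (4 * \<kappa> y))"
        by (simp add: case_prod_beta')
    qed auto
    then show ?thesis by simp
  qed
  have key: "integral B (\<lambda>y. (G (z0 + r *\<^sub>R y) \<bullet> y) * (4 * \<kappa> y)) = r * integral B (\<lambda>y. H y * l (z0 + r *\<^sub>R y))" for r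
  proof -
    \<comment> \<open>\<open>f1\<close> is the x-derivative of \<open>H\<close> times the real part
      of the gradient at \<open>z0 + r *\<^sub>R y\<close>, and \<open>f2\<close> the y-derivative
      of \<open>H\<close> times its imaginary part.\<close>
    define f1 where "f1 y = - 4 * Re y * \<kappa> y * Re (G (z0 + r *\<^sub>R y)) + H y * (r * Re (G' (z0 + r *\<^sub>R y) 1))" for y
    define f2 where "f2 y = - 4 * Im y * \<kappa> y * Im (G (z0 + r *\<^sub>R y)) + H y * (r * Im (G' (z0 + r *\<^sub>R y) \<i>))" for y
    have cf: "continuous_on (cbox (- e) e) f1" "continuous_on (cbox (- e) e) f2"
      unfolding f1_def f2_def B_def[symmetric] by (intro continuous_intros c\<kappa> cH cr cG c)+
    \<comment> \<open>The squared positive part is differentiable also at 0, so \<open>H\<close> can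
      be differentiated across the unit circle.\<close>
    have m: "((\<lambda>x. (max 0 x)\<^sup>2) has_real_derivative 2 * max 0 x) (at x)" for x :: real
    proof (cases x "0::real" rule: linorder_cases)
      case less
      have "((\<lambda>x::real. 0) has_real_derivative 2 * max 0 x) (at x)" using less by (auto intro!: derivative_eq_intros)
      then show ?thesis
        by (rule DERIV_cong_ev[THEN iffD1, rotated -1])
          (use less in \<open>auto intro!: eventually_mono[OF eventually_nhds_in_open[of "{..<0}"]]\<close>)
    next
      case greater
      have "((\<lambda>x::real. x\<^sup>2) has_real_derivative 2 * max 0 x) (at x)" using greater by (auto intro!: derivative_eq_intros)
      then show ?thesis
        by (rule DERIV_cong_ev[THEN iffD1, rotated -1])
          (use greater in \<open>auto intro!: eventually_mono[OF eventually_nhds_in_open[of "{0<..}"]]\<close>)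
    next
      case equal
      have "((\<lambda>h::real. ((max 0 (x + h))\<^sup>2 - (max 0 x)\<^sup>2) / h) \<longlongrightarrow> 0) (at 0)"
      proof (rule Lim_null_comparison)
        show "((\<lambda>h::real. \<bar>h\<bar>) \<longlongrightarrow> 0) (at 0)" by (rule tendsto_eq_intros refl | simp)+
        show "\<forall>\<^sub>F h in at 0. norm (((max 0 (x + h))\<^sup>2 - (max 0 x)\<^sup>2) / h) \<le> \<bar>h\<bar>"
          using equal by (intro always_eventually) (auto simp: max_def power2_eq_square)
      qed
      then show ?thesis using equal by (simp add: DERIV_def)
    qed
    have zc: "z0 + r *\<^sub>R Complex x y = Complex (Re z0 + r * x) (Im z0 + r * y)" for x y by (simp add: complex_eq_iff)
    have lin: "((\<lambda>x. a + r * x) has_real_derivative r) (at x within S)" for a x S by (auto intro!: derivative_eq_intros)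
    have bd: "\<kappa> y = 0" if "\<bar>Re y\<bar> = 1 \<or> \<bar>Im y\<bar> = 1" for y
    proof -
      have "(Re y)\<^sup>2 = 1 \<or> (Im y)\<^sup>2 = 1" using that by (metis one_power2 power2_abs)
      then show ?thesis using zero_le_power2[of "Re y"] zero_le_power2[of "Im y"] by (auto simp: \<kappa>_def)
    qed
    have "(LINT z:cbox (- e) e|lborel. f1 z) = 0"
    proof (rule set_integral_cbox_zero_if_lines[OF cf(1)], rule disjI1, rule ballI, rule set_integral_derivative_zero)
      fix y x
      have d0: "((\<lambda>t. Re (G (Complex t (Im z0 + r * y)))) has_real_derivative Re (G' (Complex (Re z0 + r * x) (Im z0 + r * y)) 1)) (at (Re z0 + r * x))"
        by (rule has_real_derivative_Complex_Re[where v = "\<lambda>z. Re (G z)" and D = "\<lambda>h. Re (G' (Complex (Re z0 + r * x) (Im z0 + r * y)) h)"])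
           (intro derivative_intros G(2))
      have d1: "((\<lambda>x. Re (G (z0 + r *\<^sub>R Complex x y))) has_real_derivative Re (G' (z0 + r *\<^sub>R Complex x y) 1) * r) (at x within S)" for S
        unfolding zc by (rule DERIV_chain2[OF d0 lin])
      have d2: "((\<lambda>x. H (Complex x y)) has_real_derivative 2 * \<kappa> (Complex x y) * (- 2 * x)) (at x within S)" for S
        unfolding H_def \<kappa>_def complex.sel by (rule DERIV_chain2[OF m]) (auto intro!: derivative_eq_intros)
      show "((\<lambda>x. H (Complex x y) * Re (G (z0 + r *\<^sub>R Complex x y))) has_real_derivative f1 (Complex x y)) (at x within {Re (- e)..Re e})"
        by (rule DERIV_cong[OF DERIV_mult'[OF d2 d1]]) (simp add: f1_def algebra_simps)
    next
      fix y assume y: "y \<in> {Im (- e)..Im e}"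
      show "continuous_on {Re (- e)..Re e} (\<lambda>x. f1 (Complex x y))"
        by (rule continuous_on_compose2[OF cf(1)]) (use y in \<open>auto simp: in_cbox_complex_iff Complex_eq intro!: continuous_intros\<close>)
    qed (simp add: H_def bd e_def)
    moreover have "(LINT z:cbox (- e) e|lborel. f2 z) = 0"
    proof (rule set_integral_cbox_zero_if_lines[OF cf(2)], rule disjI2, rule ballI, rule set_integral_derivative_zero)
      fix x y
      have d0: "((\<lambda>t. Im (G (Complex (Re z0 + r * x) t))) has_real_derivative Im (G' (Complex (Re z0 + r * x) (Im z0 + r * y)) \<i>)) (at (Im z0 + r * y))"
        by (rule has_real_derivative_Complex_Im[where v = "\<lambda>z. Im (G z)" and D = "\<lambda>h. Im (G' (Complex (Re z0 + r * x) (Im z0 + r * y)) h)"])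
           (intro derivative_intros G(2))
      have d1: "((\<lambda>y. Im (G (z0 + r *\<^sub>R Complex x y))) has_real_derivative Im (G' (z0 + r *\<^sub>R Complex x y) \<i>) * r) (at y within S)" for S
        unfolding zc by (rule DERIV_chain2[OF d0 lin])
      have d2: "((\<lambda>y. H (Complex x y)) has_real_derivative 2 * \<kappa> (Complex x y) * (- 2 * y)) (at y within S)" for S
        unfolding H_def \<kappa>_def complex.sel by (rule DERIV_chain2[OF m]) (auto intro!: derivative_eq_intros)
      show "((\<lambda>y. H (Complex x y) * Im (G (z0 + r *\<^sub>R Complex x y))) has_real_derivative f2 (Complex x y)) (at y within {Im (- e)..Im e})"
        by (rule DERIV_cong[OF DERIV_mult'[OF d2 d1]]) (simp add: f2_def algebra_simps)
    next
      fix x assume x: "x \<in> {Re (- e)..Re e}"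
      show "continuous_on {Im (- e)..Im e} (\<lambda>y. f2 (Complex x y))"
        by (rule continuous_on_compose2[OF cf(2)]) (use x in \<open>auto simp: in_cbox_complex_iff Complex_eq intro!: continuous_intros\<close>)
    qed (simp add: H_def bd e_def)
    ultimately have "(LINT z:B|lborel. f1 z + f2 z) = 0"
      using cf unfolding B_def by (subst set_integral_add) (auto intro: set_integrable_continuous_cbox)
    also have "(LINT z:B|lborel. f1 z + f2 z) = (LINT y:B|lborel. r * (H y * l (z0 + r *\<^sub>R y)) - (G (z0 + r *\<^sub>R y) \<bullet> y) * (4 * \<kappa> y))"
      by (intro set_lebesgue_integral_cong) (auto simp: f1_def f2_def G(3) inner_complex_def algebra_simps B_def)
    also have "\<dots> = (LINT y:B|lborel. r * (H y * l (z0 + r *\<^sub>R y))) - (LINT y:B|lborel. (G (z0 + r *\<^sub>R y) \<bullet> y) * (4 * \<kappa> y))"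
      unfolding B_def by (intro set_integral_diff set_integrable_continuous_cbox continuous_intros c\<kappa> cH cr[unfolded B_def] cG cl)
    finally show ?thesis
      by (subst (1 2) conv) (auto intro!: continuous_intros c\<kappa> cH cr cG cl)
  qed
  have area: "(LINT z:B|lborel. a) = 4 * a" for a :: real
    unfolding B_def set_integral_cbox_iterated(1)[OF continuous_on_const]
    by (simp add: e_def set_lebesgue_integral_def)
  have sub: "z0 + r *\<^sub>R y \<in> cbox (z0 - R *\<^sub>R e) (z0 + R *\<^sub>R e)" if "y \<in> B" "0 \<le> r" "r \<le> R" for y r
  proof -
    have "\<bar>r * Re y\<bar> \<le> R * 1" "\<bar>r * Im y\<bar> \<le> R * 1"
      using that mult_mono[of r R "\<bar>Re y\<bar>" 1] mult_mono[of r R "\<bar>Im y\<bar>" 1] by (auto simp: Bin abs_mult)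
    then show ?thesis by (auto simp: in_cbox_complex_iff e_def abs_le_iff)
  qed
  have dle: "integral B (\<lambda>y. (G (z0 + r *\<^sub>R y) \<bullet> y) * (4 * \<kappa> y)) \<le> 4 * M * r" if "0 \<le> r" "r \<le> R" for r
  proof -
    have "integral B (\<lambda>y. H y * l (z0 + r *\<^sub>R y)) \<le> (LINT y:B|lborel. M)"
      unfolding conv[OF continuous_on_mult[OF cH cr[OF cl]]] unfolding B_def
    proof (rule set_integral_mono)
      fix y assume y: "y \<in> cbox (- e) e"
      then have "l (z0 + r *\<^sub>R y) \<le> M" using l sub that by (auto simp: B_def)
      then have "H y * l (z0 + r *\<^sub>R y) \<le> H y * M" using H01[of y] by (intro mult_left_mono)
      also have "\<dots> \<le> M" using H01[of y] M by (simp add: mult_left_le_one_le)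
      finally show "H y * l (z0 + r *\<^sub>R y) \<le> M" .
    qed (intro set_integrable_continuous_cbox continuous_intros cH cr[unfolded B_def] cl)+
    also have "(LINT y:B|lborel. M) = 4 * M" by (rule area)
    finally show ?thesis unfolding key using that by (metis mult.assoc mult.commute mult_left_mono)
  qed
  \<comment> \<open>The factor 4 in \<open>dle\<close> is the area of \<open>B\<close>, and
    \<open>2 * M * r\<^sup>2\<close> is an antiderivative of \<open>4 * M * r\<close>.\<close>
  have "A R - 2 * M * R\<^sup>2 \<le> A 0 - 2 * M * 0\<^sup>2"
  proof (rule DERIV_nonpos_imp_nonincreasing[where f = "\<lambda>r. A r - 2 * M * r\<^sup>2"])
    fix r assume r: "0 \<le> r" "r \<le> R"
    show "\<exists>y. ((\<lambda>r. A r - 2 * M * r\<^sup>2) has_real_derivative y) (at r) \<and> y \<le> 0"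
    proof (intro exI conjI)
      have "((\<lambda>r. 2 * M * r\<^sup>2) has_real_derivative 4 * M * r) (at r)"
        by (auto intro!: derivative_eq_intros)
      from DERIV_diff[OF dA this]
      show "((\<lambda>r. A r - 2 * M * r\<^sup>2) has_real_derivative
          integral B (\<lambda>y. (G (z0 + r *\<^sub>R y) \<bullet> y) * (4 * \<kappa> y)) - 4 * M * r) (at r)" .
    qed (use dle[OF r] in simp)
  qed (use R in simp)
  moreover have "A 0 \<le> 16 * w z0"
  proof -
    have w0: "0 \<le> w z0" using w[of z0] R by (auto simp: in_cbox_complex_iff e_def)
    have "A 0 = (LINT y:B|lborel. w z0 * (4 * \<kappa> y))"
      unfolding A_def by (subst conv) (auto intro!: continuous_intros c\<kappa>)
    also have "\<dots> \<le> (LINT y:B|lborel. w z0 * (4 * 1))"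
      unfolding B_def using \<kappa>01 w0 by (intro set_integral_mono set_integrable_continuous_cbox continuous_intros c\<kappa> mult_left_mono) auto
    also have "\<dots> = 16 * w z0" unfolding area by simp
    finally show ?thesis .
  qed
  ultimately have AR: "A R \<le> 16 * w z0 + 2 * M * R\<^sup>2" by simp
  define D where "D = cbox (z0 - (R/2) *\<^sub>R e) (z0 + (R/2) *\<^sub>R e)"
  have [measurable]: "w \<in> borel_measurable borel" using cw by (simp add: borel_measurable_continuous_onI)
  have "(LINT z:D|lborel. w z) = R\<^sup>2 * (LINT y|lborel. indicator D (z0 + R *\<^sub>R y) * w (z0 + R *\<^sub>R y))"
    unfolding set_lebesgue_integral_def using R
    by (subst lborel_integral_affine_complex[of _ R z0]) (auto simp: D_def)
  also have "\<dots> \<le> R\<^sup>2 * (LINT y:B|lborel. w (z0 + R *\<^sub>R y) * (2 * \<kappa> y))"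
    unfolding set_lebesgue_integral_def
  proof (intro mult_left_mono integral_mono')
    show "integrable lborel (\<lambda>y. indicat_real B y *\<^sub>R (w (z0 + R *\<^sub>R y) * (2 * \<kappa> y)))"
      unfolding B_def set_integrable_def[symmetric]
      by (intro set_integrable_continuous_cbox continuous_intros c\<kappa> cr[OF cw, unfolded B_def])
    fix y
    show nn: "0 \<le> indicat_real B y *\<^sub>R (w (z0 + R *\<^sub>R y) * (2 * \<kappa> y))"
      using w sub[of y R] R \<kappa>01[of y] by (auto simp: indicator_def)
    show "indicator D (z0 + R *\<^sub>R y) * w (z0 + R *\<^sub>R y) \<le> indicat_real B y *\<^sub>R (w (z0 + R *\<^sub>R y) * (2 * \<kappa> y))"
    proof (cases "z0 + R *\<^sub>R y \<in> D")
      case True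
      then have y: "\<bar>Re y\<bar> \<le> 1/2" "\<bar>Im y\<bar> \<le> 1/2"
      proof -
        have "R * (2 * Re y) \<le> R * 1" "R * (- 1) \<le> R * (2 * Re y)"
          "R * (2 * Im y) \<le> R * 1" "R * (- 1) \<le> R * (2 * Im y)"
          using True by (auto simp: D_def in_cbox_complex_iff e_def)
        then show "\<bar>Re y\<bar> \<le> 1/2" "\<bar>Im y\<bar> \<le> 1/2"
          unfolding mult_le_cancel_left_pos[OF R] by auto
      qed
      then have yB: "y \<in> B" by (auto simp: Bin)
      \<comment> \<open>On the concentric square of half the size the squared modulus of
        \<open>y\<close> is at most 1/2, so the weight \<open>2 * \<kappa> y\<close> is at least
        1.\<close>
      have "(Re y)\<^sup>2 \<le> (1/2)\<^sup>2" "(Im y)\<^sup>2 \<le> (1/2)\<^sup>2" using y by (auto simp flip: abs_le_square_iff)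
      then have "1 \<le> 2 * \<kappa> y" by (auto simp: \<kappa>_def power2_eq_square)
      moreover have "0 \<le> w (z0 + R *\<^sub>R y)" using w sub[OF yB, of R] R by simp
      ultimately show ?thesis using True yB by (simp add: mult_le_cancel_left1)
    next
      case False then show ?thesis using nn by simp
    qed
  qed simp
  also have "(LINT y:B|lborel. w (z0 + R *\<^sub>R y) * (2 * \<kappa> y)) = A R / 2"
  proof -
    have "A R = (LINT y:B|lborel. w (z0 + R *\<^sub>R y) * (4 * \<kappa> y))"
      unfolding A_def by (rule conv) (intro continuous_intros c\<kappa> cr cw)
    also have "\<dots> = (LINT y:B|lborel. 2 * (w (z0 + R *\<^sub>R y) * (2 * \<kappa> y)))"
      by (simp add: algebra_simps)
    finally show ?thesis by (subst (asm) set_integral_mult_right) simp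
  qed
  also have "R\<^sup>2 * (A R / 2) \<le> R\<^sup>2 * (8 * w z0 + M * R\<^sup>2)"
    using AR by (intro mult_left_mono) auto
  finally show ?thesis by (simp add: D_def)
qed

section \<open>Laplacians of logarithms of holomorphic tuples\<close>

text \<open>One computation with three uses: the full tuple gives
  \<open>log \<parallel>F\<parallel>\<close>, a single function gives a harmonic function, and the
  pair \<open>(g, \<epsilon>)\<close> gives a smooth substitute for
  \<open>log \<bar>g\<bar>\<close>.\<close>

lemma laplacian_log_norm:
  fixes F :: "'i \<Rightarrow> complex \<Rightarrow> complex"
  assumes fin: "finite A" and hol: "\<And>i. i \<in> A \<Longrightarrow> F i holomorphic_on UNIV"
    and pos: "\<And>z. z \<in> T \<Longrightarrow> (\<Sum>i\<in>A. (cmod (F i z))\<^sup>2) \<noteq> 0"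
  shows "laplacian_on T (\<lambda>z. ln (\<Sum>i\<in>A. (cmod (F i z))\<^sup>2) / 2)
    (\<lambda>z. 2 * ((\<Sum>i\<in>A. (cmod (deriv (F i) z))\<^sup>2) / (\<Sum>i\<in>A. (cmod (F i z))\<^sup>2)
           - (cmod (\<Sum>i\<in>A. F i z * cnj (deriv (F i) z)))\<^sup>2 / (\<Sum>i\<in>A. (cmod (F i z))\<^sup>2)\<^sup>2))"
proof -
  define S where "S z = (\<Sum>i\<in>A. (cmod (F i z))\<^sup>2)" for z
  \<comment> \<open>\<open>2 * c z\<close> is the gradient of \<open>S\<close> at \<open>z\<close>,
    seen as a complex number, so \<open>c z / S z\<close> is that of \<open>ln (S z) / 2\<close>;
    \<open>c' z\<close> is the derivative of \<open>c\<close>.\<close>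
  define c where "c z = (\<Sum>i\<in>A. F i z * cnj (deriv (F i) z))" for z
  define c' where "c' z h = (\<Sum>i\<in>A. F i z * cnj (deriv (deriv (F i)) z * h) + deriv (F i) z * h * cnj (deriv (F i) z))" for z h
  have d: "(F i has_derivative (\<lambda>h. deriv (F i) z * h)) (at z)" if "i \<in> A" for i z
    using holomorphic_derivI[OF hol[OF that], of z] by (simp add: has_field_derivative_def)
  have hol': "deriv (F i) holomorphic_on UNIV" if "i \<in> A" for i
    using holomorphic_deriv[OF hol[OF that] open_UNIV] .
  have d2: "(deriv (F i) has_derivative (\<lambda>h. deriv (deriv (F i)) z * h)) (at z)" if "i \<in> A" for i z
    using holomorphic_derivI[OF hol'[OF that], of z] by (simp add: has_field_derivative_def)
  have hol'': "deriv (deriv (F i)) holomorphic_on UNIV" if "i \<in> A" for i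
    using holomorphic_deriv[OF hol'[OF that] open_UNIV] .
  have ch: "continuous_on T (F i)" "continuous_on T (deriv (F i))" "continuous_on T (deriv (deriv (F i)))" if "i \<in> A" for i
    using hol[OF that] hol'[OF that] hol''[OF that]
    by (meson holomorphic_on_imp_continuous_on continuous_on_subset subset_UNIV)+
  have S_inner: "S = (\<lambda>z. \<Sum>i\<in>A. F i z \<bullet> F i z)" by (simp add: S_def fun_eq_iff dot_square_norm)
  have dS: "(S has_derivative (\<lambda>h. 2 * (c z \<bullet> h))) (at z)" for z
  proof -
    have "(S has_derivative (\<lambda>h. \<Sum>i\<in>A. F i z \<bullet> (deriv (F i) z * h) + (deriv (F i) z * h) \<bullet> F i z)) (at z)"
      unfolding S_inner by (intro has_derivative_sum has_derivative_inner d)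
    moreover have "(\<Sum>i\<in>A. F i z \<bullet> (deriv (F i) z * h) + (deriv (F i) z * h) \<bullet> F i z) = 2 * (c z \<bullet> h)" for h
      unfolding c_def inner_sum_left sum_distrib_left
      by (intro sum.cong refl) (simp add: inner_complex_def algebra_simps)
    ultimately show ?thesis by simp
  qed
  have dc: "(c has_derivative c' z) (at z)" for z
    unfolding c_def c'_def by (intro has_derivative_sum has_derivative_mult has_derivative_cnj d d2)
  have Spos: "S z > 0" if "z \<in> T" for z
    using pos[OF that] sum_nonneg[of A "\<lambda>i. (cmod (F i z))\<^sup>2"] unfolding S_def by fastforce
  have cS: "continuous_on T S" unfolding S_def by (intro continuous_intros ch)
  have cc: "continuous_on T c" unfolding c_def by (intro continuous_intros ch)
  have cc': "continuous_on T (\<lambda>z. c' z h)" for h unfolding c'_def by (intro continuous_intros ch)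
  define G' where "G' z h = inverse (S z) *\<^sub>R c' z h - (2 * (c z \<bullet> h) / (S z)\<^sup>2) *\<^sub>R c z" for z h
  have "laplacian_on T (\<lambda>z. ln (S z) / 2) (\<lambda>z. 2 * ((\<Sum>i\<in>A. (cmod (deriv (F i) z))\<^sup>2) / S z - (cmod (c z))\<^sup>2 / (S z)\<^sup>2))"
    unfolding laplacian_on_def
  proof (intro exI[of _ "\<lambda>z. inverse (S z) *\<^sub>R c z"] exI[of _ G'] conjI ballI)
    fix z assume z: "z \<in> T"
    show "((\<lambda>z. ln (S z) / 2) has_derivative (\<lambda>h. (inverse (S z) *\<^sub>R c z) \<bullet> h)) (at z)"
      using Spos[OF z] by (auto intro!: derivative_eq_intros dS simp: field_simps)
    have "((\<lambda>z. inverse (S z)) has_derivative (\<lambda>h. - (2 * (c z \<bullet> h) / (S z)\<^sup>2))) (at z)"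
      by (rule has_derivative_eq_rhs[OF Deriv.has_derivative_inverse[OF _ dS]]) (use Spos[OF z] in \<open>auto simp: power2_eq_square field_simps\<close>)
    from has_derivative_scaleR[OF this dc]
    show "((\<lambda>z. inverse (S z) *\<^sub>R c z) has_derivative G' z) (at z)"
      by (rule has_derivative_eq_rhs) (auto simp: G'_def)
    have "Re (c' z 1) + Im (c' z \<i>) = 2 * (\<Sum>i\<in>A. (cmod (deriv (F i) z))\<^sup>2)"
      unfolding c'_def Re_sum Im_sum sum.distrib[symmetric] sum_distrib_left
      by (intro sum.cong refl) (simp add: cmod_power2, simp add: power2_eq_square algebra_simps)
    moreover have "(c z \<bullet> 1) * Re (c z) + (c z \<bullet> \<i>) * Im (c z) = (cmod (c z))\<^sup>2"
      unfolding cmod_power2 by (simp add: inner_complex_def power2_eq_square)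
    moreover have "Re (G' z 1) + Im (G' z \<i>) = (Re (c' z 1) + Im (c' z \<i>)) / S z
         - 2 * ((c z \<bullet> 1) * Re (c z) + (c z \<bullet> \<i>) * Im (c z)) / (S z)\<^sup>2"
      by (simp add: G'_def field_simps add_divide_distrib diff_divide_distrib)
    ultimately show "2 * ((\<Sum>i\<in>A. (cmod (deriv (F i) z))\<^sup>2) / S z - (cmod (c z))\<^sup>2 / (S z)\<^sup>2) = Re (G' z 1) + Im (G' z \<i>)"
      by (simp add: algebra_simps)
  next
    have S0: "\<forall>z\<in>T. S z \<noteq> 0" "\<forall>z\<in>T. (S z)\<^sup>2 \<noteq> 0" using Spos by force+
    show "continuous_on T (\<lambda>z. G' z 1)" "continuous_on T (\<lambda>z. G' z \<i>)"
      unfolding G'_def by (intro continuous_intros cS cc cc' S0)+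
  qed
  then show ?thesis by (simp only: S_def c_def)
qed

text \<open>For a single function, equality holds in the Cauchy-Schwarz inequality behind the
  general formula.\<close>

lemma laplacian_log_abs:
  assumes hol: "g holomorphic_on UNIV" and nz: "\<And>z. z \<in> T \<Longrightarrow> g z \<noteq> 0"
  shows "laplacian_on T (\<lambda>z. ln (cmod (g z))) (\<lambda>z. 0)"
proof -
  have "laplacian_on T (\<lambda>z. ln (\<Sum>i\<in>{()}. (cmod (g z))\<^sup>2) / 2)
    (\<lambda>z. 2 * ((\<Sum>i\<in>{()}. (cmod (deriv g z))\<^sup>2) / (\<Sum>i\<in>{()}. (cmod (g z))\<^sup>2)
           - (cmod (\<Sum>i\<in>{()}. g z * cnj (deriv g z)))\<^sup>2 / (\<Sum>i\<in>{()}. (cmod (g z))\<^sup>2)\<^sup>2))"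
    by (rule laplacian_log_norm) (use assms in auto)
  moreover have "ln ((cmod (g z))\<^sup>2) / 2 = ln (cmod (g z))" for z
    by (cases "g z = 0") (simp_all add: ln_realpow)
  ultimately have "laplacian_on T (\<lambda>z. ln (cmod (g z)))
     (\<lambda>z. 2 * ((cmod (deriv g z))\<^sup>2 / (cmod (g z))\<^sup>2 - (cmod (g z * cnj (deriv g z)))\<^sup>2 / ((cmod (g z))\<^sup>2)\<^sup>2))"
    by simp
  then show ?thesis
    by (rule laplacian_on_cong) (use nz in \<open>auto simp: norm_mult power_mult_distrib power2_eq_square\<close>)
qed

text \<open>The density is the pull-back by \<open>g\<close> of a kernel that tends to
  \<open>2 * pi\<close> times the point mass at 0 as \<open>\<epsilon>\<close> tends to 0. It is
  nonnegative and continuous, also at the zeros of \<open>g\<close>.\<close>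

lemma laplacian_log_regularized:
  assumes hol: "g holomorphic_on UNIV" and \<epsilon>: "\<epsilon> \<noteq> 0"
  shows "laplacian_on T (\<lambda>z. ln ((cmod (g z))\<^sup>2 + \<epsilon>\<^sup>2) / 2)
    (\<lambda>z. 2 * (cmod (deriv g z))\<^sup>2 * \<epsilon>\<^sup>2 / ((cmod (g z))\<^sup>2 + \<epsilon>\<^sup>2)\<^sup>2)"
proof -
  define F where "F i = (if i then g else (\<lambda>_. of_real \<epsilon>))" for i
  have d: "deriv (F False) z = 0" for z by (simp add: F_def)
  have pos: "(cmod (g z))\<^sup>2 + \<epsilon>\<^sup>2 > 0" for z using \<epsilon> by (simp add: add_nonneg_pos)
  have "laplacian_on T (\<lambda>z. ln (\<Sum>i\<in>UNIV. (cmod (F i z))\<^sup>2) / 2)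
    (\<lambda>z. 2 * ((\<Sum>i\<in>UNIV. (cmod (deriv (F i) z))\<^sup>2) / (\<Sum>i\<in>UNIV. (cmod (F i z))\<^sup>2)
           - (cmod (\<Sum>i\<in>UNIV. F i z * cnj (deriv (F i) z)))\<^sup>2 / (\<Sum>i\<in>UNIV. (cmod (F i z))\<^sup>2)\<^sup>2))"
    by (rule laplacian_log_norm) (use hol pos in \<open>auto simp: F_def UNIV_bool add.commute dest!: less_imp_neq\<close>)
  moreover have "2 * ((\<Sum>i\<in>UNIV. (cmod (deriv (F i) z))\<^sup>2) / (\<Sum>i\<in>UNIV. (cmod (F i z))\<^sup>2)
           - (cmod (\<Sum>i\<in>UNIV. F i z * cnj (deriv (F i) z)))\<^sup>2 / (\<Sum>i\<in>UNIV. (cmod (F i z))\<^sup>2)\<^sup>2)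
       = 2 * (cmod (deriv g z))\<^sup>2 * \<epsilon>\<^sup>2 / ((cmod (g z))\<^sup>2 + \<epsilon>\<^sup>2)\<^sup>2" for z
    using pos[of z] unfolding UNIV_bool by (simp add: d, simp add: F_def norm_mult power_mult_distrib divide_simps power2_eq_square) (simp add: algebra_simps)
  moreover have "(\<Sum>i\<in>UNIV. (cmod (F i z))\<^sup>2) = (cmod (g z))\<^sup>2 + \<epsilon>\<^sup>2" for z
    by (simp add: F_def UNIV_bool)
  ultimately show ?thesis by (simp cong: if_cong)
qed

section \<open>The Laplacian of the logarithm of an entire function\<close>

text \<open>\<open>pi / (2 * s ^ 3)\<close> is the integral over the whole line: the antiderivative
  \<open>P\<close> increases from \<open>- pi / (4 * s ^ 3)\<close> to
  \<open>pi / (4 * s ^ 3)\<close>.\<close>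

lemma kernel_line_integral_le:
  fixes s :: real
  assumes s: "s > 0"
  shows "(LBINT x:{a..b}. 1 / ((x - c)\<^sup>2 + s\<^sup>2)\<^sup>2) \<le> pi / (2 * s ^ 3)"
proof (cases "a \<le> b")
  case True
  define P where "P x = (x - c) / (2 * s\<^sup>2 * ((x - c)\<^sup>2 + s\<^sup>2)) + arctan ((x - c) / s) / (2 * s ^ 3)" for x
  have pos: "(x - c)\<^sup>2 + s\<^sup>2 > 0" for x using s by (simp add: add_nonneg_pos)
  have ne: "((x - c)\<^sup>2 + s\<^sup>2)\<^sup>2 \<noteq> 0" for x using pos[of x] by (metis less_irrefl zero_eq_power2)
  have dP: "(P has_real_derivative 1 / ((x - c)\<^sup>2 + s\<^sup>2)\<^sup>2) (at x)" for x
  proof -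
    have "s * s + (x - c) * (x - c) \<noteq> 0" using pos[of x] unfolding power2_eq_square by linarith
    then show ?thesis
      unfolding P_def using s pos[of x]
      apply (auto intro!: derivative_eq_intros)
      apply (simp add: divide_simps power2_eq_square power3_eq_cube add.commute)
      apply (simp add: algebra_simps eval_nat_numeral)
      done
  qed
  have mono: "P x \<le> P y" if "x \<le> y" for x y
    using that by (rule DERIV_nonneg_imp_nondecreasing) (use dP pos in \<open>auto intro!: exI[of _ "1 / ((_ - c)\<^sup>2 + s\<^sup>2)\<^sup>2"]\<close>)
  have top: "(P \<longlongrightarrow> pi / (4 * s ^ 3)) at_top"
  proof -
    have "(P \<longlongrightarrow> (pi * inverse (s ^ 3) / 4)) at_top"
      unfolding P_def using s by real_asymp
    then show ?thesis by (simp add: field_simps)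
  qed
  have bot: "(P \<longlongrightarrow> - pi / (4 * s ^ 3)) at_bot"
  proof -
    have "(P \<longlongrightarrow> - (pi * inverse (s ^ 3) / 4)) at_bot"
      unfolding P_def using s by real_asymp
    then show ?thesis by (simp add: field_simps)
  qed
  have "P b \<le> pi / (4 * s ^ 3)"
    by (rule tendsto_lowerbound[OF top]) (auto intro!: mono eventually_mono[OF eventually_ge_at_top[of b]])
  moreover have "- pi / (4 * s ^ 3) \<le> P a"
    by (rule tendsto_upperbound[OF bot]) (auto intro!: mono eventually_mono[OF eventually_le_at_bot[of a]])
  moreover have "(LBINT x. indicator {a..b} x *\<^sub>R (1 / ((x - c)\<^sup>2 + s\<^sup>2)\<^sup>2)) = P b - P a"
  proof (rule integral_FTC_Icc[OF True])
    show "continuous_on {a..b} (\<lambda>x. 1 / ((x - c)\<^sup>2 + s\<^sup>2)\<^sup>2)"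
      by (intro continuous_intros ballI ne)
  qed (use dP in \<open>auto simp: has_real_derivative_iff_has_vector_derivative[symmetric] intro: has_field_derivative_at_within\<close>)
  ultimately show ?thesis by (simp add: set_lebesgue_integral_def field_simps)
next
  case False
  then show ?thesis using s by (simp add: set_lebesgue_integral_def)
qed

text \<open>The kernel has mass \<open>2 * pi\<close> in the plane. Integrating in x first leaves
  \<open>pi * \<epsilon>\<^sup>2 / s y ^ 3\<close>, which has the antiderivative
  \<open>pi * P y\<close>, and \<open>P\<close> takes values in \<open>[-1, 1]\<close>.\<close>

lemma kernel_integral_le:
  fixes \<epsilon> :: real
  assumes \<epsilon>: "\<epsilon> > 0"
  shows "(LINT z:cbox p q|lborel. 2 * \<epsilon>\<^sup>2 / ((cmod (z - a))\<^sup>2 + \<epsilon>\<^sup>2)\<^sup>2) \<le> 2 * pi"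
proof -
  define s where "s y = sqrt ((y - Im a)\<^sup>2 + \<epsilon>\<^sup>2)" for y
  have spos: "s y > 0" for y using \<epsilon> by (simp add: s_def add_nonneg_pos)
  have s2: "(s y)\<^sup>2 = (y - Im a)\<^sup>2 + \<epsilon>\<^sup>2" for y by (simp add: s_def)
  have pos: "(cmod (z - a))\<^sup>2 + \<epsilon>\<^sup>2 > 0" for z using \<epsilon> by (simp add: add_nonneg_pos)
  have ne: "((cmod (z - a))\<^sup>2 + \<epsilon>\<^sup>2)\<^sup>2 \<noteq> 0" for z using pos[of z] by (metis less_irrefl zero_eq_power2)
  have cont: "continuous_on (cbox p q) (\<lambda>z. 2 * \<epsilon>\<^sup>2 / ((cmod (z - a))\<^sup>2 + \<epsilon>\<^sup>2)\<^sup>2)"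
    by (intro continuous_intros ballI ne)
  have inner: "(LBINT x:{Re p..Re q}. 2 * \<epsilon>\<^sup>2 / ((cmod (Complex x y - a))\<^sup>2 + \<epsilon>\<^sup>2)\<^sup>2) \<le> pi * (\<epsilon>\<^sup>2 / s y ^ 3)" for y
  proof -
    have "(LBINT x:{Re p..Re q}. 2 * \<epsilon>\<^sup>2 / ((cmod (Complex x y - a))\<^sup>2 + \<epsilon>\<^sup>2)\<^sup>2)
        = (LBINT x:{Re p..Re q}. 2 * \<epsilon>\<^sup>2 * (1 / ((x - Re a)\<^sup>2 + (s y)\<^sup>2)\<^sup>2))"
      by (simp add: cmod_power2 s2 add.assoc)
    also have "\<dots> = 2 * \<epsilon>\<^sup>2 * (LBINT x:{Re p..Re q}. 1 / ((x - Re a)\<^sup>2 + (s y)\<^sup>2)\<^sup>2)"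
      by (rule set_integral_mult_right)
    also have "\<dots> \<le> 2 * \<epsilon>\<^sup>2 * (pi / (2 * s y ^ 3))"
      by (intro mult_left_mono kernel_line_integral_le spos) simp
    finally show ?thesis by (simp add: mult.commute)
  qed
  define P where "P y = (y - Im a) / s y" for y
  have P1: "\<bar>P y\<bar> \<le> 1" for y
  proof -
    have "\<bar>y - Im a\<bar> \<le> s y" unfolding s_def by (rule real_le_rsqrt) simp
    then show ?thesis using spos[of y] by (simp add: P_def abs_divide divide_le_eq_1)
  qed
  have cs: "continuous_on S s" for S unfolding s_def by (intro continuous_intros)
  have s3: "s y ^ 3 \<noteq> 0" for y using spos[of y] by simp
  have c3: "continuous_on S (\<lambda>y. \<epsilon>\<^sup>2 / s y ^ 3)" for S
    by (intro continuous_intros cs ballI s3)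
  have dP: "(P has_real_derivative \<epsilon>\<^sup>2 / s y ^ 3) (at y)" for y
  proof -
    have ds: "(s has_real_derivative (y - Im a) / s y) (at y)"
    proof -
      have "(s has_real_derivative (inverse (s y) / 2) * (2 * (y - Im a))) (at y)"
        unfolding s_def by (rule DERIV_chain2[OF DERIV_real_sqrt]) (use \<epsilon> in \<open>auto intro!: derivative_eq_intros add_nonneg_pos\<close>)
      moreover have "inverse u / 2 * (2 * t) = t / u" for u t :: real by (simp add: field_simps)
      ultimately show ?thesis by (simp only:)
    qed
    have "(P has_real_derivative (1 * s y - (y - Im a) * ((y - Im a) / s y)) / (s y * s y)) (at y)"
      unfolding P_def using spos[of y] by (intro DERIV_divide ds) (auto intro!: derivative_eq_intros)
    moreover have "(1 * s y - (y - Im a) * ((y - Im a) / s y)) / (s y * s y) = ((s y)\<^sup>2 - (y - Im a)\<^sup>2) / s y ^ 3"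
      using spos[of y] by (simp add: field_simps power2_eq_square power3_eq_cube)
    ultimately show ?thesis by (simp add: s2)
  qed
  have outer: "(LBINT y:{Im p..Im q}. pi * (\<epsilon>\<^sup>2 / s y ^ 3)) \<le> 2 * pi"
  proof (cases "Im p \<le> Im q")
    case True
    have "(LBINT y. indicator {Im p..Im q} y *\<^sub>R (\<epsilon>\<^sup>2 / s y ^ 3)) = P (Im q) - P (Im p)"
      by (rule integral_FTC_Icc[OF True])
         (use dP c3 in \<open>auto simp: has_real_derivative_iff_has_vector_derivative[symmetric] intro: has_field_derivative_at_within\<close>)
    also have "\<dots> \<le> 2" using P1[of "Im p"] P1[of "Im q"] by linarith
    finally have "pi * (LBINT y:{Im p..Im q}. \<epsilon>\<^sup>2 / s y ^ 3) \<le> pi * 2"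
      unfolding set_lebesgue_integral_def by (intro mult_left_mono) auto
    then show ?thesis by (subst set_integral_mult_right) (simp add: mult.commute)
  qed (simp add: set_lebesgue_integral_def)
  have "(LINT z:cbox p q|lborel. 2 * \<epsilon>\<^sup>2 / ((cmod (z - a))\<^sup>2 + \<epsilon>\<^sup>2)\<^sup>2)
     \<le> (LBINT y:{Im p..Im q}. pi * (\<epsilon>\<^sup>2 / s y ^ 3))"
    unfolding set_integral_cbox_iterated(1)[OF cont] set_lebesgue_integral_def[of _ "{Im p..Im q}"]
  proof (rule integral_mono')
    show "integrable lborel (\<lambda>y. indicator {Im p..Im q} y *\<^sub>R (pi * (\<epsilon>\<^sup>2 / s y ^ 3)))"
      unfolding set_integrable_def[symmetric]
      by (intro borel_integrable_atLeastAtMost' continuous_on_mult continuous_on_const c3)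
  qed (use inner spos in \<open>auto simp: indicator_def less_imp_le\<close>)
  with outer show ?thesis by simp
qed

lemma integrable_log_abs_interval: "set_integrable lborel {a..b} (\<lambda>x::real. ln \<bar>x - c\<bar>)"
proof (cases "a \<le> b")
  case True
  define K where "K = \<bar>a\<bar> + \<bar>b\<bar> + \<bar>c\<bar> + 1"
  define P where "P x = K * x - ((x - c) * ln \<bar>x - c\<bar> - x)" for x
  have "((\<lambda>x. K - ln \<bar>x - c\<bar>) has_integral (P b - P a)) {a..b}"
  proof (rule fundamental_theorem_of_calculus_strong[of "{c}"])
    have c0: "((\<lambda>x::real. x * ln \<bar>x\<bar>) \<longlongrightarrow> 0) (at 0)"
    proof -
      have "((\<lambda>x::real. x * ln \<bar>x\<bar>) \<longlongrightarrow> 0) (at_right 0)" by real_asymp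
      moreover have "((\<lambda>x::real. x * ln \<bar>x\<bar>) \<longlongrightarrow> 0) (at_left 0)" by real_asymp
      ultimately show ?thesis by (simp add: filterlim_split_at)
    qed
    have "isCont (\<lambda>x::real. x * ln \<bar>x\<bar>) x" for x
    proof (cases "x = 0")
      case True then show ?thesis using c0 by (simp add: isCont_def)
    next
      case False then show ?thesis by (intro continuous_intros) auto
    qed
    then have "continuous_on UNIV (\<lambda>x::real. x * ln \<bar>x\<bar>)" by (simp add: continuous_at_imp_continuous_on)
    then have c1: "continuous_on {a..b} (\<lambda>x. (x - c) * ln \<bar>x - c\<bar>)"
      by (rule continuous_on_compose2[where f = "\<lambda>x. x - c"]) (auto intro!: continuous_intros)
    show "continuous_on {a..b} P" unfolding P_def
      by (rule continuous_on_diff[OF _ continuous_on_diff[OF c1 continuous_on_id]]) (intro continuous_intros)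
    fix x assume x: "x \<in> {a..b} - {c}"
    have "((\<lambda>x. ln \<bar>x - c\<bar>) has_real_derivative 1 / (x - c)) (at x)"
    proof (cases "x < c")
      case True
      then have "((\<lambda>x. ln (c - x)) has_real_derivative 1 / (x - c)) (at x)"
        by (auto intro!: derivative_eq_intros simp: field_simps)
      then show ?thesis
        by (rule has_field_derivative_transform_within_open[where S = "{..<c}"]) (use True in auto)
    next
      case False
      then have "((\<lambda>x. ln (x - c)) has_real_derivative 1 / (x - c)) (at x)"
        using x by (auto intro!: derivative_eq_intros simp: field_simps)
      then show ?thesis
        by (rule has_field_derivative_transform_within_open[where S = "{c<..}"]) (use False x in auto)
    qed
    then have "(P has_real_derivative K - ln \<bar>x - c\<bar>) (at x)"
      unfolding P_def
      by (rule DERIV_cong[OF DERIV_diff[OF DERIV_cmult[OF DERIV_ident]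
            DERIV_diff[OF DERIV_mult'[OF DERIV_diff[OF DERIV_ident DERIV_const]] DERIV_ident]]])
         (use x in simp)
    then show "(P has_vector_derivative K - ln \<bar>x - c\<bar>) (at x)"
      by (simp add: has_real_derivative_iff_has_vector_derivative)
  qed (use True in auto)
  then have "(\<lambda>x. K - ln \<bar>x - c\<bar>) integrable_on {a..b}" by blast
  moreover have "0 \<le> K - ln \<bar>x - c\<bar>" if "x \<in> {a..b}" for x
  proof (cases "x = c")
    case False
    then have "ln \<bar>x - c\<bar> \<le> \<bar>x - c\<bar> - 1" by (intro ln_le_minus_one) auto
    then show ?thesis using that by (auto simp: K_def)
  qed (simp add: K_def)
  ultimately have "(\<lambda>x. K - ln \<bar>x - c\<bar>) absolutely_integrable_on {a..b}"
    by (rule nonnegative_absolutely_integrable_1)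
  then have "integrable lborel (\<lambda>x. indicator {a..b} x *\<^sub>R (K - ln \<bar>x - c\<bar>))"
    unfolding set_integrable_def by (subst (asm) integrable_completion) auto
  then have 1: "set_integrable lborel {a..b} (\<lambda>x. K - ln \<bar>x - c\<bar>)" by (simp add: set_integrable_def)
  have 2: "set_integrable lborel {a..b} (\<lambda>x. K)" by (intro borel_integrable_atLeastAtMost') auto
  from set_integral_diff(1)[OF 2 1] show ?thesis by simp
qed (simp add: set_integrable_def)

lemma set_integrable_cbox_of_Re:
  fixes f :: "real \<Rightarrow> real"
  assumes f: "set_integrable lborel {Re p..Re q} f" and [measurable]: "f \<in> borel_measurable borel"
  shows "set_integrable lborel (cbox p q) (\<lambda>z. f (Re z))"
proof -
  define g where "g x = indicator {Re p..Re q} x * f x" for x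
  have g: "integrable lborel g" using f by (simp add: set_integrable_def g_def[abs_def])
  define k where "k y = indicat_real {Im p..Im q} y" for y
  have k: "integrable lborel k" by (simp add: k_def[abs_def] integrable_indicator_iff emeasure_lborel_Icc_eq)
  have [measurable]: "g \<in> borel_measurable borel" "k \<in> borel_measurable borel"
    using g k by (auto dest: borel_measurable_integrable)
  have "integrable (lborel \<Otimes>\<^sub>M lborel) (\<lambda>(x, y). g x * k y)"
  proof (rule lborel_pair.Fubini_integrable)
    show "integrable lborel (\<lambda>x. \<integral>y. norm (case (x, y) of (x, y) \<Rightarrow> g x * k y) \<partial>lborel)"
      using g by (simp add: abs_mult)
  qed (use k in auto)
  then have "integrable (distr (lborel \<Otimes>\<^sub>M lborel) borel (\<lambda>(x, y). Complex x y)) (\<lambda>z. g (Re z) * k (Im z))"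
    by (subst integrable_distr_eq) (auto simp: case_prod_beta')
  then have "integrable lborel (\<lambda>z. g (Re z) * k (Im z))" by (simp flip: lborel_complex)
  then show ?thesis
    unfolding set_integrable_def
    by (rule back_subst[of "integrable lborel"]) (auto simp: g_def k_def indicator_def in_cbox_complex_iff fun_eq_iff)
qed

section \<open>Zeros of entire functions\<close>

lemma entire_finite_zeros:
  fixes g :: "complex \<Rightarrow> complex"
  assumes g: "g holomorphic_on UNIV" and nz: "\<exists>z. g z \<noteq> 0" and K: "compact K"
  shows "finite {z \<in> K. g z = 0}"
proof (cases "g constant_on UNIV")
  case True
  then have "{z \<in> K. g z = 0} = {}" using nz by (auto simp: constant_on_def)
  then show ?thesis by (metis finite.emptyI)
next
  case False
  then show ?thesis using holomorphic_compact_finite_zeros[OF g open_UNIV connected_UNIV K] by simp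
qed

lemma entire_factor_zero:
  fixes g :: "complex \<Rightarrow> complex"
  assumes g: "g holomorphic_on UNIV" and nz: "\<exists>z. g z \<noteq> 0"
  obtains h where "h holomorphic_on UNIV" "h a \<noteq> 0" "\<And>z. g z = (z - a) ^ nat (zorder g a) * h z"
proof -
  define n where "n = nat (zorder g a)"
  have "\<exists>w\<in>UNIV. g w \<noteq> 0" using nz by blast
  from zorder_exist_zero[OF g open_UNIV connected_UNIV UNIV_I this, of a]
  obtain r where r: "r > 0" "zor_poly g a holomorphic_on cball a r"
    "\<And>w. w \<in> cball a r \<Longrightarrow> g w = zor_poly g a w * (w - a) ^ n \<and> zor_poly g a w \<noteq> 0"
    unfolding n_def by blast
  define h where "h z = (if z \<in> ball a r then zor_poly g a z else g z / (z - a) ^ n)" for z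
  have h2: "h z = g z / (z - a) ^ n" if "z \<noteq> a" for z
    using r(3)[of z] that by (auto simp: h_def)
  have "h holomorphic_on ball a r"
    by (rule holomorphic_transform[OF holomorphic_on_subset[OF r(2)]]) (auto simp: h_def)
  moreover have "h holomorphic_on (- {a})"
    by (rule holomorphic_transform[of "\<lambda>z. g z / (z - a) ^ n"])
       (auto simp: h2 intro!: holomorphic_intros holomorphic_on_subset[OF g])
  ultimately have "h holomorphic_on (ball a r \<union> - {a})"
    by (intro holomorphic_on_Un) auto
  also have "ball a r \<union> - {a} = UNIV" using r(1) by auto
  finally have "h holomorphic_on UNIV" .
  moreover have "h a \<noteq> 0" using r by (auto simp: h_def)
  moreover have "g z = (z - a) ^ n * h z" for z
  proof (cases "z = a")
    case True
    then show ?thesis using r(3)[of a] r(1) by (simp add: h_def)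
  qed (simp add: h2)
  ultimately show ?thesis using that by (simp add: n_def)
qed

lemma entire_factor_zeros:
  fixes g :: "complex \<Rightarrow> complex"
  assumes g: "g holomorphic_on UNIV" and nz: "\<exists>z. g z \<noteq> 0" and "finite A"
  shows "\<exists>h. h holomorphic_on UNIV \<and> (\<forall>a\<in>A. h a \<noteq> 0) \<and> (\<forall>z. g z = (\<Prod>a\<in>A. (z - a) ^ nat (zorder g a)) * h z)"
  using assms(3)
proof (induction A rule: finite_induct)
  case empty
  then show ?case using g by auto
next
  case (insert b A)
  then obtain h where h: "h holomorphic_on UNIV" "\<forall>a\<in>A. h a \<noteq> 0" "\<And>z. g z = (\<Prod>a\<in>A. (z - a) ^ nat (zorder g a)) * h z"
    by blast
  have "\<exists>z. h z \<noteq> 0" using nz h(3) by auto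
  then obtain k where k: "k holomorphic_on UNIV" "k b \<noteq> 0" "\<And>z. h z = (z - b) ^ nat (zorder h b) * k z"
    using entire_factor_zero[OF h(1), of b] by blast
  \<comment> \<open>Dividing out the points of \<open>A\<close> leaves the order at \<open>b\<close>
    unchanged, since those factors are nonzero at \<open>b\<close>.\<close>
  have "zorder g b = int (nat (zorder h b))"
  proof (rule zorder_eqI[of UNIV _ "\<lambda>z. (\<Prod>a\<in>A. (z - a) ^ nat (zorder g a)) * k z"])
    show "(\<lambda>z. (\<Prod>a\<in>A. (z - a) ^ nat (zorder g a)) * k z) holomorphic_on UNIV"
      by (intro holomorphic_intros k(1))
    show "(\<Prod>a\<in>A. (b - a) ^ nat (zorder g a)) * k b \<noteq> 0"
      using insert k(2) by (auto simp: prod_zero_iff)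
  next
    fix w :: complex assume "w \<noteq> b"
    show "g w = (\<Prod>a\<in>A. (w - a) ^ nat (zorder g a)) * k w * (w - b) powi int (nat (zorder h b))"
      by (subst h(3), subst k(3)) (simp only: power_int_of_nat mult_ac)
  qed simp_all
  then have eq: "nat (zorder g b) = nat (zorder h b)" by simp
  have "g z = (\<Prod>a\<in>insert b A. (z - a) ^ nat (zorder g a)) * k z" for z
    using insert by (simp add: h(3)[of z] eq) (simp add: k(3)[of z] mult_ac)
  moreover have "k a \<noteq> 0" if "a \<in> insert b A" for a
    using that k h(2) by (cases "a = b") (auto simp: k(3)[of a])
  ultimately show ?case using k(1) by blast
qed

section \<open>The Laplacian of \<open>log \<bar>g\<bar>\<close> against test functions\<close>

locale test_function =
  fixes p q :: complex and \<alpha> \<alpha>' \<alpha>'' \<beta> \<beta>' \<beta>'' :: "real \<Rightarrow> real"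
  assumes \<alpha>: "\<And>x. (\<alpha> has_real_derivative \<alpha>' x) (at x)" "\<And>x. (\<alpha>' has_real_derivative \<alpha>'' x) (at x)"
      "continuous_on UNIV \<alpha>''"
    and \<beta>: "\<And>x. (\<beta> has_real_derivative \<beta>' x) (at x)" "\<And>x. (\<beta>' has_real_derivative \<beta>'' x) (at x)"
      "continuous_on UNIV \<beta>''"
    and zero: "\<alpha> (Re p) = 0" "\<alpha> (Re q) = 0" "\<alpha>' (Re p) = 0" "\<alpha>' (Re q) = 0"
      "\<beta> (Im p) = 0" "\<beta> (Im q) = 0" "\<beta>' (Im p) = 0" "\<beta>' (Im q) = 0"
    and nonneg: "\<And>z. z \<in> cbox p q \<Longrightarrow> 0 \<le> \<alpha> (Re z) * \<beta> (Im z)"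
begin

definition \<phi> :: "complex \<Rightarrow> real" where "\<phi> z = \<alpha> (Re z) * \<beta> (Im z)"

definition lap_\<phi> :: "complex \<Rightarrow> real" where
  "lap_\<phi> z = \<alpha>'' (Re z) * \<beta> (Im z) + \<alpha> (Re z) * \<beta>'' (Im z)"

lemma continuous_test: "continuous_on S \<phi>" "continuous_on S lap_\<phi>"
proof -
  have c: "continuous_on UNIV \<alpha>" "continuous_on UNIV \<beta>"
    using \<alpha>(1) \<beta>(1) by (meson DERIV_continuous continuous_at_imp_continuous_on)+
  have comp: "continuous_on S (\<lambda>z. \<alpha> (Re z))" "continuous_on S (\<lambda>z. \<alpha>'' (Re z))"
     "continuous_on S (\<lambda>z. \<beta> (Im z))" "continuous_on S (\<lambda>z. \<beta>'' (Im z))"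
    using continuous_on_compose2[OF c(1), of S Re] continuous_on_compose2[OF c(2), of S Im]
      continuous_on_compose2[OF \<alpha>(3), of S Re] continuous_on_compose2[OF \<beta>(3), of S Im]
    by (simp_all add: continuous_on_Re continuous_on_Im)
  show "continuous_on S \<phi>" "continuous_on S lap_\<phi>"
    unfolding \<phi>_def lap_\<phi>_def by (intro continuous_intros comp)+
qed

lemma green:
  assumes "laplacian_on (cbox p q) v l"
  shows "(LINT z:cbox p q|lborel. \<phi> z * l z) = (LINT z:cbox p q|lborel. lap_\<phi> z * v z)"
  unfolding \<phi>_def lap_\<phi>_def by (rule green_cbox[OF assms \<alpha> \<beta> zero])

text \<open>Dominated convergence: where \<open>g z\<close> is nonzero, the regularized logarithm
  lies between \<open>ln (cmod (g z))\<close> and a constant \<open>C\<close> coming from a bound of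
  \<open>g\<close> on the rectangle.\<close>

lemma log_regularized_limit:
  fixes g :: "complex \<Rightarrow> complex"
  assumes int: "set_integrable lborel (cbox p q) (\<lambda>z. ln (cmod (g z)))"
    and cont: "continuous_on UNIV g" and nz: "AE z in lborel. g z \<noteq> 0"
  shows "(\<lambda>n. LINT z:cbox p q|lborel. lap_\<phi> z * (ln ((cmod (g z))\<^sup>2 + (1 / real (Suc n))\<^sup>2) / 2))
     \<longlonglongrightarrow> (LINT z:cbox p q|lborel. lap_\<phi> z * ln (cmod (g z)))"
proof -
  have cg: "continuous_on (cbox p q) g" using cont continuous_on_subset by blast
  have [measurable]: "g \<in> borel_measurable borel" "lap_\<phi> \<in> borel_measurable borel"
    using cont continuous_test by (auto intro: borel_measurable_continuous_onI)
  obtain B where B: "B > 0" "\<And>z. z \<in> cbox p q \<Longrightarrow> cmod (g z) \<le> B"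
    using compact_imp_bounded[OF compact_continuous_image[OF cg compact_cbox]] by (auto simp: bounded_pos)
  obtain M where M: "M > 0" "\<And>z. z \<in> cbox p q \<Longrightarrow> \<bar>lap_\<phi> z\<bar> \<le> M"
    using compact_imp_bounded[OF compact_continuous_image[OF continuous_test(2) compact_cbox[of p q]]] by (auto simp: bounded_pos)
  define C where "C = ln (B\<^sup>2 + 1) / 2"
  have C0: "C \<ge> 0" by (simp add: C_def)
  have bound: "\<bar>ln ((cmod (g z))\<^sup>2 + (1 / real (Suc n))\<^sup>2) / 2\<bar> \<le> C + \<bar>ln (cmod (g z))\<bar>"
    if z: "z \<in> cbox p q" "g z \<noteq> 0" for z n
  proof -
    have e: "(1 / real (Suc n))\<^sup>2 \<le> 1" "0 < (1 / real (Suc n))\<^sup>2" by (auto simp: power_le_one)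
    have "(cmod (g z))\<^sup>2 \<le> B\<^sup>2" using B z by (intro power_mono) auto
    moreover have "0 < B\<^sup>2 + 1" by (simp add: add_nonneg_pos)
    ultimately have "ln ((cmod (g z))\<^sup>2 + (1 / real (Suc n))\<^sup>2) \<le> ln (B\<^sup>2 + 1)"
      using e z by (subst ln_le_cancel_iff) (auto intro: add_pos_pos simp del: of_nat_Suc)
    moreover have "ln ((cmod (g z))\<^sup>2) \<le> ln ((cmod (g z))\<^sup>2 + (1 / real (Suc n))\<^sup>2)"
      using e z by (subst ln_le_cancel_iff) (auto intro: add_pos_pos simp del: of_nat_Suc)
    then have "2 * ln (cmod (g z)) \<le> ln ((cmod (g z))\<^sup>2 + (1 / real (Suc n))\<^sup>2)"
      using z by (simp add: ln_realpow)
    ultimately show ?thesis using C0 unfolding C_def by linarith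
  qed
  show ?thesis
    unfolding set_lebesgue_integral_def
  proof (rule integral_dominated_convergence[where w = "\<lambda>z. M * (indicator (cbox p q) z *\<^sub>R (C + \<bar>ln (cmod (g z))\<bar>))"])
    show "integrable lborel (\<lambda>z. M * (indicator (cbox p q) z *\<^sub>R (C + \<bar>ln (cmod (g z))\<bar>)))"
    proof -
      have "set_integrable lborel (cbox p q) (\<lambda>z. C)" by (rule set_integrable_continuous_cbox) auto
      moreover have "set_integrable lborel (cbox p q) (\<lambda>z. \<bar>ln (cmod (g z))\<bar>)" using int by (rule set_integrable_abs)
      ultimately have "set_integrable lborel (cbox p q) (\<lambda>z. C + \<bar>ln (cmod (g z))\<bar>)" by (rule set_integral_add)
      then show ?thesis unfolding set_integrable_def by (rule integrable_mult_right)
    qed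
    show "AE z in lborel. (\<lambda>n. indicat_real (cbox p q) z *\<^sub>R (lap_\<phi> z * (ln ((cmod (g z))\<^sup>2 + (1 / real (Suc n))\<^sup>2) / 2)))
       \<longlonglongrightarrow> indicat_real (cbox p q) z *\<^sub>R (lap_\<phi> z * ln (cmod (g z)))"
      using nz
    proof eventually_elim
      fix z assume z: "g z \<noteq> 0"
      have "(\<lambda>n. ln ((cmod (g z))\<^sup>2 + (1 / real (Suc n))\<^sup>2) / 2) \<longlonglongrightarrow> ln ((cmod (g z))\<^sup>2 + 0\<^sup>2) / 2"
        using z by (intro tendsto_intros LIMSEQ_Suc[OF lim_1_over_n]) auto
      also have "ln ((cmod (g z))\<^sup>2 + 0\<^sup>2) / 2 = ln (cmod (g z))" using z by (simp add: ln_realpow)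
      finally show "(\<lambda>n. indicat_real (cbox p q) z *\<^sub>R (lap_\<phi> z * (ln ((cmod (g z))\<^sup>2 + (1 / real (Suc n))\<^sup>2) / 2)))
       \<longlonglongrightarrow> indicat_real (cbox p q) z *\<^sub>R (lap_\<phi> z * ln (cmod (g z)))"
        by (intro tendsto_intros)
    qed
    show "AE z in lborel. norm (indicat_real (cbox p q) z *\<^sub>R (lap_\<phi> z * (ln ((cmod (g z))\<^sup>2 + (1 / real (Suc n))\<^sup>2) / 2)))
       \<le> M * (indicator (cbox p q) z *\<^sub>R (C + \<bar>ln (cmod (g z))\<bar>))" for n
      using nz
    proof eventually_elim
      fix z assume z: "g z \<noteq> 0"
      show "norm (indicat_real (cbox p q) z *\<^sub>R (lap_\<phi> z * (ln ((cmod (g z))\<^sup>2 + (1 / real (Suc n))\<^sup>2) / 2)))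
       \<le> M * (indicator (cbox p q) z *\<^sub>R (C + \<bar>ln (cmod (g z))\<bar>))"
      proof (cases "z \<in> cbox p q")
        case True
        then show ?thesis
          using mult_mono[OF M(2)[OF True] bound[OF True z, of n]] M(1) by (simp add: abs_mult del: of_nat_Suc)
      qed simp
    qed
  qed measurable
qed

lemma set_integrable_sum:
  fixes f :: "'i \<Rightarrow> complex \<Rightarrow> real"
  assumes "\<And>i. i \<in> A \<Longrightarrow> set_integrable lborel S (f i)"
  shows "set_integrable lborel S (\<lambda>z. \<Sum>i\<in>A. f i z)"
    and "(LINT z:S|lborel. \<Sum>i\<in>A. f i z) = (\<Sum>i\<in>A. LINT z:S|lborel. f i z)"
  using assms by (simp_all add: set_integrable_def set_lebesgue_integral_def sum_distrib_left integral_sum)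

lemma AE_Re_neq: "AE z in lborel. Re z \<noteq> c"
proof -
  have "{z. Re z = c} = {z. 1 \<bullet> z = c}" by (simp add: inner_complex_def)
  then have "negligible {z. Re z = c}" using negligible_hyperplane[of "1::complex" c] by simp
  then have "{z. Re z = c} \<in> null_sets (completion lborel)" by (simp add: negligible_iff_null_sets)
  moreover have "{z. Re z = c} \<in> sets lborel"
    by (simp add: closed_Collect_eq continuous_on_Re)
  ultimately have "{z. Re z = c} \<in> null_sets lborel" by (simp add: null_sets_completion_iff)
  then show ?thesis using AE_not_in by fastforce
qed

text \<open>Off the null line \<open>Re z = Re a\<close>, the logarithm of the distance is bounded
  below by the one-variable logarithm \<open>ln \<bar>Re z - Re a\<bar>\<close>, and above by
  \<open>ln x \<le> x - 1\<close>.\<close>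

lemma integrable_log_dist: "set_integrable lborel (cbox p q) (\<lambda>z. ln (cmod (z - a)))"
proof (rule set_integrable_bound)
  show "set_integrable lborel (cbox p q) (\<lambda>z. \<bar>ln \<bar>Re z - Re a\<bar>\<bar> + cmod (z - a))"
  proof (rule set_integral_add)
    show "set_integrable lborel (cbox p q) (\<lambda>z. \<bar>ln \<bar>Re z - Re a\<bar>\<bar>)"
      by (rule set_integrable_abs, rule set_integrable_cbox_of_Re[OF integrable_log_abs_interval]) measurable
    show "set_integrable lborel (cbox p q) (\<lambda>z. cmod (z - a))"
      by (intro set_integrable_continuous_cbox continuous_intros)
  qed
  show "set_borel_measurable lborel (cbox p q) (\<lambda>z. ln (cmod (z - a)))"
    unfolding set_borel_measurable_def by measurable
  show "AE z in lborel. z \<in> cbox p q \<longrightarrow> norm (ln (cmod (z - a))) \<le> norm (\<bar>ln \<bar>Re z - Re a\<bar>\<bar> + cmod (z - a))"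
    using AE_Re_neq[of "Re a"]
  proof eventually_elim
    fix z assume z: "Re z \<noteq> Re a"
    have le: "\<bar>Re z - Re a\<bar> \<le> cmod (z - a)" using abs_Re_le_cmod[of "z - a"] by simp
    have pos: "0 < \<bar>Re z - Re a\<bar>" using z by simp
    then have "ln \<bar>Re z - Re a\<bar> \<le> ln (cmod (z - a))" using le by (subst ln_le_cancel_iff) auto
    moreover have "ln (cmod (z - a)) \<le> cmod (z - a) - 1" using pos le by (intro ln_le_minus_one) auto
    ultimately show "z \<in> cbox p q \<longrightarrow> norm (ln (cmod (z - a))) \<le> norm (\<bar>ln \<bar>Re z - Re a\<bar>\<bar> + cmod (z - a))"
      unfolding real_norm_def using norm_ge_zero[of "z - a"] by linarith
  qed
qed

text \<open>By Green's formula the left side is a limit of integrals of \<open>\<phi>\<close>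
  against nonnegative kernels \<open>k n\<close> of mass at most \<open>2 * pi\<close> that
  concentrate at \<open>a\<close>. The inequality suffices to bound Laplacians by zeros, and it
  makes no exception for \<open>a\<close> on an edge.\<close>

lemma log_dist_laplacian_le:
  assumes a: "a \<in> cbox p q"
  shows "(LINT z:cbox p q|lborel. lap_\<phi> z * ln (cmod (z - a))) \<le> 2 * pi * \<phi> a"
proof -
  define \<epsilon> where "\<epsilon> n = 1 / real (Suc n)" for n
  have \<epsilon>: "\<epsilon> n > 0" for n by (simp add: \<epsilon>_def)
  define k where "k n z = 2 * (\<epsilon> n)\<^sup>2 / ((cmod (z - a))\<^sup>2 + (\<epsilon> n)\<^sup>2)\<^sup>2" for n z
  have k0: "0 \<le> k n z" for n z by (simp add: k_def)
  have ne: "((cmod (z - a))\<^sup>2 + (\<epsilon> n)\<^sup>2)\<^sup>2 \<noteq> 0" for n z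
    using \<epsilon>[of n] by (metis add_nonneg_pos less_irrefl zero_eq_power2 zero_le_power2 zero_less_power)
  have ck: "continuous_on S (k n)" for S n unfolding k_def by (intro continuous_intros ballI ne)
  define I where "I n = (LINT z:cbox p q|lborel. \<phi> z * k n z)" for n
  have "laplacian_on (cbox p q) (\<lambda>z. ln ((cmod (z - a))\<^sup>2 + (\<epsilon> n)\<^sup>2) / 2) (k n)" for n
    using laplacian_log_regularized[OF holomorphic_on_diff[OF holomorphic_on_ident holomorphic_on_const[of a]], of "\<epsilon> n" "cbox p q" for n] less_imp_neq[OF \<epsilon>]
    by (auto simp: k_def[abs_def])
  then have Ieq: "I n = (LINT z:cbox p q|lborel. lap_\<phi> z * (ln ((cmod (z - a))\<^sup>2 + (1 / real (Suc n))\<^sup>2) / 2))" for n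
    unfolding I_def \<epsilon>_def by (rule green)
  have lim: "I \<longlonglongrightarrow> (LINT z:cbox p q|lborel. lap_\<phi> z * ln (cmod (z - a)))"
    unfolding Ieq
    by (rule log_regularized_limit[OF integrable_log_dist])
       (auto intro!: continuous_intros eventually_mono[OF AE_Re_neq[of "Re a"]])
  have "(LINT z:cbox p q|lborel. lap_\<phi> z * ln (cmod (z - a))) \<le> (\<phi> a + \<tau>) * (2 * pi)" if \<tau>: "\<tau> > 0" for \<tau>
  proof -
    have "isCont \<phi> a" using continuous_test(1)[of UNIV] by (simp add: continuous_on_eq_continuous_at)
    then obtain \<delta> where \<delta>: "\<delta> > 0" "\<And>z. dist z a < \<delta> \<Longrightarrow> dist (\<phi> z) (\<phi> a) < \<tau>"
      using \<tau> unfolding continuous_at_eps_delta by (metis dist_commute)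
    obtain M where M: "M > 0" "\<And>z. z \<in> cbox p q \<Longrightarrow> \<bar>\<phi> z\<bar> \<le> M"
      using compact_imp_bounded[OF compact_continuous_image[OF continuous_test(1) compact_cbox[of p q]]] by (auto simp: bounded_pos)
    define m where "m = (LINT z:cbox p q|lborel. (1::real))"
    \<comment> \<open>Near \<open>a\<close> the continuity of \<open>\<phi>\<close> is used; at
      distance at least \<open>\<delta>\<close> the kernel is at most
      \<open>2 * (\<epsilon> n)\<^sup>2 / \<delta> ^ 4\<close>.\<close>
    have bound: "I n \<le> (\<phi> a + \<tau>) * (2 * pi) + M * (2 * (\<epsilon> n)\<^sup>2 / \<delta> ^ 4) * m" for n
    proof -
      have "I n \<le> (LINT z:cbox p q|lborel. (\<phi> a + \<tau>) * k n z + M * (2 * (\<epsilon> n)\<^sup>2 / \<delta> ^ 4) * 1)"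
        unfolding I_def
      proof (rule set_integral_mono)
        fix z assume z: "z \<in> cbox p q"
        show "\<phi> z * k n z \<le> (\<phi> a + \<tau>) * k n z + M * (2 * (\<epsilon> n)\<^sup>2 / \<delta> ^ 4) * 1"
        proof (cases "dist z a < \<delta>")
          case True
          then have "\<phi> z \<le> \<phi> a + \<tau>" using \<delta>(2)[of z] by (simp add: dist_real_def abs_less_iff)
          then have "\<phi> z * k n z \<le> (\<phi> a + \<tau>) * k n z" using k0 by (rule mult_right_mono)
          moreover have "0 \<le> M * (2 * (\<epsilon> n)\<^sup>2 / \<delta> ^ 4)" using M \<delta> by simp
          ultimately show ?thesis by simp
        next
          case False
          have "\<delta> ^ 4 = (\<delta>\<^sup>2)\<^sup>2" by simp
          also have "\<dots> \<le> ((cmod (z - a))\<^sup>2 + (\<epsilon> n)\<^sup>2)\<^sup>2"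
            using False \<delta>(1) by (intro power_mono add_increasing2) (auto simp: dist_norm)
          finally have "k n z \<le> 2 * (\<epsilon> n)\<^sup>2 / \<delta> ^ 4"
            unfolding k_def using \<delta>(1) by (intro divide_left_mono mult_pos_pos) (auto simp: ne zero_less_power2)
          then have "\<phi> z * k n z \<le> M * (2 * (\<epsilon> n)\<^sup>2 / \<delta> ^ 4)"
            using M(2)[OF z] M(1) k0[of n z] by (intro mult_mono) auto
          moreover have "0 \<le> (\<phi> a + \<tau>) * k n z" using nonneg[OF a] \<tau> k0[of n z] by (simp add: \<phi>_def)
          ultimately show ?thesis by simp
        qed
      qed (intro set_integrable_continuous_cbox continuous_intros ck continuous_test)+
      also have "\<dots> = (LINT z:cbox p q|lborel. (\<phi> a + \<tau>) * k n z) + (LINT z:cbox p q|lborel. M * (2 * (\<epsilon> n)\<^sup>2 / \<delta> ^ 4) * 1)"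
        by (intro set_integral_add set_integrable_continuous_cbox continuous_intros ck)
      also have "\<dots> = (\<phi> a + \<tau>) * (LINT z:cbox p q|lborel. k n z) + M * (2 * (\<epsilon> n)\<^sup>2 / \<delta> ^ 4) * m"
        unfolding m_def set_integral_mult_right ..
      also have "\<dots> \<le> (\<phi> a + \<tau>) * (2 * pi) + M * (2 * (\<epsilon> n)\<^sup>2 / \<delta> ^ 4) * m"
        using kernel_integral_le[OF \<epsilon>[of n], of p q a] nonneg[OF a] \<tau>
        by (intro add_right_mono mult_left_mono) (auto simp: k_def \<phi>_def)
      finally show ?thesis .
    qed
    have "\<epsilon> \<longlonglongrightarrow> 0" unfolding \<epsilon>_def by (rule LIMSEQ_Suc[OF lim_1_over_n])
    then have "(\<lambda>n. (\<phi> a + \<tau>) * (2 * pi) + M * (2 * (\<epsilon> n)\<^sup>2 / \<delta> ^ 4) * m) \<longlonglongrightarrow> (\<phi> a + \<tau>) * (2 * pi) + M * (2 * 0\<^sup>2 / \<delta> ^ 4) * m"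
      using \<delta>(1) by (intro tendsto_intros) auto
    then have "(\<lambda>n. (\<phi> a + \<tau>) * (2 * pi) + M * (2 * (\<epsilon> n)\<^sup>2 / \<delta> ^ 4) * m) \<longlonglongrightarrow> (\<phi> a + \<tau>) * (2 * pi)" by simp
    from LIMSEQ_le[OF lim this] bound show ?thesis by blast
  qed
  then have "(LINT z:cbox p q|lborel. lap_\<phi> z * ln (cmod (z - a))) / (2 * pi) \<le> \<phi> a + \<tau>" if "\<tau> > 0" for \<tau>
    using that by (simp add: pos_divide_le_eq)
  then have "(LINT z:cbox p q|lborel. lap_\<phi> z * ln (cmod (z - a))) / (2 * pi) \<le> \<phi> a"
    by (rule field_le_epsilon)
  then show ?thesis by (simp add: pos_divide_le_eq mult.commute)
qed

text \<open>On the rectangle, \<open>g\<close> is a product of powers of \<open>z - a\<close> and of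
  a function \<open>h\<close> without zeros there. By Green's formula \<open>ln (cmod (h z))\<close>
  contributes 0, each zero contributes at most \<open>2 * pi * \<phi> a\<close> times its order, and
  \<open>\<tau>\<close> pays for replacing the limit by large \<open>n\<close>.\<close>

lemma regularized_laplacian_le_zeros:
  fixes g :: "complex \<Rightarrow> complex"
  assumes g: "g holomorphic_on UNIV" and nz: "\<exists>z. g z \<noteq> 0" and \<tau>: "\<tau> > 0"
  shows "\<forall>\<^sub>F n in sequentially. (LINT z:cbox p q|lborel. \<phi> z *
      (2 * (cmod (deriv g z))\<^sup>2 * (1 / real (Suc n))\<^sup>2 / ((cmod (g z))\<^sup>2 + (1 / real (Suc n))\<^sup>2)\<^sup>2))
    \<le> 2 * pi * (\<Sum>a\<in>{a \<in> cbox p q. g a = 0}. real (nat (zorder g a)) * \<phi> a) + \<tau>"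
proof -
  define A where "A = {a \<in> cbox p q. g a = 0}"
  note finA = entire_finite_zeros[OF g nz]
  have fin: "finite A" unfolding A_def by (rule finA[OF compact_cbox])
  obtain h where h: "h holomorphic_on UNIV" "\<forall>a\<in>A. h a \<noteq> 0"
     "\<And>z. g z = (\<Prod>a\<in>A. (z - a) ^ nat (zorder g a)) * h z"
    using entire_factor_zeros[OF g nz fin] by blast
  have hnz: "h z \<noteq> 0" if "z \<in> cbox p q" for z
  proof (cases "g z = 0")
    case True then show ?thesis using that h(2) by (simp add: A_def)
  next
    case False then show ?thesis using h(3)[of z] by auto
  qed
  have ln_g: "ln (cmod (g z)) = (\<Sum>a\<in>A. real (nat (zorder g a)) * ln (cmod (z - a))) + ln (cmod (h z))"
    if "z \<in> cbox p q" "z \<notin> A" for z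
  proof -
    have "cmod (z - a) > 0" if "a \<in> A" for a using that \<open>z \<notin> A\<close> by auto
    then have "ln (\<Prod>a\<in>A. cmod (z - a) ^ nat (zorder g a)) = (\<Sum>a\<in>A. real (nat (zorder g a)) * ln (cmod (z - a)))"
      and "(\<Prod>a\<in>A. cmod (z - a) ^ nat (zorder g a)) > 0"
      using fin by (auto simp: ln_prod ln_realpow intro!: prod_pos)
    then show ?thesis
      using hnz[OF that(1)] by (simp add: h(3)[of z] norm_mult norm_power ln_mult flip: prod_norm)
  qed
  have AE_A: "AE z in lborel. z \<notin> A" using finite_imp_null_set_lborel[OF fin] by (rule AE_not_in)
  have lap_h: "laplacian_on (cbox p q) (\<lambda>z. ln (cmod (h z))) (\<lambda>z. 0)"
    by (rule laplacian_log_abs[OF h(1) hnz])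
  have int_h: "set_integrable lborel (cbox p q) (\<lambda>z. ln (cmod (h z)))"
    by (rule set_integrable_continuous_cbox[OF laplacian_on_continuous(1)[OF lap_h]])
  have [measurable]: "g \<in> borel_measurable borel" "h \<in> borel_measurable borel" "lap_\<phi> \<in> borel_measurable borel"
    using g h(1) continuous_test by (auto intro!: borel_measurable_continuous_onI holomorphic_on_imp_continuous_on)
  define R where "R z = (\<Sum>a\<in>A. real (nat (zorder g a)) * ln (cmod (z - a))) + ln (cmod (h z))" for z
  have intR: "set_integrable lborel (cbox p q) R"
    unfolding R_def by (intro set_integral_add set_integrable_sum(1) set_integrable_mult_right integrable_log_dist int_h)
  have AEeq: "AE z in lborel. z \<in> cbox p q \<longrightarrow> ln (cmod (g z)) = R z"
    using AE_A by eventually_elim (auto simp: ln_g R_def)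
  have int_g: "set_integrable lborel (cbox p q) (\<lambda>z. ln (cmod (g z)))"
    using intR unfolding set_integrable_def
    by (rule Bochner_Integration.integrable_cong_AE[THEN iffD1, rotated -1])
       (use AEeq in \<open>auto simp: R_def elim!: eventually_mono\<close>)
  have AE_g: "AE z in lborel. g z \<noteq> 0"
  proof -
    have "countable {z. g z = 0}"
    proof -
      have "{z. g z = 0} = (\<Union>n::nat. {z \<in> cball 0 (real n). g z = 0})"
        by (auto simp: real_arch_simple)
      also have "countable \<dots>" by (intro countable_UN countableI_type countable_finite finA compact_cball)
      finally show ?thesis .
    qed
    then have "{z. g z = 0} \<in> null_sets lborel" by (rule countable_imp_null_set_lborel)
    then show ?thesis using AE_not_in by fastforce
  qed
  have lint: "set_integrable lborel (cbox p q) (\<lambda>z. lap_\<phi> z * u z)" if "set_integrable lborel (cbox p q) u" "u \<in> borel_measurable borel" for u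
  proof -
    obtain M where M: "M > 0" "\<And>z. z \<in> cbox p q \<Longrightarrow> \<bar>lap_\<phi> z\<bar> \<le> M"
      using compact_imp_bounded[OF compact_continuous_image[OF continuous_test(2) compact_cbox[of p q]]] by (auto simp: bounded_pos)
    show ?thesis
      by (rule set_integrable_bound[OF set_integrable_mult_right[of M, OF that(1)]])
         (use that(2) M in \<open>auto simp: set_borel_measurable_def abs_mult intro!: mult_right_mono always_eventually\<close>)
  qed
  have "(LINT z:cbox p q|lborel. lap_\<phi> z * ln (cmod (g z))) = (LINT z:cbox p q|lborel. lap_\<phi> z * R z)"
    by (rule set_lebesgue_integral_cong_AE) (use AEeq in \<open>auto simp: R_def elim!: eventually_mono\<close>)
  also have "\<dots> = (LINT z:cbox p q|lborel. (\<Sum>a\<in>A. real (nat (zorder g a)) * (lap_\<phi> z * ln (cmod (z - a)))) + lap_\<phi> z * ln (cmod (h z)))"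
    by (simp add: R_def algebra_simps sum_distrib_left)
  also have "\<dots> = (\<Sum>a\<in>A. real (nat (zorder g a)) * (LINT z:cbox p q|lborel. lap_\<phi> z * ln (cmod (z - a))))
       + (LINT z:cbox p q|lborel. lap_\<phi> z * ln (cmod (h z)))"
  proof (subst set_integral_add)
    show "set_integrable lborel (cbox p q) (\<lambda>z. \<Sum>a\<in>A. real (nat (zorder g a)) * (lap_\<phi> z * ln (cmod (z - a))))"
      by (intro set_integrable_sum(1) set_integrable_mult_right lint integrable_log_dist) measurable
    show "set_integrable lborel (cbox p q) (\<lambda>z. lap_\<phi> z * ln (cmod (h z)))"
      by (intro lint int_h) measurable
    have "(LINT z:cbox p q|lborel. \<Sum>a\<in>A. real (nat (zorder g a)) * (lap_\<phi> z * ln (cmod (z - a))))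
      = (\<Sum>a\<in>A. LINT z:cbox p q|lborel. real (nat (zorder g a)) * (lap_\<phi> z * ln (cmod (z - a))))"
      by (intro set_integrable_sum(2) set_integrable_mult_right lint integrable_log_dist) measurable
    then show "(LINT z:cbox p q|lborel. \<Sum>a\<in>A. real (nat (zorder g a)) * (lap_\<phi> z * ln (cmod (z - a))))
       + (LINT z:cbox p q|lborel. lap_\<phi> z * ln (cmod (h z)))
      = (\<Sum>a\<in>A. real (nat (zorder g a)) * (LINT z:cbox p q|lborel. lap_\<phi> z * ln (cmod (z - a))))
       + (LINT z:cbox p q|lborel. lap_\<phi> z * ln (cmod (h z)))" by simp
  qed
  also have "(LINT z:cbox p q|lborel. lap_\<phi> z * ln (cmod (h z))) = 0"
    by (simp flip: green[OF lap_h])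
  also have "(\<Sum>a\<in>A. real (nat (zorder g a)) * (LINT z:cbox p q|lborel. lap_\<phi> z * ln (cmod (z - a)))) + 0
      \<le> (\<Sum>a\<in>A. real (nat (zorder g a)) * (2 * pi * \<phi> a))"
    unfolding add_0_right by (intro sum_mono mult_left_mono log_dist_laplacian_le) (auto simp: A_def)
  also have "\<dots> = 2 * pi * (\<Sum>a\<in>A. real (nat (zorder g a)) * \<phi> a)"
    by (simp add: sum_distrib_left mult_ac)
  finally have le: "(LINT z:cbox p q|lborel. lap_\<phi> z * ln (cmod (g z))) < 2 * pi * (\<Sum>a\<in>A. real (nat (zorder g a)) * \<phi> a) + \<tau>"
    using \<tau> by simp
  have eq: "(LINT z:cbox p q|lborel. \<phi> z *
      (2 * (cmod (deriv g z))\<^sup>2 * (1 / real (Suc n))\<^sup>2 / ((cmod (g z))\<^sup>2 + (1 / real (Suc n))\<^sup>2)\<^sup>2))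
     = (LINT z:cbox p q|lborel. lap_\<phi> z * (ln ((cmod (g z))\<^sup>2 + (1 / real (Suc n))\<^sup>2) / 2))" for n
    by (rule green[OF laplacian_log_regularized[OF g]]) simp
  have "\<forall>\<^sub>F n in sequentially. (LINT z:cbox p q|lborel. lap_\<phi> z * (ln ((cmod (g z))\<^sup>2 + (1 / real (Suc n))\<^sup>2) / 2))
      < 2 * pi * (\<Sum>a\<in>A. real (nat (zorder g a)) * \<phi> a) + \<tau>"
    by (rule order_tendstoD(2)[OF log_regularized_limit[OF int_g _ AE_g] le])
       (use g in \<open>auto intro: holomorphic_on_imp_continuous_on\<close>)
  then show ?thesis
    unfolding eq A_def[symmetric] by (rule eventually_mono) (rule less_imp_le)
qed

end

section \<open>A grid of squares\<close>

locale bump =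
  fixes \<psi> \<psi>' \<psi>'' :: "real \<Rightarrow> real"
  assumes \<psi>: "\<And>x. (\<psi> has_real_derivative \<psi>' x) (at x)" "\<And>x. (\<psi>' has_real_derivative \<psi>'' x) (at x)"
      "continuous_on UNIV \<psi>''"
    and \<psi>_zero: "\<psi> 0 = 0" "\<psi> 1 = 0" "\<psi>' 0 = 0" "\<psi>' 1 = 0"
    and \<psi>_range: "\<And>x. 0 \<le> x \<Longrightarrow> x \<le> 1 \<Longrightarrow> 0 \<le> \<psi> x" "\<And>x. 0 \<le> x \<Longrightarrow> x \<le> 1 \<Longrightarrow> \<psi> x \<le> 1"

text \<open>\<open>P\<close> is the square of \<open>1 - (1 - 2 * x) ^ (2 * r)\<close>, which
  vanishes at 0 and 1 and is nearly 1 in between; squaring makes the derivative vanish at the ends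
  too. Since \<open>(1 - y)^2 \<ge> 1 - 2 * y\<close>, the integral is at least
  \<open>1 - 2 / (2 * r + 1)\<close>.\<close>

lemma bump_exists:
  fixes \<tau> :: real
  assumes "\<tau> > 0"
  shows "\<exists>\<psi> \<psi>' \<psi>''. bump \<psi> \<psi>' \<psi>'' \<and> 1 - \<tau> \<le> (LBINT x:{0..1}. \<psi> x)"
proof -
  obtain r :: nat where r: "2 / \<tau> < real r" using reals_Archimedean2 by blast
  then have r0: "r > 0" using assms by (metis less_le_trans not_gr_zero of_nat_0 divide_pos_pos less_irrefl zero_less_numeral less_trans)
  define Q :: "real poly" where "Q = 1 - [:1, -2:] ^ (2 * r)"
  define P where "P = Q * Q"
  have Q: "poly Q x = 1 - (1 - 2 * x) ^ (2 * r)" for x by (simp add: Q_def mult.commute)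
  have y: "0 \<le> (1 - 2 * x) ^ (2 * r)" "(1 - 2 * x) ^ (2 * r) \<le> 1" if "0 \<le> x" "x \<le> 1" for x :: real
  proof -
    have "(1 - 2 * x) ^ (2 * r) = \<bar>1 - 2 * x\<bar> ^ (2 * r)" by (simp only: power_even_abs even_mult_iff even_numeral simp_thms)
    also have "\<dots> \<le> 1" using that by (intro power_le_one) auto
    finally show "(1 - 2 * x) ^ (2 * r) \<le> 1" .
  qed simp
  have b: "bump (poly P) (poly (pderiv P)) (poly (pderiv (pderiv P)))"
  proof
    fix x :: real assume x: "0 \<le> x" "x \<le> 1"
    show "0 \<le> poly P x" by (simp add: P_def)
    show "poly P x \<le> 1" using y[OF x] by (auto simp: P_def Q intro!: mult_le_one)
  next
    show "(poly P has_real_derivative poly (pderiv P) x) (at x)"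
      "(poly (pderiv P) has_real_derivative poly (pderiv (pderiv P)) x) (at x)" for x by (rule poly_DERIV)+
  next
    show "continuous_on UNIV (poly (pderiv (pderiv P)))" by (intro continuous_intros)
  qed (use r0 in \<open>auto simp: P_def Q pderiv_mult\<close>)
  have lower: "(LBINT x:{0..1}. 1 - 2 * (1 - 2 * x) ^ (2 * r)) \<le> (LBINT x:{0..1}. poly P x)"
  proof (rule set_integral_mono)
    fix x :: real
    show "1 - 2 * (1 - 2 * x) ^ (2 * r) \<le> poly P x"
      using zero_le_square[of "(1 - 2 * x) ^ (2 * r)"] by (simp add: P_def Q algebra_simps)
  qed (intro borel_integrable_atLeastAtMost' continuous_intros)+
  have "(LBINT x. indicator {0..1} x *\<^sub>R (1 - 2 * (1 - 2 * x) ^ (2 * r)))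
     = (1 + (1 - 2 * 1) ^ (2 * r + 1) / real (2 * r + 1)) - (0 + (1 - 2 * 0) ^ (2 * r + 1) / real (2 * r + 1))"
  proof (rule integral_FTC_Icc)
    fix x :: real
    have "((\<lambda>x. x + (1 - 2 * x) ^ (2 * r + 1) / real (2 * r + 1)) has_real_derivative
        1 + (real (2 * r + 1) * (1 - 2 * x) ^ (2 * r) * (- 2)) / real (2 * r + 1)) (at x)"
      by (rule derivative_eq_intros refl | simp)+
    moreover have "1 + (real (2 * r + 1) * (1 - 2 * x) ^ (2 * r) * (- 2)) / real (2 * r + 1) = 1 - 2 * (1 - 2 * x) ^ (2 * r)"
      by (simp add: divide_simps)
    ultimately have A: "((\<lambda>x. x + (1 - 2 * x) ^ (2 * r + 1) / real (2 * r + 1)) has_real_derivative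
         1 - 2 * (1 - 2 * x) ^ (2 * r)) (at x)" by (simp only:)
    show "((\<lambda>x. x + (1 - 2 * x) ^ (2 * r + 1) / real (2 * r + 1)) has_vector_derivative
         1 - 2 * (1 - 2 * x) ^ (2 * r)) (at x within {0..1})"
      by (rule has_field_derivative_at_within[OF A, unfolded has_real_derivative_iff_has_vector_derivative])
  qed (auto intro!: continuous_intros)
  then have "(LBINT x:{0..1}. 1 - 2 * (1 - 2 * x) ^ (2 * r)) = 1 - 2 / real (2 * r + 1)"
    by (simp add: set_lebesgue_integral_def)
  moreover have "2 / real (2 * r + 1) \<le> \<tau>"
  proof -
    have "2 < real r * \<tau>" using r assms by (simp add: pos_divide_less_eq)
    moreover have "0 \<le> real r * \<tau>" using assms by simp
    ultimately show ?thesis using assms by (simp add: pos_divide_le_eq algebra_simps)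
  qed
  ultimately have "1 - \<tau> \<le> (LBINT x:{0..1}. poly P x)" using lower by linarith
  with b show ?thesis by blast
qed

definition corner :: "nat \<Rightarrow> int \<Rightarrow> int \<Rightarrow> complex" where
  "corner N a b = Complex (of_int a / real N) (of_int b / real N)"

text \<open>Closed, so that Green's formula on \<open>cbox\<close> applies; neighbours share edges,
  and there the bumps vanish.\<close>

definition sq :: "nat \<Rightarrow> int \<Rightarrow> int \<Rightarrow> complex set" where
  "sq N a b = cbox (corner N a b) (corner N (a + 1) (b + 1))"

lemma in_sq_iff:
  assumes "N > 0"
  shows "z \<in> sq N a b \<longleftrightarrow> of_int a \<le> real N * Re z \<and> real N * Re z \<le> of_int a + 1 \<and>
      of_int b \<le> real N * Im z \<and> real N * Im z \<le> of_int b + 1"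
  using assms by (auto simp: sq_def corner_def in_cbox_complex_iff field_simps)

text \<open>Since \<open>div\<close> on integers rounds down, dividing the indices by
  \<open>m\<close> leads from a subsquare to the enclosing square for negative indices as
  well.\<close>

lemma sq_child_subset:
  assumes "N > 0" "m > 0"
  shows "sq (N * m) a b \<subseteq> sq N (a div int m) (b div int m)"
proof
  fix z assume z: "z \<in> sq (N * m) a b"
  have *: "of_int (c div int m) \<le> real N * x \<and> real N * x \<le> of_int (c div int m) + 1"
    if "of_int c \<le> real (N * m) * x" "real (N * m) * x \<le> of_int c + 1" for c x
  proof -
    have m: "real m > 0" using assms by simp
    have c: "c = int m * (c div int m) + c mod int m" by simp
    have "0 \<le> c mod int m" "c mod int m \<le> int m - 1" using assms(2) by auto
    then have "int m * (c div int m) \<le> c" "c + 1 \<le> int m * (c div int m) + int m" using c by linarith+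
    then have "real_of_int (int m * (c div int m)) \<le> of_int c" "real_of_int (c + 1) \<le> of_int (int m * (c div int m) + int m)"
      by (simp_all only: of_int_le_iff)
    then have "real m * of_int (c div int m) \<le> of_int c" "of_int c + 1 \<le> real m * (of_int (c div int m) + 1)"
      by (auto simp: algebra_simps)
    moreover have "real (N * m) * x = real m * (real N * x)" by (simp add: mult_ac)
    ultimately have "real m * of_int (c div int m) \<le> real m * (real N * x)"
      "real m * (real N * x) \<le> real m * (of_int (c div int m) + 1)"
      using that by linarith+
    then show ?thesis unfolding mult_le_cancel_left_pos[OF m] by blast
  qed
  have Nm: "N * m > 0" using assms by simp
  from z show "z \<in> sq N (a div int m) (b div int m)"
    unfolding in_sq_iff[OF Nm] in_sq_iff[OF assms(1)] using *[of a "Re z"] *[of b "Im z"] by blast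
qed

lemma exists_sq_floor: "N > 0 \<Longrightarrow> z \<in> sq N \<lfloor>real N * Re z\<rfloor> \<lfloor>real N * Im z\<rfloor>"
  by (simp add: in_sq_iff)

lemma sq_children_cover:
  assumes "N > 0" "m > 0" "z \<in> sq N a b"
  shows "\<exists>a' b'. a' div int m = a \<and> b' div int m = b \<and> z \<in> sq (N * m) a' b'"
proof -
  have *: "\<exists>c'. c' div int m = c \<and> of_int c' \<le> real (N * m) * x \<and> real (N * m) * x \<le> of_int c' + 1"
    if c: "of_int c \<le> real N * x" "real N * x \<le> of_int c + 1" for c x
  proof (cases "real N * x = of_int c + 1")
    case True
    \<comment> \<open>On the right or upper edge the floor would belong to the neighbour, so the
      last subsquare is taken instead.\<close>
    have "(int m * c + (int m - 1)) div int m = c" using assms(2) by (simp add: div_pos_pos_trivial)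
    moreover have "real (N * m) * x = real m * (of_int c + 1)" using True by (simp add: mult_ac)
    ultimately show ?thesis by (intro exI[of _ "int m * c + (int m - 1)"]) (auto simp: algebra_simps)
  next
    case False
    define c' where "c' = \<lfloor>real (N * m) * x\<rfloor>"
    have m: "real m > 0" using assms by simp
    have eq: "real (N * m) * x = real m * (real N * x)" by (simp add: mult_ac)
    have "real m * of_int c \<le> real (N * m) * x" unfolding eq using c m by (intro mult_left_mono) auto
    then have "of_int (int m * c) \<le> real (N * m) * x" by simp
    then have 1: "int m * c \<le> c'" unfolding c'_def by (simp only: le_floor_iff)
    have "real (N * m) * x < real m * (of_int c + 1)" unfolding eq using c m False by (intro mult_strict_left_mono) auto
    then have "real (N * m) * x < of_int (int m * c + int m)" by (simp add: algebra_simps)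
    then have 2: "c' < int m * c + int m" unfolding c'_def by (simp only: floor_less_iff)
    define r where "r = c' - int m * c"
    have "c' = int m * c + r" "0 \<le> r" "r < int m" using 1 2 by (auto simp: r_def)
    then have "c' div int m = c" by simp
    moreover have "of_int c' \<le> real (N * m) * x" "real (N * m) * x \<le> of_int c' + 1"
      unfolding c'_def by linarith+
    ultimately show ?thesis by blast
  qed
  have Nm: "N * m > 0" using assms by simp
  from assms(3) show ?thesis
    unfolding in_sq_iff[OF Nm] in_sq_iff[OF assms(1)] using *[of a "Re z"] *[of b "Im z"] by blast
qed

definition children :: "nat \<Rightarrow> (int \<times> int) set \<Rightarrow> (int \<times> int) set" where
  "children m A = {(a, b). (a div int m, b div int m) \<in> A}"

lemma card_children:
  assumes "m > 0" "finite A"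
  shows "finite (children m A) \<and> card (children m A) = m\<^sup>2 * card A"
proof -
  define f where "f = (\<lambda>((a, b), (i, j)). (int m * a + i, int m * b + j))"
  define D where "D = A \<times> ({0..<int m} \<times> {0..<int m})"
  have inj: "inj_on f D"
  proof (rule inj_onI)
    fix x y assume x: "x \<in> D" and y: "y \<in> D" and e: "f x = f y"
    obtain a b i j where xx: "x = ((a, b), (i, j))" by (metis prod.collapse)
    obtain a' b' i' j' where yy: "y = ((a', b'), (i', j'))" by (metis prod.collapse)
    have r: "0 \<le> i" "i < int m" "0 \<le> j" "j < int m" "0 \<le> i'" "i' < int m" "0 \<le> j'" "j' < int m"
      using x y by (auto simp: D_def xx yy)
    have 1: "int m * a + i = int m * a' + i'" "int m * b + j = int m * b' + j'" using e by (auto simp: f_def xx yy)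
    have "(int m * a + i) div int m = a" "(int m * a' + i') div int m = a'"
      "(int m * b + j) div int m = b" "(int m * b' + j') div int m = b'" using r by auto
    then show "x = y" using 1 by (auto simp: xx yy)
  qed
  have img: "f ` D = children m A"
  proof (intro equalityI subsetI)
    fix x assume "x \<in> f ` D"
    then show "x \<in> children m A" by (auto simp: f_def D_def children_def)
  next
    fix x assume x: "x \<in> children m A"
    obtain a b where ab: "x = (a, b)" by (cases x)
    have "((a div int m, b div int m), (a mod int m, b mod int m)) \<in> D"
      using x assms(1) by (auto simp: D_def children_def ab)
    moreover have "f ((a div int m, b div int m), (a mod int m, b mod int m)) = x" by (simp add: f_def ab)
    ultimately show "x \<in> f ` D" by (metis imageI)
  qed
  have "finite D" using assms by (simp add: D_def)
  then show ?thesis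
    using card_image[OF inj] by (auto simp: img[symmetric] D_def card_cartesian_product power2_eq_square)
qed

lemma squares_inside_finite:
  assumes "\<omega> \<subseteq> ball 0 1" "N > 0"
  shows "finite {(a, b). sq N a b \<subseteq> \<omega>}" and "card {(a, b). sq N a b \<subseteq> \<omega>} \<le> 9 * N\<^sup>2"
proof -
  have sub: "{(a, b). sq N a b \<subseteq> \<omega>} \<subseteq> {- int N..int N} \<times> {- int N..int N}"
  proof
    fix x assume "x \<in> {(a, b). sq N a b \<subseteq> \<omega>}"
    then obtain a b where x: "x = (a, b)" and "sq N a b \<subseteq> \<omega>" by blast
    moreover have "corner N a b \<in> sq N a b" using assms(2) by (simp add: in_sq_iff corner_def)
    ultimately have "cmod (corner N a b) < 1" using assms(1) by auto
    then have "\<bar>of_int a / real N\<bar> < 1" "\<bar>of_int b / real N\<bar> < 1"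
      using abs_Re_le_cmod[of "corner N a b"] abs_Im_le_cmod[of "corner N a b"] by (auto simp: corner_def)
    then have "\<bar>real_of_int a\<bar> < real N" "\<bar>real_of_int b\<bar> < real N" using assms(2) by (auto simp: abs_divide)
    then show "x \<in> {- int N..int N} \<times> {- int N..int N}" using x by auto
  qed
  show "finite {(a, b). sq N a b \<subseteq> \<omega>}" by (rule finite_subset[OF sub]) auto
  have "card {(a, b). sq N a b \<subseteq> \<omega>} \<le> card ({- int N..int N} \<times> {- int N..int N})"
    by (rule card_mono[OF _ sub]) auto
  \<comment> \<open>From here on 9 bounds the number of squares relative to \<open>N^2\<close>:
    there are \<open>2 * N + 1 \<le> 3 * N\<close> possible indices in each direction.\<close>
  also have "\<dots> = (2 * N + 1) * (2 * N + 1)" by (simp add: card_cartesian_product nat_add_distrib nat_mult_distrib)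
  also have "\<dots> \<le> (3 * N) * (3 * N)" using assms(2) by (intro mult_mono) auto
  finally show "card {(a, b). sq N a b \<subseteq> \<omega>} \<le> 9 * N\<^sup>2" by (simp add: power2_eq_square)
qed

lemma measure_sq: "N > 0 \<Longrightarrow> measure lborel (sq N a b) = 1 / (real N)\<^sup>2"
  unfolding sq_def by (subst measure_lborel_cbox_eq) (auto simp: Basis_complex_def corner_def field_simps power2_eq_square)

lemma sq_sets [measurable]: "sq N a b \<in> sets borel" by (simp add: sq_def)

text \<open>At all sufficiently fine meshes a given point of \<open>\<omega>\<close> lies in a grid
  square inside \<open>\<omega>\<close>; dominated convergence of the indicators turns this into
  measures. Arbitrarily fine meshes are provided because the mean inequality needs room in the
  annulus.\<close>

lemma open_exhausted_by_squares:
  assumes op: "open \<omega>" and sub: "\<omega> \<subseteq> ball 0 1" and \<tau>: "\<tau> > 0"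
  shows "\<exists>N\<ge>n. N > 0 \<and> measure lborel \<omega> \<le> card {(a, b). sq N a b \<subseteq> \<omega>} / (real N)\<^sup>2 + \<tau>"
proof -
  define U where "U N = (\<Union>(a, b)\<in>{(a, b). sq N a b \<subseteq> \<omega>}. sq N a b)" for N
  have fm: "\<omega> \<in> fmeasurable lborel"
  proof (rule fmeasurableI)
    have "emeasure lborel \<omega> \<le> emeasure lborel (ball (0::complex) 1)" using sub by (intro emeasure_mono) auto
    also have "\<dots> < \<infinity>" by (rule emeasure_lborel_ball_finite)
    finally show "emeasure lborel \<omega> < \<infinity>" .
  qed (use op in simp)
  have Um: "U N \<in> sets borel" if "N > 0" for N
  proof -
    have "countable {(a, b). sq N a b \<subseteq> \<omega>}" by simp
    then show ?thesis unfolding U_def by (intro sets.countable_UN') auto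
  qed
  have "(\<lambda>n. LINT z|lborel. indicat_real (U (Suc n)) z) \<longlonglongrightarrow> (LINT z|lborel. indicat_real \<omega> z)"
  proof (rule integral_dominated_convergence[where w = "indicat_real \<omega>"])
    show "integrable lborel (indicat_real \<omega>)" using fm by (simp add: fmeasurable_def integrable_indicator_iff)
    show "AE z in lborel. (\<lambda>n. indicat_real (U (Suc n)) z) \<longlonglongrightarrow> indicat_real \<omega> z"
    proof (rule always_eventually, rule allI)
      fix z
      show "(\<lambda>n. indicat_real (U (Suc n)) z) \<longlonglongrightarrow> indicat_real \<omega> z"
      proof (cases "z \<in> \<omega>")
        case True
        then obtain e where e: "e > 0" "ball z e \<subseteq> \<omega>" using op open_contains_ball by blast
        obtain n0 :: nat where n0: "2 / e < real n0" using reals_Archimedean2 by blast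
        have "z \<in> U (Suc n)" if "n \<ge> n0" for n
        proof -
          let ?N = "Suc n"
          have Ne: "2 < real ?N * e"
          proof -
            have "2 / e < real ?N" using n0 that by linarith
            then show ?thesis using e(1) by (simp add: pos_divide_less_eq)
          qed
          define S where "S = sq ?N \<lfloor>real ?N * Re z\<rfloor> \<lfloor>real ?N * Im z\<rfloor>"
          have zS: "z \<in> S" unfolding S_def by (rule exists_sq_floor) simp
          have "S \<subseteq> ball z e"
          proof
            fix x assume x: "x \<in> S"
            have "\<bar>real ?N * Re x - real ?N * Re z\<bar> \<le> 1" "\<bar>real ?N * Im x - real ?N * Im z\<bar> \<le> 1"
              using x zS unfolding S_def in_sq_iff[OF zero_less_Suc] by linarith+
            moreover have eq: "\<bar>real ?N * u - real ?N * v\<bar> = real ?N * \<bar>v - u\<bar>" for u v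
              by (simp add: right_diff_distrib[symmetric] abs_mult abs_minus_commute del: of_nat_Suc)
            ultimately have "real ?N * \<bar>Re (z - x)\<bar> + real ?N * \<bar>Im (z - x)\<bar> \<le> 2"
              using eq[of "Re x" "Re z"] eq[of "Im x" "Im z"] unfolding minus_complex.sel by linarith
            then have "real ?N * (\<bar>Re (z - x)\<bar> + \<bar>Im (z - x)\<bar>) < real ?N * e" using Ne unfolding distrib_left by linarith
            then have "\<bar>Re (z - x)\<bar> + \<bar>Im (z - x)\<bar> < e" by simp
            then show "x \<in> ball z e" using cmod_le[of "z - x"] by (simp add: dist_norm)
          qed
          then show ?thesis unfolding U_def using e(2) zS by (auto simp: S_def)
        qed
        then have "\<forall>\<^sub>F n in sequentially. indicat_real (U (Suc n)) z = indicat_real \<omega> z"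
          using True unfolding eventually_sequentially by (intro exI[of _ n0]) auto
        then show ?thesis by (rule tendsto_eventually)
      next
        case False
        then have "z \<notin> U n" for n by (auto simp: U_def)
        then show ?thesis using False by simp
      qed
    qed
    show "AE z in lborel. norm (indicat_real (U (Suc n)) z) \<le> indicat_real \<omega> z" for n
      by (rule always_eventually) (auto simp: U_def indicator_def)
  qed (use op Um in \<open>auto intro: borel_measurable_indicator\<close>)
  then have "(\<lambda>n. measure lborel (U (Suc n))) \<longlonglongrightarrow> measure lborel \<omega>" by simp
  then have "\<forall>\<^sub>F k in sequentially. measure lborel \<omega> - \<tau> < measure lborel (U (Suc k))"
    using \<tau> by (intro order_tendstoD(1)) auto
  then obtain k0 where "\<And>k. k \<ge> k0 \<Longrightarrow> measure lborel \<omega> - \<tau> < measure lborel (U (Suc k))"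
    by (auto simp: eventually_sequentially)
  then have *: "measure lborel \<omega> - \<tau> < measure lborel (U (Suc (max k0 n)))" by simp
  define N where "N = Suc (max k0 n)"
  have N: "N > 0" "N \<ge> n" by (auto simp: N_def)
  have "measure lborel (U N) \<le> (\<Sum>(a, b)\<in>{(a, b). sq N a b \<subseteq> \<omega>}. measure lborel (sq N a b))"
    unfolding U_def case_prod_beta'
    by (rule measure_UNION_le) (use squares_inside_finite(1)[OF sub N(1)] in \<open>auto simp: case_prod_beta'\<close>)
  also have "\<dots> = card {(a, b). sq N a b \<subseteq> \<omega>} / (real N)\<^sup>2"
    by (simp add: measure_sq[OF N(1)] case_prod_beta')
  finally show ?thesis using * N unfolding N_def by (intro exI[of _ "Suc (max k0 n)"]) auto
qed

section \<open>Bumps on the squares of the grid\<close>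

context bump
begin

definition \<phi>\<^sub>q :: "nat \<Rightarrow> int \<Rightarrow> int \<Rightarrow> complex \<Rightarrow> real" where
  "\<phi>\<^sub>q N a b z = \<psi> (real N * Re z - of_int a) * \<psi> (real N * Im z - of_int b)"

lemma \<phi>\<^sub>q_range:
  assumes "N > 0" "z \<in> sq N a b"
  shows "0 \<le> \<phi>\<^sub>q N a b z" "\<phi>\<^sub>q N a b z \<le> 1"
  using assms(2) unfolding in_sq_iff[OF assms(1)] \<phi>\<^sub>q_def by (auto intro!: mult_nonneg_nonneg mult_le_one \<psi>_range)

text \<open>The zero of \<open>\<psi>\<close> at 1 excludes the right and upper edges, so at most
  one bump is nonzero at a given point. Hence the bumps of one grid add up to at most 1.\<close>

lemma \<phi>\<^sub>q_nonzero_imp_floor: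
  assumes "N > 0" "z \<in> sq N a b" "\<phi>\<^sub>q N a b z \<noteq> 0"
  shows "a = \<lfloor>real N * Re z\<rfloor>" "b = \<lfloor>real N * Im z\<rfloor>"
proof -
  have z: "of_int a \<le> real N * Re z" "real N * Re z \<le> of_int a + 1" "of_int b \<le> real N * Im z" "real N * Im z \<le> of_int b + 1"
    using assms(2) unfolding in_sq_iff[OF assms(1)] by auto
  have "real N * Re z - of_int a \<noteq> 1" "real N * Im z - of_int b \<noteq> 1"
    using assms(3) \<psi>_zero by (auto simp: \<phi>\<^sub>q_def)
  then show "a = \<lfloor>real N * Re z\<rfloor>" "b = \<lfloor>real N * Im z\<rfloor>" using z by linarith+
qed

lemma sum_\<phi>\<^sub>q_le:
  assumes "N > 0" "finite A" "\<And>a b. (a, b) \<in> A \<Longrightarrow> sq N a b \<subseteq> \<omega>"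
  shows "(\<Sum>(a, b)\<in>A. indicat_real (sq N a b) z * \<phi>\<^sub>q N a b z) \<le> indicat_real \<omega> z"
proof -
  define c where "c = (\<lfloor>real N * Re z\<rfloor>, \<lfloor>real N * Im z\<rfloor>)"
  define h where "h = (\<lambda>(a, b). indicat_real (sq N a b) z * \<phi>\<^sub>q N a b z)"
  have h0: "h x = 0" if "x \<noteq> c" for x
  proof (rule ccontr)
    obtain a b where x: "x = (a, b)" by (cases x)
    assume "h x \<noteq> 0"
    then have "z \<in> sq N a b" "\<phi>\<^sub>q N a b z \<noteq> 0" by (auto simp: h_def x indicator_def)
    from \<phi>\<^sub>q_nonzero_imp_floor[OF assms(1) this] show False using that by (simp add: x c_def)
  qed
  have "(\<Sum>x\<in>A. h x) = (if c \<in> A then h c else 0)"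
  proof (cases "c \<in> A")
    case True
    then have "(\<Sum>x\<in>A. h x) = h c + (\<Sum>x\<in>A - {c}. h x)" using assms(2) by (simp add: sum.remove)
    also have "(\<Sum>x\<in>A - {c}. h x) = 0" using h0 by (intro sum.neutral) auto
    finally show ?thesis using True by simp
  next
    case False
    then have "h x = 0" if "x \<in> A" for x using h0[of x] that by blast
    then show ?thesis using False by (simp add: sum.neutral)
  qed
  also have "\<dots> \<le> indicat_real \<omega> z"
    using assms(3)[of "fst c" "snd c"] \<phi>\<^sub>q_range(2)[OF assms(1), of z "fst c" "snd c"]
    by (auto simp: h_def indicator_def split: prod.splits)
  finally show ?thesis by (simp add: h_def)
qed

lemma test_function_sq:
  assumes N: "N > 0"
  shows "test_function (corner N a b) (corner N (a + 1) (b + 1))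
    (\<lambda>x. \<psi> (real N * x - of_int a)) (\<lambda>x. real N * \<psi>' (real N * x - of_int a)) (\<lambda>x. (real N)\<^sup>2 * \<psi>'' (real N * x - of_int a))
    (\<lambda>x. \<psi> (real N * x - of_int b)) (\<lambda>x. real N * \<psi>' (real N * x - of_int b)) (\<lambda>x. (real N)\<^sup>2 * \<psi>'' (real N * x - of_int b))"
proof
  have lin: "((\<lambda>x. real N * x - c) has_real_derivative real N) (at x)" for c x by (auto intro!: derivative_eq_intros)
  have d1: "((\<lambda>x. \<psi> (real N * x - c)) has_real_derivative real N * \<psi>' (real N * x - c)) (at x)" for c x
    using DERIV_chain2[OF \<psi>(1) lin, of c x] by (simp add: mult.commute)
  have d2: "((\<lambda>x. real N * \<psi>' (real N * x - c)) has_real_derivative (real N)\<^sup>2 * \<psi>'' (real N * x - c)) (at x)" for c x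
    using DERIV_cmult[OF DERIV_chain2[OF \<psi>(2) lin, of c x], of "real N"] by (simp add: mult_ac power2_eq_square)
  have c: "continuous_on UNIV (\<lambda>x. (real N)\<^sup>2 * \<psi>'' (real N * x - c))" for c
    by (intro continuous_intros continuous_on_compose2[OF \<psi>(3)]) auto
  show "((\<lambda>x. \<psi> (real N * x - of_int a)) has_real_derivative real N * \<psi>' (real N * x - of_int a)) (at x)" for x by (rule d1)
  show "((\<lambda>x. real N * \<psi>' (real N * x - of_int a)) has_real_derivative (real N)\<^sup>2 * \<psi>'' (real N * x - of_int a)) (at x)" for x by (rule d2)
  show "continuous_on UNIV (\<lambda>x. (real N)\<^sup>2 * \<psi>'' (real N * x - of_int a))" by (rule c)
  show "((\<lambda>x. \<psi> (real N * x - of_int b)) has_real_derivative real N * \<psi>' (real N * x - of_int b)) (at x)" for x by (rule d1)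
  show "((\<lambda>x. real N * \<psi>' (real N * x - of_int b)) has_real_derivative (real N)\<^sup>2 * \<psi>'' (real N * x - of_int b)) (at x)" for x by (rule d2)
  show "continuous_on UNIV (\<lambda>x. (real N)\<^sup>2 * \<psi>'' (real N * x - of_int b))" by (rule c)
  fix z assume "z \<in> cbox (corner N a b) (corner N (a + 1) (b + 1))"
  then show "0 \<le> \<psi> (real N * Re z - real_of_int a) * \<psi> (real N * Im z - real_of_int b)"
    using \<phi>\<^sub>q_range(1)[OF N, of z a b] by (simp add: sq_def \<phi>\<^sub>q_def)
qed (use N in \<open>simp_all add: corner_def \<psi>_zero\<close>)

lemma continuous_\<phi>\<^sub>q: "continuous_on S (\<phi>\<^sub>q N a b)"
proof -
  have "continuous_on UNIV \<psi>" using \<psi>(1) by (meson DERIV_continuous continuous_at_imp_continuous_on)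
  then show ?thesis unfolding \<phi>\<^sub>q_def
    by (intro continuous_intros continuous_on_compose2[of UNIV \<psi> S]) auto
qed

lemma second_derivative_bound: "\<exists>C>0. \<forall>x\<in>{0..1}. \<bar>\<psi>'' x\<bar> \<le> C"
proof -
  have "continuous_on {0..1::real} \<psi>''" using \<psi>(3) continuous_on_subset by blast
  then have "bounded (\<psi>'' ` {0..1})" by (intro compact_imp_bounded compact_continuous_image) auto
  then show ?thesis by (auto simp: bounded_pos)
qed

lemma set_integrable_sq: "continuous_on (sq N a b) (f :: complex \<Rightarrow> real) \<Longrightarrow> set_integrable lborel (sq N a b) f"
  unfolding sq_def by (rule set_integrable_continuous_cbox)

text \<open>Each of the two second derivatives of the rescaled bump contributes
  \<open>C * (real N)\<^sup>2\<close>. The right side involves \<open>v\<close> alone: a small mean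
  of its modulus makes the tested Laplacian small, however large the Laplacian is pointwise.\<close>

lemma green_sq_bound:
  assumes N: "N > 0" and lap: "laplacian_on (sq N a b) v l" and C: "\<And>x. x \<in> {0..1} \<Longrightarrow> \<bar>\<psi>'' x\<bar> \<le> C"
  shows "(LINT z:sq N a b|lborel. \<phi>\<^sub>q N a b z * l z) \<le> 2 * C * (real N)\<^sup>2 * (LINT z:sq N a b|lborel. \<bar>v z\<bar>)"
proof -
  interpret t: test_function "corner N a b" "corner N (a + 1) (b + 1)"
    "\<lambda>x. \<psi> (real N * x - of_int a)" "\<lambda>x. real N * \<psi>' (real N * x - of_int a)" "\<lambda>x. (real N)\<^sup>2 * \<psi>'' (real N * x - of_int a)"
    "\<lambda>x. \<psi> (real N * x - of_int b)" "\<lambda>x. real N * \<psi>' (real N * x - of_int b)" "\<lambda>x. (real N)\<^sup>2 * \<psi>'' (real N * x - of_int b)"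
    using N by (rule test_function_sq)
  have cv: "continuous_on (sq N a b) v" using laplacian_on_continuous[OF lap] by simp
  have "(LINT z:sq N a b|lborel. \<phi>\<^sub>q N a b z * l z) = (LINT z:sq N a b|lborel. t.lap_\<phi> z * v z)"
    using t.green[OF lap[unfolded sq_def]] by (simp add: sq_def \<phi>\<^sub>q_def t.\<phi>_def)
  also have "\<dots> \<le> (LINT z:sq N a b|lborel. 2 * C * (real N)\<^sup>2 * \<bar>v z\<bar>)"
  proof (rule set_integral_mono)
    fix z assume z: "z \<in> sq N a b"
    define x y where "x = real N * Re z - of_int a" and "y = real N * Im z - of_int b"
    have xy: "x \<in> {0..1}" "y \<in> {0..1}" using z unfolding in_sq_iff[OF N] by (auto simp: x_def y_def)
    have b: "\<bar>\<psi>'' u * \<psi> w\<bar> \<le> C" if "u \<in> {0..1}" "w \<in> {0..1}" for u w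
    proof -
      have "\<bar>\<psi>'' u\<bar> * \<bar>\<psi> w\<bar> \<le> C * 1"
        using C[OF that(1)] \<psi>_range[of w] that(2) by (intro mult_mono) auto
      then show ?thesis by (simp add: abs_mult)
    qed
    have "t.lap_\<phi> z = (real N)\<^sup>2 * (\<psi>'' x * \<psi> y + \<psi>'' y * \<psi> x)"
      unfolding t.lap_\<phi>_def x_def y_def by (simp add: algebra_simps)
    moreover have "\<bar>\<psi>'' x * \<psi> y + \<psi>'' y * \<psi> x\<bar> \<le> 2 * C" using b[OF xy] b[OF xy(2,1)] by linarith
    ultimately have "\<bar>t.lap_\<phi> z\<bar> \<le> (real N)\<^sup>2 * (2 * C)" by (simp add: abs_mult mult_left_mono)
    then have "\<bar>t.lap_\<phi> z\<bar> * \<bar>v z\<bar> \<le> (real N)\<^sup>2 * (2 * C) * \<bar>v z\<bar>" by (intro mult_right_mono) auto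
    then show "t.lap_\<phi> z * v z \<le> 2 * C * (real N)\<^sup>2 * \<bar>v z\<bar>"
      using abs_ge_self[of "t.lap_\<phi> z * v z"] by (simp add: abs_mult mult_ac)
  qed (intro set_integrable_sq continuous_intros cv t.continuous_test)+
  also have "\<dots> = 2 * C * (real N)\<^sup>2 * (LINT z:sq N a b|lborel. \<bar>v z\<bar>)" by (rule set_integral_mult_right)
  finally show ?thesis .
qed

text \<open>Rescaling to the unit square gives the square of the one-dimensional integral, at least
  \<open>(1 - \<tau>)^2 \<ge> 1 - 2 * \<tau>\<close>: the bumps lose little of the area.\<close>

lemma integral_\<phi>\<^sub>q_ge:
  assumes N: "N > 0" and \<tau>: "1 - \<tau> \<le> (LBINT x:{0..1}. \<psi> x)" "0 \<le> \<tau>" "\<tau> \<le> 1"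
  shows "(1 - 2 * \<tau>) / (real N)\<^sup>2 \<le> (LINT z:sq N a b|lborel. \<phi>\<^sub>q N a b z)"
proof -
  define I where "I = (LBINT x:{0..1}. \<psi> x)"
  define U where "U = cbox 0 (Complex 1 1)"
  define u where "u z = \<psi> (Re z) * \<psi> (Im z)" for z
  have c\<psi>: "continuous_on UNIV \<psi>" using \<psi>(1) by (meson DERIV_continuous continuous_at_imp_continuous_on)
  have cu: "continuous_on S u" for S unfolding u_def
    by (intro continuous_intros continuous_on_compose2[OF c\<psi>]) auto
  have [measurable]: "\<phi>\<^sub>q N a b \<in> borel_measurable borel"
    using continuous_\<phi>\<^sub>q by (intro borel_measurable_continuous_onI) 
  have "(LINT z:sq N a b|lborel. \<phi>\<^sub>q N a b z) = (1 / real N)\<^sup>2 * (LINT y|lborel. indicator (sq N a b) (corner N a b + (1 / real N) *\<^sub>R y) *\<^sub>R \<phi>\<^sub>q N a b (corner N a b + (1 / real N) *\<^sub>R y))"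
    unfolding set_lebesgue_integral_def using N by (intro lborel_integral_affine_complex) auto
  also have "(LINT y|lborel. indicator (sq N a b) (corner N a b + (1 / real N) *\<^sub>R y) *\<^sub>R \<phi>\<^sub>q N a b (corner N a b + (1 / real N) *\<^sub>R y))
     = (LINT y:U|lborel. u y)"
    unfolding set_lebesgue_integral_def
  proof (intro Bochner_Integration.integral_cong refl)
    fix y :: complex
    have "corner N a b + (1 / real N) *\<^sub>R y \<in> sq N a b \<longleftrightarrow> y \<in> U"
      unfolding in_sq_iff[OF N] U_def in_cbox_complex_iff using N by (simp add: corner_def field_simps zero_le_mult_iff)
    moreover have "\<phi>\<^sub>q N a b (corner N a b + (1 / real N) *\<^sub>R y) = u y"
      using N by (simp add: \<phi>\<^sub>q_def u_def corner_def field_simps)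
    ultimately show "indicat_real (sq N a b) (corner N a b + (1 / real N) *\<^sub>R y) *\<^sub>R \<phi>\<^sub>q N a b (corner N a b + (1 / real N) *\<^sub>R y) = indicat_real U y *\<^sub>R u y"
      by (simp add: indicator_def)
  qed
  also have "(LINT y:U|lborel. u y) = (LBINT y:{0..1}. LBINT x:{0..1}. u (Complex x y))"
    unfolding U_def by (subst set_integral_cbox_iterated(1)[OF cu]) simp
  also have "\<dots> = (LBINT y:{0..1}. \<psi> y * I)"
    by (simp add: u_def I_def mult.commute)
  also have "\<dots> = I * I" by (simp add: I_def)
  finally have eq: "(LINT z:sq N a b|lborel. \<phi>\<^sub>q N a b z) = (1 / real N)\<^sup>2 * (I * I)" .
  have "(1 - \<tau>) * (1 - \<tau>) \<le> I * I" using \<tau> unfolding I_def by (intro mult_mono) auto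
  moreover have "1 - 2 * \<tau> \<le> (1 - \<tau>) * (1 - \<tau>)" by (simp add: algebra_simps)
  ultimately have "1 - 2 * \<tau> \<le> I * I" by linarith
  then have "(1 / real N)\<^sup>2 * (1 - 2 * \<tau>) \<le> (1 / real N)\<^sup>2 * (I * I)" by (intro mult_left_mono) auto
  then show ?thesis unfolding eq by (simp add: power_divide)
qed

end

text \<open>A single point with \<open>w \<le> s\<close> in each subsquare is enough, as the mean
  inequality around it bounds the integral over the subsquare. The factor
  \<open>4 / (real N)\<^sup>2\<close> is \<open>R\<^sup>2\<close> times the number
  \<open>m\<^sup>2\<close> of subsquares.\<close>

lemma set_integral_sq_le_children:
  assumes N: "N > 0" "m > 0" "12 \<le> N" and sub: "sq N a b \<subseteq> {z. 1/2 < cmod z \<and> cmod z < 1}"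
    and lap: "laplacian_on UNIV w l" and M: "0 \<le> M"
    and l: "\<And>z. 1/4 \<le> cmod z \<Longrightarrow> cmod z \<le> 2 \<Longrightarrow> l z \<le> M"
    and w: "\<And>z. 1/4 \<le> cmod z \<Longrightarrow> cmod z \<le> 2 \<Longrightarrow> 0 \<le> w z"
    and white: "\<And>x. x \<in> children m {(a, b)} \<Longrightarrow> \<exists>z\<in>sq (N * m) (fst x) (snd x). w z \<le> s"
  shows "(LINT z:sq N a b|lborel. w z) \<le> 4 / (real N)\<^sup>2 * (8 * s + 4 * M / (real (N * m))\<^sup>2)"
proof -
  define D where "D = children m {(a, b)}"
  have fD: "finite D" "card D = m\<^sup>2" using card_children[OF N(2), of "{(a, b)}"] by (auto simp: D_def)
  \<comment> \<open>\<open>R / 2\<close> is the side of a subsquare, so the square of half-side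
    \<open>R / 2\<close> about any point of the subsquare contains it.\<close>
  define R where "R = 2 / real (N * m)"
  have Nm: "N * m > 0" using N by simp
  have R: "R > 0" using Nm by (simp add: R_def)
  have cw: "continuous_on S w" for S using laplacian_on_continuous(1)[OF laplacian_on_subset[OF lap]] by simp
  have childsub: "sq (N * m) (fst x) (snd x) \<subseteq> sq N a b" if "x \<in> D" for x
    using sq_child_subset[OF N(1,2), of "fst x" "snd x"] that by (auto simp: D_def children_def)
  have child: "(LINT z:sq (N * m) (fst x) (snd x)|lborel. w z) \<le> R\<^sup>2 * (8 * s + M * R\<^sup>2)" if x: "x \<in> D" for x
  proof -
    obtain z0 where z0: "z0 \<in> sq (N * m) (fst x) (snd x)" "w z0 \<le> s" using white[OF x[unfolded D_def]] by blast
    let ?e = "Complex 1 1"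
    have z0ann: "1/2 < cmod z0" "cmod z0 < 1" using z0(1) childsub[OF x] sub by auto
    have ann: "1/4 \<le> cmod z \<and> cmod z \<le> 2" if z: "z \<in> cbox (z0 - R *\<^sub>R ?e) (z0 + R *\<^sub>R ?e)" for z
    proof -
      have "\<bar>Re (z - z0)\<bar> \<le> R" "\<bar>Im (z - z0)\<bar> \<le> R" using z by (auto simp: in_cbox_complex_iff)
      then have d: "cmod (z - z0) \<le> 2 * R" using cmod_le[of "z - z0"] by linarith
      \<comment> \<open>\<open>N \<ge> 12\<close> gives \<open>R \<le> 1/6\<close>; the square of
        half-side \<open>R\<close> then stays within distance \<open>1/4\<close> of
        \<open>z0\<close>, where the bounds on \<open>w\<close> and \<open>l\<close> hold.\<close>
      have "12 * 1 \<le> N * m" using N by (intro mult_le_mono) auto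
      then have "real 12 \<le> real (N * m)" by (subst of_nat_le_iff) simp
      then have "R \<le> 2 / 12" unfolding R_def by (intro divide_left_mono) auto
      have "\<bar>Re (z - z0)\<bar> \<le> 1/6" "\<bar>Im (z - z0)\<bar> \<le> 1/6"
        using \<open>R \<le> 2/12\<close> \<open>\<bar>Re (z - z0)\<bar> \<le> R\<close> \<open>\<bar>Im (z - z0)\<bar> \<le> R\<close> by linarith+
      then have "(Re (z - z0))\<^sup>2 \<le> (1/6)\<^sup>2" "(Im (z - z0))\<^sup>2 \<le> (1/6)\<^sup>2"
        by (metis abs_ge_zero power2_abs power_mono)+
      then have "(cmod (z - z0))\<^sup>2 \<le> (1/4)\<^sup>2" unfolding cmod_power2 by (simp add: power2_eq_square)
      then have "cmod (z - z0) \<le> 1/4" by (rule power2_le_imp_le) simp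
      then show ?thesis
        using norm_triangle_ineq2[of z0 z] norm_triangle_ineq2[of z z0] z0ann by (simp add: norm_minus_commute)
    qed
    have half: "sq (N * m) (fst x) (snd x) \<subseteq> cbox (z0 - (R/2) *\<^sub>R ?e) (z0 + (R/2) *\<^sub>R ?e)"
    proof
      fix z assume z: "z \<in> sq (N * m) (fst x) (snd x)"
      have "real (N * m) * (Re z - Re z0) \<le> 1" "real (N * m) * (Re z0 - Re z) \<le> 1"
        "real (N * m) * (Im z - Im z0) \<le> 1" "real (N * m) * (Im z0 - Im z) \<le> 1"
        using z z0(1) unfolding in_sq_iff[OF Nm] right_diff_distrib by linarith+
      then have "Re z - Re z0 \<le> R / 2" "Re z0 - Re z \<le> R / 2" "Im z - Im z0 \<le> R / 2" "Im z0 - Im z \<le> R / 2"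
        using Nm by (simp_all add: R_def pos_le_divide_eq mult.commute)
      then show "z \<in> cbox (z0 - (R/2) *\<^sub>R ?e) (z0 + (R/2) *\<^sub>R ?e)" by (auto simp: in_cbox_complex_iff)
    qed
    have "(LINT z:sq (N * m) (fst x) (snd x)|lborel. w z) \<le> (LINT z:cbox (z0 - (R/2) *\<^sub>R ?e) (z0 + (R/2) *\<^sub>R ?e)|lborel. w z)"
      unfolding set_lebesgue_integral_def
    proof (rule integral_mono')
      show "integrable lborel (\<lambda>z. indicat_real (cbox (z0 - (R/2) *\<^sub>R ?e) (z0 + (R/2) *\<^sub>R ?e)) z *\<^sub>R w z)"
        unfolding set_integrable_def[symmetric] by (rule set_integrable_continuous_cbox[OF cw])
      fix z
      have "z \<in> cbox (z0 - R *\<^sub>R ?e) (z0 + R *\<^sub>R ?e)" if "z \<in> cbox (z0 - (R/2) *\<^sub>R ?e) (z0 + (R/2) *\<^sub>R ?e)"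
        using that R by (auto simp: in_cbox_complex_iff)
      then have "0 \<le> w z" if "z \<in> cbox (z0 - (R/2) *\<^sub>R ?e) (z0 + (R/2) *\<^sub>R ?e)" using that ann w by blast
      then show "0 \<le> indicat_real (cbox (z0 - (R/2) *\<^sub>R ?e) (z0 + (R/2) *\<^sub>R ?e)) z *\<^sub>R w z"
        "indicat_real (sq (N * m) (fst x) (snd x)) z *\<^sub>R w z \<le> indicat_real (cbox (z0 - (R/2) *\<^sub>R ?e) (z0 + (R/2) *\<^sub>R ?e)) z *\<^sub>R w z"
        using half by (auto simp: indicator_def)
    qed
    also have "\<dots> \<le> R\<^sup>2 * (8 * w z0 + M * R\<^sup>2)"
      by (rule laplacian_mean_inequality[OF lap R M]) (use ann l w in auto)
    also have "\<dots> \<le> R\<^sup>2 * (8 * s + M * R\<^sup>2)" using z0(2) by (intro mult_left_mono) auto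
    finally show ?thesis .
  qed
  have wsq: "0 \<le> w z" if "z \<in> sq N a b" for z using that sub w[of z] by force
  have "(LINT z:sq N a b|lborel. w z) \<le> (LINT z|lborel. (\<Sum>x\<in>D. indicat_real (sq (N * m) (fst x) (snd x)) z *\<^sub>R w z))"
    unfolding set_lebesgue_integral_def
  proof (rule integral_mono')
    show "integrable lborel (\<lambda>z. \<Sum>x\<in>D. indicat_real (sq (N * m) (fst x) (snd x)) z *\<^sub>R w z)"
      using set_integrable_continuous_cbox[OF cw] unfolding set_integrable_def sq_def
      by (intro Bochner_Integration.integrable_sum) blast
    fix z
    have nn: "0 \<le> indicat_real (sq (N * m) (fst x) (snd x)) z *\<^sub>R w z" if "x \<in> D" for x
      using childsub[OF that] wsq by (auto simp: indicator_def)
    then show "0 \<le> (\<Sum>x\<in>D. indicat_real (sq (N * m) (fst x) (snd x)) z *\<^sub>R w z)" by (rule sum_nonneg)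
    show "indicat_real (sq N a b) z *\<^sub>R w z \<le> (\<Sum>x\<in>D. indicat_real (sq (N * m) (fst x) (snd x)) z *\<^sub>R w z)"
    proof (cases "z \<in> sq N a b")
      case True
      then obtain a' b' where ab: "a' div int m = a" "b' div int m = b" "z \<in> sq (N * m) a' b'"
        using sq_children_cover[OF N(1,2)] by blast
      then have "(a', b') \<in> D" by (simp add: D_def children_def)
      from member_le_sum[OF this _ fD(1), of "\<lambda>x. indicat_real (sq (N * m) (fst x) (snd x)) z *\<^sub>R w z"] nn
      have "indicat_real (sq (N * m) a' b') z *\<^sub>R w z \<le> (\<Sum>x\<in>D. indicat_real (sq (N * m) (fst x) (snd x)) z *\<^sub>R w z)" by simp
      then show ?thesis using True ab(3) by simp
    next
      case False then show ?thesis using nn by (simp add: sum_nonneg)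
    qed
  qed
  also have "\<dots> = (\<Sum>x\<in>D. (LINT z:sq (N * m) (fst x) (snd x)|lborel. w z))"
    unfolding set_lebesgue_integral_def
    using set_integrable_continuous_cbox[OF cw] unfolding set_integrable_def sq_def
    by (intro Bochner_Integration.integral_sum) blast
  also have "\<dots> \<le> (\<Sum>x\<in>D. R\<^sup>2 * (8 * s + M * R\<^sup>2))" by (intro sum_mono child)
  also have "\<dots> = (real m)\<^sup>2 * (R\<^sup>2 * (8 * s + M * R\<^sup>2))" by (simp add: fD(2))
  also have "(real m)\<^sup>2 * (R\<^sup>2 * (8 * s + M * R\<^sup>2)) = 4 / (real N)\<^sup>2 * (8 * s + 4 * M / (real (N * m))\<^sup>2)"
    using N(1,2) by (simp add: R_def power_divide power_mult_distrib)
  finally show ?thesis .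
qed

section \<open>Comparing the Laplacians in an annulus\<close>

text \<open>Up to normalization, \<open>X j\<close> is the white area at scale \<open>j\<close>,
  summed over \<open>i\<close>. It decreases in \<open>j\<close>, starts at \<open>q * c\<close> or
  below and stays nonnegative, so one of \<open>M\<close> steps lowers it by at most
  \<open>q * c / M\<close>. A square counted on the left has a subsquare where whiteness is lost,
  and the number of these subsquares is \<open>(m^2)^(j+1)\<close> times the decrease.\<close>

lemma pigeonhole_scale:
  fixes A :: "nat \<Rightarrow> (int \<times> int) set" and W :: "nat \<Rightarrow> nat \<Rightarrow> (int \<times> int) set" and c :: real
  assumes m: "m > 0" and M: "M > 0" and fin: "finite (A 0)" and c: "real (card (A 0)) \<le> c"
    and A: "\<And>j. A (Suc j) = children m (A j)"
    and W: "\<And>j i. W j i \<subseteq> A j" "\<And>j i. W (Suc j) i \<subseteq> children m (W j i)"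
  shows "\<exists>j<M. real (card {x\<in>A j. \<exists>i\<in>{1..q}. x \<in> W j i \<and> \<not> children m {x} \<subseteq> W (Suc j) i})
      \<le> (real m)\<^sup>2 * (real m)\<^sup>2 ^ j * (real q * c / real M)"
proof -
  have finA: "finite (A j)" for j
    using fin card_children[OF m] by (induction j) (auto simp: A)
  have finW: "finite (W j i)" for j i using W(1) finA by (rule finite_subset)
  define X where "X j = (\<Sum>i\<in>{1..q}. real (card (W j i)) / (real m)\<^sup>2 ^ j)" for j
  define bad where "bad j i = {x\<in>W j i. \<not> children m {x} \<subseteq> W (Suc j) i}" for j i
  have bad: "real (card (bad j i)) \<le> (real m)\<^sup>2 * real (card (W j i)) - real (card (W (Suc j) i))" for j i
  proof -
    let ?D = "children m (W j i) - W (Suc j) i"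
    have fD: "finite ?D" using card_children[OF m finW] by blast
    have "bad j i \<subseteq> (\<lambda>(a, b). (a div int m, b div int m)) ` ?D"
    proof
      fix x assume "x \<in> bad j i"
      then obtain a b where ab: "(a, b) \<in> children m {x}" "(a, b) \<notin> W (Suc j) i" and x: "x \<in> W j i"
        by (auto simp: bad_def)
      then have "(a, b) \<in> ?D" "x = (a div int m, b div int m)" by (auto simp: children_def)
      then show "x \<in> (\<lambda>(a, b). (a div int m, b div int m)) ` ?D" by (auto intro: rev_image_eqI)
    qed
    then have "card (bad j i) \<le> card ?D" using fD by (rule surj_card_le[rotated])
    also have "card ?D = m\<^sup>2 * card (W j i) - card (W (Suc j) i)"
      using card_children[OF m finW] W(2) finW by (subst card_Diff_subset) auto
    finally have "card (bad j i) \<le> m\<^sup>2 * card (W j i) - card (W (Suc j) i)" .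
    moreover have "card (W (Suc j) i) \<le> m\<^sup>2 * card (W j i)"
      using card_children[OF m finW, of j i] card_mono[OF _ W(2), of j i] by simp
    ultimately have "card (bad j i) + card (W (Suc j) i) \<le> m\<^sup>2 * card (W j i)" by simp
    then have "real (card (bad j i) + card (W (Suc j) i)) \<le> real (m\<^sup>2 * card (W j i))" by (simp only: of_nat_le_iff)
    then show ?thesis by simp
  qed
  have step: "real (card {x\<in>A j. \<exists>i\<in>{1..q}. x \<in> W j i \<and> \<not> children m {x} \<subseteq> W (Suc j) i})
     \<le> (real m)\<^sup>2 * (real m)\<^sup>2 ^ j * (X j - X (Suc j))" for j
  proof -
    have "{x\<in>A j. \<exists>i\<in>{1..q}. x \<in> W j i \<and> \<not> children m {x} \<subseteq> W (Suc j) i} = (\<Union>i\<in>{1..q}. bad j i)"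
      using W(1) by (auto simp: bad_def)
    then have "real (card {x\<in>A j. \<exists>i\<in>{1..q}. x \<in> W j i \<and> \<not> children m {x} \<subseteq> W (Suc j) i}) \<le> real (\<Sum>i\<in>{1..q}. card (bad j i))"
      by (simp only: of_nat_le_iff) (rule card_UN_le, simp)
    also have "\<dots> \<le> (\<Sum>i\<in>{1..q}. (real m)\<^sup>2 * real (card (W j i)) - real (card (W (Suc j) i)))"
      unfolding of_nat_sum by (intro sum_mono bad)
    also have "\<dots> = (real m)\<^sup>2 * (real m)\<^sup>2 ^ j * (X j - X (Suc j))"
      using m by (simp add: X_def sum_subtractf[symmetric] sum_distrib_left right_diff_distrib)
    finally show ?thesis .
  qed
  have "\<exists>j<M. X j - X (Suc j) \<le> real q * c / real M"
  proof (rule ccontr)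
    assume "\<not> ?thesis"
    then have "real q * c / real M < X j - X (Suc j)" if "j < M" for j using that by force
    then have "(\<Sum>j<M. real q * c / real M) < (\<Sum>j<M. X j - X (Suc j))"
      using M by (intro sum_strict_mono) auto
    also have "\<dots> = X 0 - X M" by (rule sum_lessThan_telescope')
    also have "\<dots> \<le> X 0" by (simp add: X_def sum_nonneg)
    also have "X 0 \<le> (\<Sum>i\<in>{1..q}. c)"
      unfolding X_def using c card_mono[OF fin W(1)] by (intro sum_mono) (simp add: order_trans[OF _ c])
    finally show False using M by simp
  qed
  then obtain j where j: "j < M" "X j - X (Suc j) \<le> real q * c / real M" by blast
  have "(real m)\<^sup>2 * (real m)\<^sup>2 ^ j * (X j - X (Suc j)) \<le> (real m)\<^sup>2 * (real m)\<^sup>2 ^ j * (real q * c / real M)"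
    using j(2) by (intro mult_left_mono) auto
  then show ?thesis using step[of j] j(1) by (intro exI[of _ j]) auto
qed

text \<open>What a rescaled curve provides, stripped of the curve: \<open>\<rho>\<close> is the
  Laplacian of \<open>u\<close>, \<open>\<beta> i\<close> that of the regularized
  \<open>u\<^sub>i\<close>, and \<open>w i\<close> is the difference of these functions plus a
  constant that makes it nonnegative. In \<open>harmonic\<close>, \<open>J\<close> leaves out fewer
  than \<open>k\<close> indices, and \<open>h\<close> stands for \<open>u\<close> minus the
  normalized logarithm of a form without zeros; its bound \<open>B\<close> does not grow with
  \<open>L\<close>.\<close>

locale potentials = bump +
  fixes \<omega> :: "complex set" and q k :: nat and C S B L :: real
    and w \<beta> :: "nat \<Rightarrow> complex \<Rightarrow> real" and \<rho> :: "complex \<Rightarrow> real"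
  assumes open_\<omega>: "open \<omega>" and \<omega>: "\<omega> \<subseteq> {z. 1/2 < cmod z \<and> cmod z < 1}"
    and nn: "0 \<le> C" "0 \<le> B" "0 \<le> L"
    and lap: "\<And>i. i \<in> {1..q} \<Longrightarrow> laplacian_on UNIV (w i) (\<lambda>z. \<rho> z - \<beta> i z)"
    and w: "\<And>i z. i \<in> {1..q} \<Longrightarrow> 1/4 \<le> cmod z \<Longrightarrow> cmod z \<le> 2 \<Longrightarrow> 0 \<le> w i z"
    and \<rho>: "continuous_on UNIV \<rho>" "\<And>z. 0 \<le> \<rho> z" "\<And>z. 1/4 \<le> cmod z \<Longrightarrow> cmod z \<le> 2 \<Longrightarrow> \<rho> z \<le> C * L"
    and \<beta>: "\<And>i. i \<in> {1..q} \<Longrightarrow> continuous_on UNIV (\<beta> i)" "\<And>i z. i \<in> {1..q} \<Longrightarrow> 0 \<le> \<beta> i z"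
    and harmonic: "\<And>N a b J. N > 0 \<Longrightarrow> sq N a b \<subseteq> \<omega> \<Longrightarrow> J \<subseteq> {1..q} \<Longrightarrow> q + 1 \<le> card J + k \<Longrightarrow>
       (\<And>j z. j \<in> J \<Longrightarrow> z \<in> sq N a b \<Longrightarrow> S < w j z) \<Longrightarrow>
       \<exists>h. laplacian_on (sq N a b) h \<rho> \<and> (\<forall>z\<in>sq N a b. \<bar>h z\<bar> \<le> B)"
begin

abbreviation I :: "nat \<Rightarrow> int \<Rightarrow> int \<Rightarrow> (complex \<Rightarrow> real) \<Rightarrow> real" where
  "I N a b f \<equiv> (LINT z:sq N a b|lborel. \<phi>\<^sub>q N a b z * f z)"

lemma I_integrable: "continuous_on UNIV f \<Longrightarrow> set_integrable lborel (sq N a b) (\<lambda>z. \<phi>\<^sub>q N a b z * f z)"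
  by (intro set_integrable_sq continuous_intros continuous_\<phi>\<^sub>q) (auto intro: continuous_on_subset)

lemma I_nonneg: "N > 0 \<Longrightarrow> (\<And>z. 0 \<le> f z) \<Longrightarrow> 0 \<le> I N a b f"
  unfolding set_lebesgue_integral_def using \<phi>\<^sub>q_range(1)
  by (intro Bochner_Integration.integral_nonneg) (auto simp: indicator_def)

lemma I_\<rho>_le:
  assumes "N > 0" "sq N a b \<subseteq> \<omega>"
  shows "I N a b \<rho> \<le> C * L / (real N)\<^sup>2"
proof -
  have "I N a b \<rho> \<le> (LINT z:sq N a b|lborel. C * L)"
  proof (rule set_integral_mono[OF I_integrable[OF \<rho>(1)]])
    fix z assume z: "z \<in> sq N a b"
    then have "\<rho> z \<le> C * L" using assms(2) \<omega> by (intro \<rho>(3)) force+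
    moreover have "\<phi>\<^sub>q N a b z * \<rho> z \<le> 1 * \<rho> z" using \<phi>\<^sub>q_range[OF assms(1) z] \<rho>(2) by (intro mult_right_mono)
    ultimately show "\<phi>\<^sub>q N a b z * \<rho> z \<le> C * L" by simp
  qed (intro set_integrable_sq continuous_intros)
  also have "\<dots> = C * L / (real N)\<^sup>2"
    using measure_sq[OF assms(1)] by (simp add: set_lebesgue_integral_def)
  finally show ?thesis .
qed

text \<open>If at least \<open>k\<close> indices are white, \<open>good\<close> makes each of them
  white in all subsquares, so \<open>w i\<close> has a small mean and \<open>\<rho>\<close> and
  \<open>\<beta> i\<close> have nearly the same mass under the bump. Otherwise
  \<open>w j > s \<ge> S\<close> throughout the square for all but fewer than \<open>k\<close>
  indices, and \<open>harmonic\<close> bounds the mass of \<open>\<rho>\<close> by a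
  constant.\<close>

lemma good_square:
  assumes N: "12 \<le> N" and m: "m > 0" and sub: "sq N a b \<subseteq> \<omega>" and s: "S \<le> s" "0 \<le> s"
    and C\<psi>: "\<And>x. x \<in> {0..1} \<Longrightarrow> \<bar>\<psi>'' x\<bar> \<le> C\<psi>"
    and good: "\<And>i x. i \<in> {1..q} \<Longrightarrow> \<exists>z\<in>sq N a b. w i z \<le> s \<Longrightarrow> x \<in> children m {(a, b)} \<Longrightarrow>
       \<exists>z\<in>sq (N * m) (fst x) (snd x). w i z \<le> s"
  shows "real k * I N a b \<rho> \<le> (\<Sum>i\<in>{1..q}. I N a b (\<beta> i))
     + real q * (8 * C\<psi> * (8 * s + 4 * (C * L) / (real (N * m))\<^sup>2)) + real k * (2 * C\<psi> * B)"
proof -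
  have N0: "N > 0" using N by simp
  have C\<psi>0: "0 \<le> C\<psi>" using C\<psi>[of 0] by auto
  \<comment> \<open>The factor \<open>8 * C\<psi>\<close> is
    \<open>2 * C\<psi> * (real N)\<^sup>2\<close> from Green's formula times
    \<open>4 / (real N)\<^sup>2\<close> from the mean inequality.\<close>
  define E where "E = 8 * C\<psi> * (8 * s + 4 * (C * L) / (real (N * m))\<^sup>2)"
  have E0: "0 \<le> E" unfolding E_def using C\<psi>0 s nn by (intro mult_nonneg_nonneg add_nonneg_nonneg divide_nonneg_nonneg) auto
  define Wh where "Wh = {i\<in>{1..q}. \<exists>z\<in>sq N a b. w i z \<le> s}"
  have WhI: "finite Wh" "Wh \<subseteq> {1..q}" by (auto simp: Wh_def)
  have sub': "sq N a b \<subseteq> {z. 1/2 < cmod z \<and> cmod z < 1}" using sub \<omega> by blast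
  have white: "I N a b \<rho> \<le> I N a b (\<beta> i) + E" if i: "i \<in> Wh" for i
  proof -
    have iq: "i \<in> {1..q}" using i WhI by blast
    have "(LINT z:sq N a b|lborel. w i z) \<le> 4 / (real N)\<^sup>2 * (8 * s + 4 * (C * L) / (real (N * m))\<^sup>2)"
    proof (rule set_integral_sq_le_children[OF N0 m N sub' lap[OF iq]])
      show "\<rho> z - \<beta> i z \<le> C * L" if "1/4 \<le> cmod z" "cmod z \<le> 2" for z
        using \<rho>(3)[OF that] \<beta>(2)[OF iq, of z] by linarith
    qed (use nn w[OF iq] good[OF iq] i in \<open>auto simp: Wh_def\<close>)
    moreover have "(LINT z:sq N a b|lborel. \<bar>w i z\<bar>) = (LINT z:sq N a b|lborel. w i z)"
      using sub' w[OF iq] by (intro set_lebesgue_integral_cong) force+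
    moreover have "I N a b (\<lambda>z. \<rho> z - \<beta> i z) \<le> 2 * C\<psi> * (real N)\<^sup>2 * (LINT z:sq N a b|lborel. \<bar>w i z\<bar>)"
      by (rule green_sq_bound[OF N0 laplacian_on_subset[OF lap[OF iq]] C\<psi>]) auto
    ultimately have "I N a b (\<lambda>z. \<rho> z - \<beta> i z) \<le> 2 * C\<psi> * (real N)\<^sup>2 * (4 / (real N)\<^sup>2 * (8 * s + 4 * (C * L) / (real (N * m))\<^sup>2))"
      using C\<psi>0 mult_left_mono[of "LINT z:sq N a b|lborel. w i z" "4 / (real N)\<^sup>2 * (8 * s + 4 * (C * L) / (real (N * m))\<^sup>2)" "2 * C\<psi> * (real N)\<^sup>2"] by simp
    also have "\<dots> = 2 * C\<psi> * 4 * ((real N)\<^sup>2 / (real N)\<^sup>2) * (8 * s + 4 * (C * L) / (real (N * m))\<^sup>2)"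
      by simp
    also have "(real N)\<^sup>2 / (real N)\<^sup>2 = 1" using N0 by simp
    finally have "I N a b (\<lambda>z. \<rho> z - \<beta> i z) \<le> E" by (simp add: E_def)
    moreover have "I N a b (\<lambda>z. \<rho> z - \<beta> i z) = I N a b \<rho> - I N a b (\<beta> i)"
      unfolding right_diff_distrib by (rule set_integral_diff(2)[OF I_integrable[OF \<rho>(1)] I_integrable[OF \<beta>(1)[OF iq]]])
    ultimately show ?thesis by linarith
  qed
  have I\<rho>: "0 \<le> I N a b \<rho>" by (rule I_nonneg[OF N0 \<rho>(2)])
  have I\<beta>: "0 \<le> I N a b (\<beta> i)" if "i \<in> {1..q}" for i by (rule I_nonneg[OF N0 \<beta>(2)[OF that]])
  show ?thesis
  proof (cases "k \<le> card Wh")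
    case True
    then have "real k * I N a b \<rho> \<le> (\<Sum>i\<in>Wh. I N a b \<rho>)" using I\<rho> by (simp add: mult_right_mono)
    also have "\<dots> \<le> (\<Sum>i\<in>Wh. I N a b (\<beta> i) + E)" by (intro sum_mono white)
    also have "\<dots> \<le> (\<Sum>i\<in>{1..q}. I N a b (\<beta> i) + E)"
      using WhI I\<beta> E0 by (intro sum_mono2) auto
    also have "\<dots> = (\<Sum>i\<in>{1..q}. I N a b (\<beta> i)) + real q * E" by (simp add: sum.distrib)
    finally have "real k * I N a b \<rho> \<le> (\<Sum>i\<in>{1..q}. I N a b (\<beta> i)) + real q * E" .
    moreover have "0 \<le> real k * (2 * C\<psi> * B)" using C\<psi>0 nn by simp
    ultimately show ?thesis unfolding E_def by linarith
  next
    case False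
    have "card ({1..q} - Wh) = q - card Wh" using WhI by (simp add: card_Diff_subset)
    then have "q + 1 \<le> card ({1..q} - Wh) + k" using False by simp
    moreover have "S < w j z" if "j \<in> {1..q} - Wh" "z \<in> sq N a b" for j z
      using that s by (force simp: Wh_def)
    ultimately obtain h where h: "laplacian_on (sq N a b) h \<rho>" "\<And>z. z \<in> sq N a b \<Longrightarrow> \<bar>h z\<bar> \<le> B"
      using harmonic[OF N0 sub, of "{1..q} - Wh"] by blast
    have ch: "continuous_on (sq N a b) h" using laplacian_on_continuous[OF h(1)] by simp
    have "(LINT z:sq N a b|lborel. \<bar>h z\<bar>) \<le> (LINT z:sq N a b|lborel. B)"
      using h(2) by (intro set_integral_mono set_integrable_sq continuous_intros ch)
    also have "\<dots> = B / (real N)\<^sup>2" using measure_sq[OF N0] by (simp add: set_lebesgue_integral_def)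
    finally have "2 * C\<psi> * (real N)\<^sup>2 * (LINT z:sq N a b|lborel. \<bar>h z\<bar>) \<le> 2 * C\<psi> * (real N)\<^sup>2 * (B / (real N)\<^sup>2)"
      using C\<psi>0 by (intro mult_left_mono) auto
    moreover have "I N a b \<rho> \<le> 2 * C\<psi> * (real N)\<^sup>2 * (LINT z:sq N a b|lborel. \<bar>h z\<bar>)"
      by (rule green_sq_bound[OF N0 h(1) C\<psi>])
    ultimately have "I N a b \<rho> \<le> 2 * C\<psi> * B" using N0 by simp
    then have "real k * I N a b \<rho> \<le> real k * (2 * C\<psi> * B)" by (intro mult_left_mono) auto
    moreover have "0 \<le> (\<Sum>i\<in>{1..q}. I N a b (\<beta> i))" using I\<beta> by (rule sum_nonneg)
    moreover have "0 \<le> real q * E" using E0 by simp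
    ultimately show ?thesis unfolding E_def by linarith
  qed
qed

text \<open>That the bumps add up to at most the indicator of \<open>\<omega>\<close> is applied to
  the nonnegative function \<open>C * L - \<rho>\<close>: the mass of \<open>\<rho>\<close> that the
  bumps miss is at most \<open>C * L\<close> times the area that they miss.\<close>

lemma set_integral_le_sum_squares:
  assumes N: "N > 0" and A: "finite A" "\<And>a b. (a, b) \<in> A \<Longrightarrow> sq N a b \<subseteq> \<omega>"
  shows "(LINT z:\<omega>|lborel. \<rho> z) \<le> (\<Sum>(a, b)\<in>A. I N a b \<rho>)
      + C * L * (measure lborel \<omega> - (\<Sum>(a, b)\<in>A. (LINT z:sq N a b|lborel. \<phi>\<^sub>q N a b z)))"
proof -
  have fm: "emeasure lborel \<omega> < \<infinity>"
  proof -
    have "emeasure lborel \<omega> \<le> emeasure lborel (ball (0::complex) 1)" using \<omega> by (intro emeasure_mono) auto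
    also have "\<dots> < \<infinity>" by (rule emeasure_lborel_ball_finite)
    finally show ?thesis .
  qed
  have [measurable]: "\<rho> \<in> borel_measurable borel" using \<rho>(1) by (rule borel_measurable_continuous_onI)
  have [measurable]: "\<omega> \<in> sets borel" using open_\<omega> by simp
  have \<rho>le: "\<rho> z \<le> C * L" if "z \<in> \<omega>" for z using that \<omega> by (intro \<rho>(3)) force+
  have iC: "set_integrable lborel \<omega> (\<lambda>z. C * L)"
    unfolding set_integrable_def using fm by (simp add: integrable_indicator_iff)
  have i\<rho>: "set_integrable lborel \<omega> \<rho>"
    by (rule set_integrable_bound[OF iC]) (use \<rho>le \<rho>(2) in \<open>auto simp: set_borel_measurable_def intro!: always_eventually order_trans[OF _ abs_ge_self]\<close>)
  define g where "g z = C * L - \<rho> z" for z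
  have ig: "set_integrable lborel \<omega> g" unfolding g_def by (rule set_integral_diff(1)[OF iC i\<rho>])
  have cg: "continuous_on UNIV g" unfolding g_def by (intro continuous_intros \<rho>(1))
  have "(\<Sum>x\<in>A. I N (fst x) (snd x) g) = (LINT z|lborel. (\<Sum>x\<in>A. indicator (sq N (fst x) (snd x)) z *\<^sub>R (\<phi>\<^sub>q N (fst x) (snd x) z * g z)))"
    unfolding set_lebesgue_integral_def using I_integrable[OF cg] unfolding set_integrable_def
    by (intro Bochner_Integration.integral_sum[symmetric]) blast
  also have "\<dots> \<le> (LINT z:\<omega>|lborel. g z)"
    unfolding set_lebesgue_integral_def
  proof (rule integral_mono')
    show "integrable lborel (\<lambda>z. indicat_real \<omega> z *\<^sub>R g z)" using ig by (simp add: set_integrable_def)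
    fix z
    show g0: "0 \<le> indicat_real \<omega> z *\<^sub>R g z" using \<rho>le by (auto simp: g_def indicator_def)
    have "(\<Sum>x\<in>A. indicator (sq N (fst x) (snd x)) z *\<^sub>R (\<phi>\<^sub>q N (fst x) (snd x) z * g z))
       = (\<Sum>(a, b)\<in>A. indicat_real (sq N a b) z * \<phi>\<^sub>q N a b z) * g z"
      unfolding sum_distrib_right by (intro sum.cong) auto
    also have "\<dots> \<le> indicat_real \<omega> z *\<^sub>R g z"
    proof (cases "z \<in> \<omega>")
      case True
      have "(\<Sum>(a, b)\<in>A. indicat_real (sq N a b) z * \<phi>\<^sub>q N a b z) \<le> 1"
        using sum_\<phi>\<^sub>q_le[OF N A, of z] True by simp
      then have "(\<Sum>(a, b)\<in>A. indicat_real (sq N a b) z * \<phi>\<^sub>q N a b z) * g z \<le> 1 * g z"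
        by (rule mult_right_mono) (use \<rho>le[OF True] in \<open>simp add: g_def\<close>)
      then show ?thesis using True by simp
    next
      case False
      then have "z \<notin> sq N (fst x) (snd x)" if "x \<in> A" for x
        using A(2)[of "fst x" "snd x"] that by auto
      then have "(\<Sum>(a, b)\<in>A. indicat_real (sq N a b) z * \<phi>\<^sub>q N a b z) = 0"
        by (intro sum.neutral) (simp add: case_prod_beta')
      then show ?thesis using False by simp
    qed
    finally show "(\<Sum>x\<in>A. indicator (sq N (fst x) (snd x)) z *\<^sub>R (\<phi>\<^sub>q N (fst x) (snd x) z * g z)) \<le> indicat_real \<omega> z *\<^sub>R g z" .
  qed
  also have "\<dots> = (LINT z:\<omega>|lborel. C * L) - (LINT z:\<omega>|lborel. \<rho> z)"
    unfolding g_def by (rule set_integral_diff(2)[OF iC i\<rho>])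
  also have "(LINT z:\<omega>|lborel. C * L) = C * L * measure lborel \<omega>"
    by (simp add: set_lebesgue_integral_def)
  finally have 1: "(\<Sum>x\<in>A. I N (fst x) (snd x) g) \<le> C * L * measure lborel \<omega> - (LINT z:\<omega>|lborel. \<rho> z)" .
  have "I N a b g = C * L * (LINT z:sq N a b|lborel. \<phi>\<^sub>q N a b z) - I N a b \<rho>" for a b
  proof -
    have "I N a b g = (LINT z:sq N a b|lborel. C * L * \<phi>\<^sub>q N a b z - \<phi>\<^sub>q N a b z * \<rho> z)"
      by (simp add: g_def algebra_simps)
    also have "\<dots> = (LINT z:sq N a b|lborel. C * L * \<phi>\<^sub>q N a b z) - I N a b \<rho>"
      by (intro set_integral_diff(2) I_integrable \<rho>(1) set_integrable_sq continuous_intros continuous_\<phi>\<^sub>q)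
    finally show ?thesis by simp
  qed
  then have "(\<Sum>x\<in>A. I N (fst x) (snd x) g) = C * L * (\<Sum>(a, b)\<in>A. (LINT z:sq N a b|lborel. \<phi>\<^sub>q N a b z)) - (\<Sum>(a, b)\<in>A. I N a b \<rho>)"
    by (simp add: sum_subtractf sum_distrib_left case_prod_beta')
  with 1 show ?thesis by (simp add: algebra_simps)
qed

end

text \<open>Five errors of size \<open>\<tau> / 5 * L\<close> are arranged by choices in this order:
  \<open>t\<close> (area missed by grid and bumps), \<open>m\<close> (remainder of the mean
  inequality), \<open>M\<close> (squares that lose whiteness; depends on \<open>m\<close>),
  \<open>s0\<close> (threshold for white; depends on the finest grid) and \<open>L0\<close> (the
  constant \<open>B\<close>, and \<open>S \<le> s0 * L\<close>). None depends on the potentials;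
  these select only the scale, from the finite list \<open>\<N>\<close>.\<close>

lemma core_estimate:
  fixes \<omega> :: "complex set" and q k :: nat and C S B \<tau> :: real
  assumes op: "open \<omega>" and \<omega>: "\<omega> \<subseteq> {z. 1/2 < cmod z \<and> cmod z < 1}"
    and \<tau>: "\<tau> > 0" and C: "0 \<le> C" and B: "0 \<le> B"
  shows "\<exists>\<psi> \<psi>' \<psi>'' \<N> L0. bump \<psi> \<psi>' \<psi>'' \<and> L0 > 0 \<and> finite \<N> \<and>
    (\<forall>(N, A)\<in>\<N>. N > 0 \<and> finite A \<and> (\<forall>(a, b)\<in>A. sq N a b \<subseteq> \<omega>)) \<and>
    (\<forall>L w \<beta> \<rho>. L0 \<le> L \<longrightarrow> potentials \<psi> \<psi>' \<psi>'' \<omega> q k C S B L w \<beta> \<rho> \<longrightarrow>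
       (\<exists>(N, A)\<in>\<N>. real k * (LINT z:\<omega>|lborel. \<rho> z) \<le>
          (\<Sum>i\<in>{1..q}. \<Sum>(a, b)\<in>A. (LINT z:sq N a b|lborel. bump.\<phi>\<^sub>q \<psi> N a b z * \<beta> i z)) + \<tau> * L))"
proof -
  have \<omega>1: "\<omega> \<subseteq> ball 0 1" using \<omega> by auto
  \<comment> \<open>The area missed is at most \<open>19 * t\<close>: \<open>t\<close> by the
    exhaustion and a fraction \<open>2 * t\<close> by the bumps, on squares of total area at most 9.
    This gives \<open>95 = 5 * 19\<close>.\<close>
  define t where "t = min 1 (\<tau> / (95 * (real k * C + 1)))"
  have t: "0 < t" "t \<le> 1" using \<tau> C by (auto simp: t_def add_nonneg_pos)
  have kC: "0 \<le> real k * C" using C by simp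
  have t5: "real k * C * (19 * t) \<le> \<tau> / 5"
  proof -
    have "t \<le> \<tau> / (95 * (real k * C + 1))" by (simp add: t_def)
    then have "t * (95 * (real k * C + 1)) \<le> \<tau>" using kC by (simp add: pos_le_divide_eq)
    then have "95 * (real k * C * t) + 95 * t \<le> \<tau>" by (simp add: algebra_simps)
    then show ?thesis using t by simp
  qed
  obtain \<psi> \<psi>' \<psi>'' where bump: "bump \<psi> \<psi>' \<psi>''" and I\<psi>: "1 - t \<le> (LBINT x:{0..1}. \<psi> x)"
    using bump_exists[OF t(1)] by blast
  interpret b: bump \<psi> \<psi>' \<psi>'' by (rule bump)
  obtain C\<psi> where C\<psi>: "C\<psi> > 0" "\<And>x. x \<in> {0..1} \<Longrightarrow> \<bar>\<psi>'' x\<bar> \<le> C\<psi>"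
    using b.second_derivative_bound by blast
  obtain N0 where N0: "N0 \<ge> 12" "N0 > 0"
    "measure lborel \<omega> \<le> card {(a, b). sq N0 a b \<subseteq> \<omega>} / (real N0)\<^sup>2 + t"
    using open_exhausted_by_squares[OF op \<omega>1 t(1), of 12] by blast
  define A0 where "A0 = {(a, b). sq N0 a b \<subseteq> \<omega>}"
  have A0: "finite A0" "card A0 \<le> 9 * N0\<^sup>2"
    unfolding A0_def using squares_inside_finite[OF \<omega>1 N0(2)] by auto
  obtain m :: nat where m: "m > 0" "9 * real q * 32 * C\<psi> * C * 5 / \<tau> \<le> real m"
  proof -
    obtain m :: nat where "9 * real q * 32 * C\<psi> * C * 5 / \<tau> < real m" using reals_Archimedean2 by blast
    then show ?thesis using that[of "Suc m"] by simp
  qed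
  obtain M :: nat where M: "M > 0" "(real m)\<^sup>2 * 9 * real q * (real k * C) * 5 / \<tau> \<le> real M"
  proof -
    obtain M :: nat where "(real m)\<^sup>2 * 9 * real q * (real k * C) * 5 / \<tau> < real M" using reals_Archimedean2 by blast
    then show ?thesis using that[of "Suc M"] by simp
  qed
  define NN where "NN j = N0 * m ^ j" for j
  define A where "A j = ((children m) ^^ j) A0" for j
  have NN: "NN j > 0" "12 \<le> NN j" "NN (Suc j) = NN j * m" for j
  proof -
    have "12 * 1 \<le> N0 * m ^ j" using N0 m by (intro mult_le_mono) auto
    then show "12 \<le> NN j" "NN j > 0" using N0(2) m(1) by (simp_all add: NN_def)
  qed (simp add: NN_def)
  have A: "A 0 = A0" "A (Suc j) = children m (A j)" for j by (simp_all add: A_def)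
  have finA: "finite (A j)" and cardA: "card (A j) = (m\<^sup>2) ^ j * card A0" for j
    using A0(1) card_children[OF m(1)] by (induction j) (auto simp: A)
  have Asub: "sq (NN j) a b \<subseteq> \<omega>" if "(a, b) \<in> A j" for j a b
    using that
  proof (induction j arbitrary: a b)
    case 0 then show ?case by (simp add: A A0_def NN_def)
  next
    case (Suc j)
    then have "sq (NN j) (a div int m) (b div int m) \<subseteq> \<omega>" by (auto simp: A children_def)
    then show ?case using sq_child_subset[OF NN(1) m(1), of j a b] by (simp add: NN(3))
  qed
  have NNsq: "(real (NN j))\<^sup>2 = (real m)\<^sup>2 ^ j * (real N0)\<^sup>2" for j
    by (simp add: NN_def power_mult_distrib flip: power_mult) (simp add: mult.commute)
  have cardA': "real (card (A j)) / (real (NN j))\<^sup>2 = real (card A0) / (real N0)\<^sup>2" for j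
    using m(1) by (simp add: cardA NNsq)
  have A0r: "real (card A0) \<le> 9 * (real N0)\<^sup>2"
  proof -
    have "real (card A0) \<le> real (9 * N0\<^sup>2)" using A0(2) by (simp only: of_nat_le_iff)
    then show ?thesis by simp
  qed
  have c0: "real (card A0) / (real N0)\<^sup>2 \<le> 9" using A0r N0(2) by (simp add: pos_divide_le_eq)
  have cardA9: "real (card (A j)) \<le> 9 * (real (NN j))\<^sup>2" for j
  proof -
    have "real (card (A j)) / (real (NN j))\<^sup>2 \<le> 9" using c0 cardA' by simp
    then show ?thesis using NN(1)[of j] by (simp add: pos_divide_le_eq)
  qed
  \<comment> \<open>A bound for the number of squares at every scale \<open>j < M\<close>, as
    \<open>s0\<close> and \<open>L0\<close> are fixed before the scale is known.\<close>
  define K where "K = 9 * (real (NN M))\<^sup>2"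
  have K0: "K > 0" using NN(1)[of M] by (simp add: K_def)
  have cardK: "real (card (A j)) \<le> K" if "j < M" for j
  proof -
    have "m ^ j \<le> m ^ M" using that m(1) by (intro power_increasing) auto
    then have "NN j \<le> NN M" by (simp add: NN_def)
    then have "(real (NN j))\<^sup>2 \<le> (real (NN M))\<^sup>2" by (intro power_mono) auto
    then show ?thesis using cardA9[of j] unfolding K_def by linarith
  qed
  define s0 where "s0 = \<tau> / (5 * (K * real q * 64 * C\<psi> + 1))"
  have Kq: "0 \<le> K * real q * 64 * C\<psi>" using K0 C\<psi>(1) by simp
  have s0: "s0 > 0" "K * real q * 64 * C\<psi> * s0 \<le> \<tau> / 5"
  proof -
    show s0: "s0 > 0" using \<tau> Kq by (simp add: s0_def add_nonneg_pos)
    define X where "X = 5 * (K * real q * 64 * C\<psi> + 1)"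
    have "X > 0" unfolding X_def by (intro mult_pos_pos add_nonneg_pos zero_less_one Kq) simp
    then have "s0 * X = \<tau>" by (simp only: s0_def X_def[symmetric] times_divide_eq_left) simp
    then have "s0 * (5 * (K * real q * 64 * C\<psi> + 1)) = \<tau>" by (simp only: X_def)
    then have "5 * (K * real q * 64 * C\<psi> * s0) + 5 * s0 = \<tau>" by (simp add: algebra_simps)
    then show "K * real q * 64 * C\<psi> * s0 \<le> \<tau> / 5" using s0 by simp
  qed
  define L0 where "L0 = max 1 (max (K * real k * (2 * C\<psi> * B) * 5 / \<tau>) (S / s0))"
  define \<N> where "\<N> = (\<lambda>j. (NN j, A j)) ` {..<M}"
  have main: "\<exists>(N, A)\<in>\<N>. real k * (LINT z:\<omega>|lborel. \<rho> z) \<le>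
          (\<Sum>i\<in>{1..q}. \<Sum>(a, b)\<in>A. (LINT z:sq N a b|lborel. bump.\<phi>\<^sub>q \<psi> N a b z * \<beta> i z)) + \<tau> * L"
    if L: "L0 \<le> L" and pot: "potentials \<psi> \<psi>' \<psi>'' \<omega> q k C S B L w \<beta> \<rho>" for L w \<beta> \<rho>
  proof -
    interpret p: potentials \<psi> \<psi>' \<psi>'' \<omega> q k C S B L w \<beta> \<rho> by (rule pot)
    have L1: "1 \<le> L" "K * real k * (2 * C\<psi> * B) * 5 / \<tau> \<le> L" "S / s0 \<le> L" using L by (auto simp: L0_def)
    define s where "s = s0 * L"
    have s: "S \<le> s" "0 \<le> s" using L1 s0(1) by (auto simp: s_def pos_divide_le_eq mult.commute)
    define W where "W j i = {x\<in>A j. \<exists>z\<in>sq (NN j) (fst x) (snd x). w i z \<le> s}" for j i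
    have W1: "W j i \<subseteq> A j" for j i by (auto simp: W_def)
    have W2: "W (Suc j) i \<subseteq> children m (W j i)" for j i
    proof
      fix x assume x: "x \<in> W (Suc j) i"
      obtain a b where ab: "x = (a, b)" by (cases x)
      have "(a div int m, b div int m) \<in> A j" using x by (auto simp: W_def ab A children_def)
      moreover have "\<exists>z\<in>sq (NN j) (a div int m) (b div int m). w i z \<le> s"
        using x sq_child_subset[OF NN(1) m(1), of j a b] by (auto simp: W_def ab NN(3))
      ultimately show "x \<in> children m (W j i)" by (simp add: W_def ab children_def)
    qed
    have "\<exists>j<M. real (card {x\<in>A j. \<exists>i\<in>{1..q}. x \<in> W j i \<and> \<not> children m {x} \<subseteq> W (Suc j) i})
      \<le> (real m)\<^sup>2 * (real m)\<^sup>2 ^ j * (real q * (9 * (real N0)\<^sup>2) / real M)"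
      by (rule pigeonhole_scale[where A = A and W = W, OF m(1) M(1) _ _ A(2) W1 W2]) (use A0 A0r in \<open>simp_all add: A(1)\<close>)
    then obtain j where j: "j < M" and jb: "real (card {x\<in>A j. \<exists>i\<in>{1..q}. x \<in> W j i \<and> \<not> children m {x} \<subseteq> W (Suc j) i})
      \<le> (real m)\<^sup>2 * (real m)\<^sup>2 ^ j * (real q * (9 * (real N0)\<^sup>2) / real M)" by blast
    define Bd where "Bd = {x\<in>A j. \<exists>i\<in>{1..q}. x \<in> W j i \<and> \<not> children m {x} \<subseteq> W (Suc j) i}"
    define N where "N = NN j"
    have N: "N > 0" "12 \<le> N" using NN by (auto simp: N_def)
    have N2: "(real N)\<^sup>2 > 0" using N by simp
    define I where "I x f = (LINT z:sq N (fst x) (snd x)|lborel. b.\<phi>\<^sub>q N (fst x) (snd x) z * f z)" for x and f :: "complex \<Rightarrow> real"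
    define E where "E = real q * (8 * C\<psi> * (8 * s + 4 * (C * L) / (real (N * m))\<^sup>2)) + real k * (2 * C\<psi> * B)"
    have E0: "0 \<le> E" unfolding E_def using C\<psi>(1) s C B L1 by (intro add_nonneg_nonneg mult_nonneg_nonneg divide_nonneg_nonneg) auto
    have sqA: "sq N (fst x) (snd x) \<subseteq> \<omega>" if "x \<in> A j" for x using Asub[of "fst x" "snd x" j] that by (simp add: N_def)
    have Ibeta: "0 \<le> I x (\<beta> i)" if "i \<in> {1..q}" for x i
      unfolding I_def by (rule p.I_nonneg[OF N(1) p.\<beta>(2)[OF that]])
    \<comment> \<open>On a bad square the crude bound \<open>\<rho> \<le> C * L\<close> is used; the
      pigeonhole principle makes such squares rare.\<close>
    have each: "real k * I x \<rho> \<le> (\<Sum>i\<in>{1..q}. I x (\<beta> i)) + E + (if x \<in> Bd then real k * (C * L / (real N)\<^sup>2) else 0)"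
      if x: "x \<in> A j" for x
    proof (cases "x \<in> Bd")
      case True
      have "real k * I x \<rho> \<le> real k * (C * L / (real N)\<^sup>2)"
        unfolding I_def by (intro mult_left_mono p.I_\<rho>_le[OF N(1) sqA[OF x]]) auto
      then show ?thesis using True E0 sum_nonneg[of "{1..q}" "\<lambda>i. I x (\<beta> i)"] Ibeta by simp
    next
      case False
      have "real k * I x \<rho> \<le> (\<Sum>i\<in>{1..q}. I x (\<beta> i)) + real q * (8 * C\<psi> * (8 * s + 4 * (C * L) / (real (N * m))\<^sup>2)) + real k * (2 * C\<psi> * B)"
        unfolding I_def
      proof (rule p.good_square[OF N(2) m(1) sqA[OF x] s C\<psi>(2)])
        fix i y assume i: "i \<in> {1..q}" and wh: "\<exists>z\<in>sq N (fst x) (snd x). w i z \<le> s" and y: "y \<in> children m {(fst x, snd x)}"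
        have "x \<in> W j i" using x wh by (simp add: W_def N_def)
        then have "children m {x} \<subseteq> W (Suc j) i" using False i x by (auto simp: Bd_def)
        then show "\<exists>z\<in>sq (N * m) (fst y) (snd y). w i z \<le> s" using y by (auto simp: W_def N_def NN(3))
      qed
      then show ?thesis using False by (simp add: E_def)
    qed
    have "real k * (\<Sum>x\<in>A j. I x \<rho>) \<le> (\<Sum>x\<in>A j. (\<Sum>i\<in>{1..q}. I x (\<beta> i)) + E + (if x \<in> Bd then real k * (C * L / (real N)\<^sup>2) else 0))"
      unfolding sum_distrib_left by (rule sum_mono[OF each])
    also have "\<dots> = (\<Sum>i\<in>{1..q}. \<Sum>x\<in>A j. I x (\<beta> i)) + real (card (A j)) * E + real (card Bd) * (real k * (C * L / (real N)\<^sup>2))"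
    proof -
      have "A j \<inter> Bd = Bd" by (auto simp: Bd_def)
      then have "(\<Sum>x\<in>A j. (if x \<in> Bd then real k * (C * L / (real N)\<^sup>2) else 0)) = real (card Bd) * (real k * (C * L / (real N)\<^sup>2))"
        by (subst sum.inter_restrict[OF finA, symmetric]) simp
      moreover have "(\<Sum>x\<in>A j. \<Sum>i\<in>{1..q}. I x (\<beta> i)) = (\<Sum>i\<in>{1..q}. \<Sum>x\<in>A j. I x (\<beta> i))" by (rule sum.swap)
      ultimately show ?thesis by (simp add: sum.distrib)
    qed
    finally have 1: "real k * (\<Sum>x\<in>A j. I x \<rho>) \<le> (\<Sum>i\<in>{1..q}. \<Sum>x\<in>A j. I x (\<beta> i)) + real (card (A j)) * E + real (card Bd) * (real k * (C * L / (real N)\<^sup>2))" .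
    have bad: "real (card Bd) * (real k * (C * L / (real N)\<^sup>2)) \<le> \<tau> / 5 * L"
    proof -
      have "real (card Bd) \<le> (real m)\<^sup>2 * 9 * real q / real M * (real N)\<^sup>2"
        using jb unfolding Bd_def[symmetric] by (simp add: N_def NNsq mult_ac)
      then have "real (card Bd) / (real N)\<^sup>2 \<le> (real m)\<^sup>2 * 9 * real q / real M"
        using N2 by (simp add: pos_divide_le_eq)
      then have "real (card Bd) / (real N)\<^sup>2 * (real k * C * L) \<le> (real m)\<^sup>2 * 9 * real q / real M * (real k * C * L)"
        using kC L1 by (intro mult_right_mono) auto
      also have "\<dots> = ((real m)\<^sup>2 * 9 * real q * (real k * C) / real M) * L" by simp
      also have "\<dots> \<le> \<tau> / 5 * L"
      proof (intro mult_right_mono)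
        have "(real m)\<^sup>2 * 9 * real q * (real k * C) * 5 \<le> real M * \<tau>" using M(2) \<tau> by (simp add: pos_divide_le_eq)
        then show "(real m)\<^sup>2 * 9 * real q * (real k * C) / real M \<le> \<tau> / 5" using M(1) by (simp add: field_simps)
      qed (use L1 in simp)
      finally show ?thesis by (simp add: mult_ac)
    qed
    have est: "real (card (A j)) * E \<le> 3 * (\<tau> / 5) * L"
    proof -
      have e1: "real (card (A j)) * (real q * (8 * C\<psi> * (8 * s))) \<le> \<tau> / 5 * L"
      proof -
        have "real (card (A j)) * (real q * (8 * C\<psi> * (8 * s))) \<le> K * (real q * (8 * C\<psi> * (8 * s)))"
          using cardK[OF j] C\<psi>(1) s by (intro mult_right_mono) auto
        also have "\<dots> = (K * real q * 64 * C\<psi> * s0) * L" by (simp add: s_def)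
        also have "\<dots> \<le> \<tau> / 5 * L" using s0(2) L1 by (intro mult_right_mono) auto
        finally show ?thesis .
      qed
      have e2: "real (card (A j)) * (real q * (8 * C\<psi> * (4 * (C * L) / (real (N * m))\<^sup>2))) \<le> \<tau> / 5 * L"
      proof -
        have "real (card (A j)) * (real q * (8 * C\<psi> * (4 * (C * L) / (real (N * m))\<^sup>2)))
          = real (card (A j)) / (real N)\<^sup>2 * (real q * 32 * C\<psi> * C * L / (real m)\<^sup>2)"
          by (simp add: power_mult_distrib)
        also have "\<dots> \<le> 9 * (real q * 32 * C\<psi> * C * L / (real m)\<^sup>2)"
          using c0 cardA'[of j] C\<psi>(1) C L1 by (intro mult_right_mono) (auto simp: N_def)
        also have "\<dots> \<le> 9 * (real q * 32 * C\<psi> * C * L / real m)"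
        proof -
          have "real m * 1 \<le> real m * real m" using m(1) by (intro mult_left_mono) auto
          then have "real m \<le> (real m)\<^sup>2" by (simp add: power2_eq_square)
          then show ?thesis using m(1) C\<psi>(1) C L1 by (intro mult_left_mono divide_left_mono) auto
        qed
        also have "\<dots> = 9 * real q * 32 * C\<psi> * C / real m * L" by simp
        also have "\<dots> \<le> \<tau> / 5 * L"
        proof (intro mult_right_mono)
          have "9 * real q * 32 * C\<psi> * C * 5 \<le> real m * \<tau>" using m(2) \<tau> by (simp add: pos_divide_le_eq)
          then show "9 * real q * 32 * C\<psi> * C / real m \<le> \<tau> / 5" using m(1) by (simp add: field_simps)
        qed (use L1 in simp)
        finally show ?thesis .
      qed
      have e3: "real (card (A j)) * (real k * (2 * C\<psi> * B)) \<le> \<tau> / 5 * L"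
      proof -
        have "real (card (A j)) * (real k * (2 * C\<psi> * B)) \<le> K * (real k * (2 * C\<psi> * B))"
          using cardK[OF j] C\<psi>(1) B by (intro mult_right_mono) auto
        also have "\<dots> \<le> \<tau> / 5 * L" using L1(2) \<tau> by (simp add: pos_divide_le_eq mult_ac)
        finally show ?thesis .
      qed
      have "real (card (A j)) * E = real (card (A j)) * (real q * (8 * C\<psi> * (8 * s)))
          + real (card (A j)) * (real q * (8 * C\<psi> * (4 * (C * L) / (real (N * m))\<^sup>2)))
          + real (card (A j)) * (real k * (2 * C\<psi> * B))"
        by (simp add: E_def distrib_left)
      then show ?thesis using e1 e2 e3 by (simp add: algebra_simps)
    qed
    have "(LINT z:\<omega>|lborel. \<rho> z) \<le> (\<Sum>(a, b)\<in>A j. p.I N a b \<rho>)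
      + C * L * (measure lborel \<omega> - (\<Sum>(a, b)\<in>A j. (LINT z:sq N a b|lborel. b.\<phi>\<^sub>q N a b z)))"
      by (rule p.set_integral_le_sum_squares[OF N(1) finA]) (use sqA in force)
    moreover have "(\<Sum>(a, b)\<in>A j. p.I N a b \<rho>) = (\<Sum>x\<in>A j. I x \<rho>)"
      by (simp add: I_def case_prod_beta')
    moreover have "measure lborel \<omega> - (\<Sum>(a, b)\<in>A j. (LINT z:sq N a b|lborel. b.\<phi>\<^sub>q N a b z)) \<le> 19 * t"
    proof -
      have "real (card (A j)) * ((1 - 2 * t) / (real N)\<^sup>2) = (\<Sum>(a, b)\<in>A j. (1 - 2 * t) / (real N)\<^sup>2)" by simp
      also have "\<dots> \<le> (\<Sum>(a, b)\<in>A j. (LINT z:sq N a b|lborel. b.\<phi>\<^sub>q N a b z))"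
        unfolding case_prod_beta' using t by (intro sum_mono b.integral_\<phi>\<^sub>q_ge[OF N(1) I\<psi>]) auto
      finally have 2: "real (card (A j)) * ((1 - 2 * t) / (real N)\<^sup>2) \<le> (\<Sum>(a, b)\<in>A j. (LINT z:sq N a b|lborel. b.\<phi>\<^sub>q N a b z))" .
      define c where "c = real (card (A j)) / (real N)\<^sup>2"
      have c: "c \<le> 9" "measure lborel \<omega> \<le> c + t"
        using c0 N0(3) cardA'[of j] by (simp_all add: c_def N_def A0_def)
      have "real (card (A j)) * ((1 - 2 * t) / (real N)\<^sup>2) = c - 2 * (c * t)" by (simp add: c_def algebra_simps diff_divide_distrib)
      moreover have "c * t \<le> 9 * t" using c(1) t by (intro mult_right_mono) auto
      ultimately show ?thesis using 2 c(2) by linarith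
    qed
    then have "C * L * (measure lborel \<omega> - (\<Sum>(a, b)\<in>A j. (LINT z:sq N a b|lborel. b.\<phi>\<^sub>q N a b z))) \<le> C * L * (19 * t)"
      using C L1 by (intro mult_left_mono) auto
    ultimately have "(LINT z:\<omega>|lborel. \<rho> z) \<le> (\<Sum>x\<in>A j. I x \<rho>) + C * L * (19 * t)" by linarith
    then have "real k * (LINT z:\<omega>|lborel. \<rho> z) \<le> real k * ((\<Sum>x\<in>A j. I x \<rho>) + C * L * (19 * t))"
      by (intro mult_left_mono) auto
    also have "\<dots> = real k * (\<Sum>x\<in>A j. I x \<rho>) + real k * C * (19 * t) * L" by (simp add: algebra_simps)
    also have "real k * C * (19 * t) * L \<le> \<tau> / 5 * L" using t5 L1 by (intro mult_right_mono) auto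
    finally have main: "real k * (LINT z:\<omega>|lborel. \<rho> z) \<le> real k * (\<Sum>x\<in>A j. I x \<rho>) + \<tau> / 5 * L" by simp
    have "real k * (LINT z:\<omega>|lborel. \<rho> z) \<le> (\<Sum>i\<in>{1..q}. \<Sum>x\<in>A j. I x (\<beta> i)) + \<tau> * L"
    proof -
      have e: "\<tau> / 5 * L = \<tau> * L / 5" "3 * (\<tau> / 5) * L = 3 * (\<tau> * L) / 5" by simp_all
      from main show ?thesis using 1 bad est unfolding e by linarith
    qed
    then have "real k * (LINT z:\<omega>|lborel. \<rho> z) \<le> (\<Sum>i\<in>{1..q}. \<Sum>(a, b)\<in>A j. (LINT z:sq N a b|lborel. b.\<phi>\<^sub>q N a b z * \<beta> i z)) + \<tau> * L"
      by (simp add: I_def case_prod_beta')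
    then show ?thesis using j by (auto simp: \<N>_def N_def)
  qed
  have "L0 > 0" by (simp add: L0_def)
  moreover have "finite \<N>" by (simp add: \<N>_def)
  moreover have "NN j > 0 \<and> finite (A j) \<and> (\<forall>(a, b)\<in>A j. sq (NN j) a b \<subseteq> \<omega>)" for j
    using NN(1) finA Asub by blast
  then have "\<forall>(N, A)\<in>\<N>. N > 0 \<and> finite A \<and> (\<forall>(a, b)\<in>A. sq N a b \<subseteq> \<omega>)"
    unfolding \<N>_def by blast
  ultimately show ?thesis using bump main
    by (intro exI[of _ \<psi>] exI[of _ \<psi>'] exI[of _ \<psi>''] exI[of _ \<N>] exI[of _ L0] conjI allI impI) auto
qed

section \<open>The Fubini-Study derivative as a Laplacian\<close>

text \<open>The terms are symmetric in \<open>i\<close> and \<open>j\<close> and vanish for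
  \<open>i = j\<close>, so the sum over all pairs is twice the left side; expanding the squares
  there gives twice the right side.\<close>

lemma lagrange_identity_complex:
  fixes a b :: "'i::{finite,linorder} \<Rightarrow> complex"
  shows "(\<Sum>(i, j)\<in>{(i, j). i < j}. (cmod (b i * a j - a i * b j))\<^sup>2)
    = (\<Sum>i\<in>UNIV. (cmod (b i))\<^sup>2) * (\<Sum>i\<in>UNIV. (cmod (a i))\<^sup>2) - (cmod (\<Sum>i\<in>UNIV. a i * cnj (b i)))\<^sup>2"
proof -
  define f where "f i j = (cmod (b i * a j - a i * b j))\<^sup>2" for i j
  have sym: "f i j = f j i" for i j
    unfolding f_def by (simp add: norm_minus_commute mult.commute)
  have diag: "f i i = 0" for i by (simp add: f_def)
  have split: "UNIV = {(i, j :: 'i). i < j} \<union> {(i, j). j < i} \<union> {(i, j). i = j}" by auto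
  have "(\<Sum>p\<in>UNIV. case p of (i, j) \<Rightarrow> f i j) = (\<Sum>(i, j)\<in>{(i, j). i < j}. f i j) + (\<Sum>(i, j)\<in>{(i, j). j < i}. f i j)
      + (\<Sum>(i, j)\<in>{(i, j). i = j}. f i j)"
    by (subst split, subst sum.union_disjoint, simp, simp, force, subst sum.union_disjoint) (auto intro: finite_subset[OF subset_UNIV])
  also have "(\<Sum>(i, j)\<in>{(i, j). i = j}. f i j) = 0" by (intro sum.neutral) (auto simp: diag)
  also have "(\<Sum>(i, j)\<in>{(i, j). j < i}. f i j) = (\<Sum>(i, j)\<in>{(i, j). i < j}. f i j)"
    by (rule sum.reindex_bij_witness[of _ prod.swap prod.swap]) (auto simp: sym)
  finally have 1: "(\<Sum>p\<in>UNIV. case p of (i, j) \<Rightarrow> f i j) = 2 * (\<Sum>(i, j)\<in>{(i, j). i < j}. f i j)" by simp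
  have fe: "f i j = (cmod (b i))\<^sup>2 * (cmod (a j))\<^sup>2 + (cmod (a i))\<^sup>2 * (cmod (b j))\<^sup>2 - 2 * Re ((a i * cnj (b i)) * cnj (a j * cnj (b j)))" for i j
    unfolding f_def cmod_power2 by (simp add: power2_eq_square algebra_simps)
  have "(\<Sum>p\<in>UNIV. case p of (i, j) \<Rightarrow> f i j) = (\<Sum>i\<in>UNIV. \<Sum>j\<in>UNIV. f i j)"
    by (simp add: sum.cartesian_product)
  also have "\<dots> = (\<Sum>i\<in>UNIV. (cmod (b i))\<^sup>2) * (\<Sum>j\<in>UNIV. (cmod (a j))\<^sup>2) + (\<Sum>i\<in>UNIV. (cmod (a i))\<^sup>2) * (\<Sum>j\<in>UNIV. (cmod (b j))\<^sup>2)
      - 2 * Re ((\<Sum>i\<in>UNIV. a i * cnj (b i)) * (\<Sum>j\<in>UNIV. cnj (a j * cnj (b j))))"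
    unfolding fe sum_product Re_sum by (simp add: sum.distrib sum_subtractf sum_distrib_left)
  also have "(\<Sum>j\<in>UNIV. cnj (a j * cnj (b j))) = cnj (\<Sum>j\<in>UNIV. a j * cnj (b j))" by simp
  also have "Re ((\<Sum>i\<in>UNIV. a i * cnj (b i)) * cnj (\<Sum>j\<in>UNIV. a j * cnj (b j))) = (cmod (\<Sum>i\<in>UNIV. a i * cnj (b i)))\<^sup>2"
    by (metis Re_complex_of_real complex_norm_square of_real_power)
  finally show ?thesis using 1 unfolding f_def by (simp add: mult.commute)
qed

text \<open>The Riesz density is the Laplacian divided by \<open>2 * pi\<close>; the factor 2 here
  leaves the \<open>1 / pi\<close> of \<open>riesz_measure\<close>.\<close>

lemma laplacian_log_norm_vec:
  fixes F :: "complex \<Rightarrow> complex ^ ('n::{finite,linorder})"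
  assumes hol: "\<And>j. (\<lambda>z. F z $ j) holomorphic_on UNIV" and nz: "\<And>z. F z \<noteq> 0"
  shows "laplacian_on UNIV (\<lambda>z. ln (norm (F z))) (\<lambda>z. 2 * (fs_deriv F z)\<^sup>2)"
proof -
  have S: "(\<Sum>i\<in>UNIV. (cmod (F z $ i))\<^sup>2) = (norm (F z))\<^sup>2" for z
    by (simp add: norm_vec_def L2_set_def sum_nonneg)
  have lap: "laplacian_on UNIV (\<lambda>z. ln (\<Sum>i\<in>UNIV. (cmod (F z $ i))\<^sup>2) / 2)
    (\<lambda>z. 2 * ((\<Sum>i\<in>UNIV. (cmod (deriv (\<lambda>w. F w $ i) z))\<^sup>2) / (\<Sum>i\<in>UNIV. (cmod (F z $ i))\<^sup>2)
           - (cmod (\<Sum>i\<in>UNIV. F z $ i * cnj (deriv (\<lambda>w. F w $ i) z)))\<^sup>2 / (\<Sum>i\<in>UNIV. (cmod (F z $ i))\<^sup>2)\<^sup>2))"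
    by (rule laplacian_log_norm[where F = "\<lambda>i z. F z $ i"]) (use hol nz S in auto)
  have ln: "ln ((norm (F z))\<^sup>2) / 2 = ln (norm (F z))" for z
    using nz by (simp add: ln_realpow)
  have eq: "(\<Sum>i\<in>UNIV. (cmod (deriv (\<lambda>w. F w $ i) z))\<^sup>2) / (\<Sum>i\<in>UNIV. (cmod (F z $ i))\<^sup>2)
           - (cmod (\<Sum>i\<in>UNIV. F z $ i * cnj (deriv (\<lambda>w. F w $ i) z)))\<^sup>2 / (\<Sum>i\<in>UNIV. (cmod (F z $ i))\<^sup>2)\<^sup>2
         = (fs_deriv F z)\<^sup>2" for z
  proof -
    define s where "s = (\<Sum>i\<in>UNIV. (cmod (F z $ i))\<^sup>2)"
    have s: "s \<noteq> 0" using nz[of z] S[of z] by (simp add: s_def)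
    have "(fs_deriv F z)\<^sup>2 = (\<Sum>(i, j)\<in>{(i, j). i < j}. (cmod (deriv (\<lambda>w. F w $ i) z * F z $ j - F z $ i * deriv (\<lambda>w. F w $ j) z))\<^sup>2) / s\<^sup>2"
      unfolding fs_deriv_def s_def by (subst real_sqrt_pow2) (auto intro!: divide_nonneg_nonneg sum_nonneg)
    also have "\<dots> = ((\<Sum>i\<in>UNIV. (cmod (deriv (\<lambda>w. F w $ i) z))\<^sup>2) * s - (cmod (\<Sum>i\<in>UNIV. F z $ i * cnj (deriv (\<lambda>w. F w $ i) z)))\<^sup>2) / s\<^sup>2"
      unfolding lagrange_identity_complex s_def ..
    also have "\<dots> = (\<Sum>i\<in>UNIV. (cmod (deriv (\<lambda>w. F w $ i) z))\<^sup>2) / s - (cmod (\<Sum>i\<in>UNIV. F z $ i * cnj (deriv (\<lambda>w. F w $ i) z)))\<^sup>2 / s\<^sup>2"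
      using s by (simp add: diff_divide_distrib power2_eq_square)
    finally show ?thesis by (simp only: s_def)
  qed
  show ?thesis using lap unfolding S ln eq[unfolded S] .
qed

lemma holomorphic_eval_cpoly:
  fixes F :: "complex \<Rightarrow> complex ^ ('n::finite)"
  assumes "\<And>j. (\<lambda>z. F z $ j) holomorphic_on S"
  shows "(\<lambda>z. eval_cpoly Q (F z)) holomorphic_on S"
  unfolding eval_cpoly_def by (intro holomorphic_intros assms)

text \<open>The error constant is uniform in the curve; this is what replaces the usual normal family
  argument for the rescaled functions \<open>log \<parallel>F\<parallel>\<close>.\<close>

lemma annulus_estimate:
  fixes V :: "('n::{finite,linorder}) pspace set" and Q :: "nat \<Rightarrow> 'n cpoly" and d :: "nat \<Rightarrow> nat"
  assumes V: "palgebraic V"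
    and Q: "\<And>i. i \<in> {1..q} \<Longrightarrow> homogeneous (d i) (Q i)" "\<And>i. i \<in> {1..q} \<Longrightarrow> d i \<ge> 1"
    and gap: "\<And>J. J \<subseteq> {1..q} \<Longrightarrow> q + 1 \<le> card J + k \<Longrightarrow>
        \<exists>e P. e \<ge> 1 \<and> homogeneous e P \<and> V \<inter> (\<Inter>j\<in>J. pzeros (Q j)) \<inter> pzeros P = {}"
    and op: "open \<omega>" and \<omega>: "\<omega> \<subseteq> {z. 1/2 < cmod z \<and> cmod z < 1}"
    and \<tau>: "\<tau> > 0" and C: "0 \<le> C"
  shows "\<exists>L0>0. \<forall>L\<ge>L0. \<forall>F. (\<forall>j. (\<lambda>z. F z $ j) holomorphic_on UNIV) \<longrightarrow> (\<forall>z. F z \<noteq> 0 \<and> proj (F z) \<in> V) \<longrightarrow>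
     (\<forall>i\<in>{1..q}. \<exists>z. eval_cpoly (Q i) (F z) \<noteq> 0) \<longrightarrow>
     (\<forall>z. 1/4 \<le> cmod z \<longrightarrow> cmod z \<le> 2 \<longrightarrow> 2 * (fs_deriv F z)\<^sup>2 \<le> C * L) \<longrightarrow>
     real k * (LINT z:\<omega>|lborel. 2 * (fs_deriv F z)\<^sup>2) \<le>
       (\<Sum>i\<in>{1..q}. 2 * pi / real (d i) * (\<Sum>z\<in>{z \<in> \<omega>. eval_cpoly (Q i) (F z) = 0}. real (nat (zorder (\<lambda>z. eval_cpoly (Q i) (F z)) z)))) + \<tau> * L"
proof -
  have "\<exists>A>0. \<forall>x. cmod (eval_cpoly (Q i) x) \<le> A * norm x ^ d i" if "i \<in> {1..q}" for i
    by (rule homogeneous_upper_bound[OF Q(1)[OF that]])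
  then obtain a where a: "\<And>i. i \<in> {1..q} \<Longrightarrow> a i > 0" "\<And>i x. i \<in> {1..q} \<Longrightarrow> cmod (eval_cpoly (Q i) x) \<le> a i * norm x ^ d i"
    by metis
  \<comment> \<open>Added to \<open>w i\<close> below, \<open>B0\<close> makes it nonnegative: it
    absorbs the constant \<open>a i\<close> from the upper bound of \<open>Q i\<close> and, through
    the summand 1, the regularization.\<close>
  define B0 where "B0 = (\<Sum>i\<in>{1..q}. ln ((a i)\<^sup>2 + 1) / 2)"
  have B0: "ln ((a i)\<^sup>2 + 1) / (2 * real (d i)) \<le> B0" if i: "i \<in> {1..q}" for i
  proof -
    have l0: "0 \<le> ln ((a i)\<^sup>2 + 1)" for i by simp
    have "ln ((a i)\<^sup>2 + 1) / (2 * real (d i)) \<le> ln ((a i)\<^sup>2 + 1) / 2"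
      using Q(2)[OF i] l0[of i] by (intro divide_left_mono) auto
    also have "\<dots> \<le> B0" unfolding B0_def using i l0 by (intro member_le_sum) auto
    finally show ?thesis .
  qed
  \<comment> \<open>There are finitely many index sets, so forms and constants can be chosen for all
    of them at once, before any curve is given.\<close>
  define \<J> where "\<J> = {J. J \<subseteq> {1..q} \<and> q + 1 \<le> card J + k}"
  have fin\<J>: "finite \<J>" unfolding \<J>_def by (rule finite_subset[of _ "Pow {1..q}"]) auto
  define good where "good J e P \<delta> c A \<longleftrightarrow> e \<ge> (1::nat) \<and> homogeneous e P \<and> \<delta> > (0::real) \<and> c > (0::real) \<and> A > (0::real) \<and>
     (\<forall>x. cmod (eval_cpoly P x) \<le> A * norm x ^ e) \<and>
     (\<forall>x. x \<noteq> 0 \<longrightarrow> proj x \<in> V \<longrightarrow> (\<forall>j\<in>J. cmod (eval_cpoly (Q j) x) \<le> \<delta> * norm x ^ d j) \<longrightarrow> c * norm x ^ e \<le> cmod (eval_cpoly P x))"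
    for J e P \<delta> c A
  have "\<exists>e P \<delta> c A. good J e P \<delta> c A" if "J \<in> \<J>" for J
  proof -
    have J: "J \<subseteq> {1..q}" "q + 1 \<le> card J + k" using that by (auto simp: \<J>_def)
    obtain e P where eP: "e \<ge> 1" "homogeneous e P" "V \<inter> (\<Inter>j\<in>J. pzeros (Q j)) \<inter> pzeros P = {}"
      using gap[OF J] by blast
    have "finite J" using J(1) finite_subset by blast
    moreover have "homogeneous (d j) (Q j)" if "j \<in> J" for j using Q(1) J(1) that by blast
    ultimately have "\<exists>\<delta>>0. \<exists>c>0. \<forall>x. x \<noteq> 0 \<longrightarrow> proj x \<in> V \<longrightarrow>
     (\<forall>j\<in>J. cmod (eval_cpoly (Q j) x) \<le> \<delta> * norm x ^ d j) \<longrightarrow> c * norm x ^ e \<le> cmod (eval_cpoly P x)"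
      using homogeneous_lower_bound_near[OF V _ _ eP(2,3)] by blast
    then show ?thesis unfolding good_def using homogeneous_upper_bound[OF eP(2)] eP(1,2) by blast
  qed
  then obtain e P \<delta> c A where "\<And>J. J \<in> \<J> \<Longrightarrow> good J (e J) (P J) (\<delta> J) (c J) (A J)" by metis
  note good = this[unfolded good_def]
  have e: "\<And>J. J \<in> \<J> \<Longrightarrow> e J \<ge> (1::nat)"
    and pos: "\<And>J. J \<in> \<J> \<Longrightarrow> \<delta> J > (0::real)" "\<And>J. J \<in> \<J> \<Longrightarrow> c J > (0::real)" "\<And>J. J \<in> \<J> \<Longrightarrow> A J > (0::real)"
    and up: "\<And>J x. J \<in> \<J> \<Longrightarrow> cmod (eval_cpoly (P J) x) \<le> A J * norm x ^ e J"
    and low: "\<And>J x. J \<in> \<J> \<Longrightarrow> x \<noteq> 0 \<Longrightarrow> proj x \<in> V \<Longrightarrow> (\<And>j. j \<in> J \<Longrightarrow> cmod (eval_cpoly (Q j) x) \<le> \<delta> J * norm x ^ d j)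
       \<Longrightarrow> c J * norm x ^ e J \<le> cmod (eval_cpoly (P J) x)"
    using good by blast+
  \<comment> \<open>\<open>w j z > S\<close> will force the modulus of \<open>Q j\<close> at
    \<open>F z\<close> to be at most \<open>\<delta> J * norm (F z) ^ d j\<close>. Then
    \<open>B\<close> bounds the difference between \<open>ln (norm (F z))\<close> and the logarithm
    of \<open>P J\<close> at \<open>F z\<close> divided by \<open>e J\<close>.\<close>
  define S where "S = B0 + (\<Sum>J\<in>\<J>. \<bar>ln (\<delta> J)\<bar>)"
  define B where "B = (\<Sum>J\<in>\<J>. \<bar>ln (c J)\<bar> + \<bar>ln (A J)\<bar>)"
  have B: "0 \<le> B" unfolding B_def by (intro sum_nonneg) auto
  have \<tau>2: "\<tau> / 2 > 0" using \<tau> by simp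
  from core_estimate[OF op \<omega> \<tau>2 C B, of q k S]
  obtain \<psi> \<psi>' \<psi>'' \<N> L0 where core_all: "bump \<psi> \<psi>' \<psi>'' \<and> L0 > 0 \<and> finite \<N> \<and>
    (\<forall>(N, A)\<in>\<N>. N > 0 \<and> finite A \<and> (\<forall>(a, b)\<in>A. sq N a b \<subseteq> \<omega>)) \<and>
    (\<forall>L w \<beta> \<rho>. L0 \<le> L \<longrightarrow> potentials \<psi> \<psi>' \<psi>'' \<omega> q k C S B L w \<beta> \<rho> \<longrightarrow>
       (\<exists>(N, A)\<in>\<N>. real k * (LINT z:\<omega>|lborel. \<rho> z) \<le>
          (\<Sum>i\<in>{1..q}. \<Sum>(a, b)\<in>A. (LINT z:sq N a b|lborel. bump.\<phi>\<^sub>q \<psi> N a b z * \<beta> i z)) + \<tau> / 2 * L))"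
    by (elim exE) (rule that)
  have bump: "bump \<psi> \<psi>' \<psi>''" and L0: "L0 > 0" and fin\<N>: "finite \<N>" using core_all by simp_all
  have sq\<N>: "N > 0 \<and> finite A \<and> (\<forall>(a, b)\<in>A. sq N a b \<subseteq> \<omega>)" if "(N, A) \<in> \<N>" for N A
    using core_all that by blast
  note \<N> = fin\<N> sq\<N>
  have core: "\<exists>(N, A)\<in>\<N>. real k * (LINT z:\<omega>|lborel. \<rho> z) \<le>
          (\<Sum>i\<in>{1..q}. \<Sum>(a, b)\<in>A. (LINT z:sq N a b|lborel. bump.\<phi>\<^sub>q \<psi> N a b z * \<beta> i z)) + \<tau> / 2 * L"
    if "L0 \<le> L" "potentials \<psi> \<psi>' \<psi>'' \<omega> q k C S B L w \<beta> \<rho>" for L w \<beta> \<rho>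
    using core_all[THEN conjunct2, THEN conjunct2, THEN conjunct2, THEN conjunct2] that by (elim allE impE)
  interpret b: bump \<psi> \<psi>' \<psi>'' by (rule bump)
  define K where "K = (\<Sum>(N, A)\<in>\<N>. real (card A))"
  have K: "real (card A) \<le> K" if "(N, A) \<in> \<N>" for N A
    unfolding K_def using member_le_sum[OF that _ \<N>(1), of "\<lambda>(N, A). real (card A)"] by auto
  have K0: "0 \<le> K" unfolding K_def by (intro sum_nonneg) auto
  \<comment> \<open>For each of \<open>q\<close> indices and at most \<open>K\<close> squares,
    replacing the regularized Laplacian by zeros costs \<open>\<tau>1\<close>; in total at most half
    of \<open>\<tau> * L\<close>.\<close>
  define \<tau>1 where "\<tau>1 = \<tau> / 2 * L0 / (real q * K + 1)"
  have qK: "real q * K + 1 > 0" using K0 by (simp add: add_nonneg_pos)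
  have \<tau>1: "\<tau>1 > 0" "real q * K * \<tau>1 \<le> \<tau> / 2 * L0"
  proof -
    show p: "\<tau>1 > 0" using \<tau> L0 qK by (simp add: \<tau>1_def)
    have "X * (y / X) = y" if "X > 0" for X y :: real using that by simp
    from this[OF qK] have "(real q * K + 1) * \<tau>1 = \<tau> / 2 * L0" unfolding \<tau>1_def .
    then show "real q * K * \<tau>1 \<le> \<tau> / 2 * L0" using p by (simp add: distrib_right)
  qed
  show ?thesis
  proof (intro exI[of _ L0] conjI L0 allI impI)
    fix L and F :: "complex \<Rightarrow> complex ^ ('n::{finite,linorder})"
    assume L: "L0 \<le> L" and hol: "\<forall>j. (\<lambda>z. F z $ j) holomorphic_on UNIV" and F: "\<forall>z. F z \<noteq> 0 \<and> proj (F z) \<in> V"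
      and Qnz: "\<forall>i\<in>{1..q}. \<exists>z. eval_cpoly (Q i) (F z) \<noteq> 0"
      and bound: "\<forall>z. 1/4 \<le> cmod z \<longrightarrow> cmod z \<le> 2 \<longrightarrow> 2 * (fs_deriv F z)\<^sup>2 \<le> C * L"
    define g where "g i z = eval_cpoly (Q i) (F z)" for i z
    define u where "u z = ln (norm (F z))" for z
    define \<rho> where "\<rho> z = 2 * (fs_deriv F z)\<^sup>2" for z
    have normF: "norm (F z) > 0" for z using F by simp
    have lap_u: "laplacian_on UNIV u \<rho>"
      unfolding u_def \<rho>_def using hol F by (intro laplacian_log_norm_vec) auto
    have hol_g: "g i holomorphic_on UNIV" for i
      unfolding g_def using hol by (intro holomorphic_eval_cpoly) auto
    have g_nz: "\<exists>z. g i z \<noteq> 0" if "i \<in> {1..q}" for i using Qnz that by (auto simp: g_def)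
    have g_up: "cmod (g i z) \<le> a i * norm (F z) ^ d i" if "i \<in> {1..q}" for i z
      unfolding g_def by (rule a(2)[OF that])
    have cF: "continuous_on UNIV (\<lambda>z. norm (F z))"
    proof -
      have "continuous_on UNIV (\<lambda>z. sqrt (\<Sum>j\<in>UNIV. (cmod (F z $ j))\<^sup>2))"
        using hol by (intro continuous_intros holomorphic_on_imp_continuous_on) auto
      then show ?thesis by (simp add: norm_vec_def L2_set_def)
    qed
    \<comment> \<open>Once \<open>\<epsilon> n < \<mu>\<close>, the regularizing term is at most
      \<open>(norm (F z) ^ d i)\<^sup>2\<close>, so it changes the upper bound of the logarithm by
      no more than a constant.\<close>
    obtain \<mu> where \<mu>: "\<mu> > 0" "\<And>i z. i \<in> {1..q} \<Longrightarrow> cmod z \<le> 2 \<Longrightarrow> \<mu> \<le> norm (F z) ^ d i"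
    proof -
      have "continuous_on (cball 0 2) (\<lambda>z::complex. norm (F z))" using cF continuous_on_subset by blast
      from continuous_attains_inf[OF compact_cball _ this]
      obtain z1 where "\<forall>z\<in>cball 0 2. norm (F z1) \<le> norm (F z)" by auto
      then have z1: "norm (F z1) \<le> norm (F z)" if "cmod z \<le> 2" for z using that by simp
      define \<mu> where "\<mu> = Min (insert 1 ((\<lambda>i. norm (F z1) ^ d i) ` {1..q}))"
      have "\<mu> > 0" unfolding \<mu>_def using normF[of z1] by (subst Min_gr_iff) auto
      moreover have "\<mu> \<le> norm (F z) ^ d i" if "i \<in> {1..q}" "cmod z \<le> 2" for i z
      proof -
        have "\<mu> \<le> norm (F z1) ^ d i" unfolding \<mu>_def using that(1) by (intro Min_le) auto
        also have "\<dots> \<le> norm (F z) ^ d i" using z1[OF that(2)] by (intro power_mono) auto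
        finally show ?thesis .
      qed
      ultimately show ?thesis using that by blast
    qed
    define \<epsilon> where "\<epsilon> n = 1 / real (Suc n)" for n
    define b where "b i n z = 2 * (cmod (deriv (g i) z))\<^sup>2 * (\<epsilon> n)\<^sup>2 / ((cmod (g i z))\<^sup>2 + (\<epsilon> n)\<^sup>2)\<^sup>2" for i n z
    have ev1: "\<forall>\<^sub>F n in sequentially. \<epsilon> n < \<mu>"
      unfolding \<epsilon>_def using \<mu>(1) by (intro order_tendstoD(2)[OF LIMSEQ_Suc[OF lim_1_over_n]])
    have ev2: "\<forall>\<^sub>F n in sequentially. (LINT z:sq N x y|lborel. b.\<phi>\<^sub>q N x y z * b i n z)
        \<le> 2 * pi * (\<Sum>z\<in>{z \<in> sq N x y. g i z = 0}. real (nat (zorder (g i) z)) * b.\<phi>\<^sub>q N x y z) + \<tau>1"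
      if "i \<in> {1..q}" "N > 0" for i N x y
    proof -
      interpret t: test_function "corner N x y" "corner N (x + 1) (y + 1)"
        "\<lambda>t. \<psi> (real N * t - of_int x)" "\<lambda>t. real N * \<psi>' (real N * t - of_int x)" "\<lambda>t. (real N)\<^sup>2 * \<psi>'' (real N * t - of_int x)"
        "\<lambda>t. \<psi> (real N * t - of_int y)" "\<lambda>t. real N * \<psi>' (real N * t - of_int y)" "\<lambda>t. (real N)\<^sup>2 * \<psi>'' (real N * t - of_int y)"
        using that(2) by (rule b.test_function_sq)
      show ?thesis
        using t.regularized_laplacian_le_zeros[OF hol_g g_nz[OF that(1)] \<tau>1(1)]
        unfolding sq_def b_def \<epsilon>_def t.\<phi>_def b.\<phi>\<^sub>q_def .
    qed
    \<comment> \<open>The family \<open>\<N>\<close> is finite, so one \<open>n\<close> serves all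
      its squares. It depends on \<open>F\<close>, but no constant fixed so far depends on
      it.\<close>
    have "\<forall>\<^sub>F n in sequentially. \<epsilon> n < \<mu> \<and> (\<forall>p\<in>\<N>. \<forall>i\<in>{1..q}. \<forall>x\<in>snd p.
        (LINT z:sq (fst p) (fst x) (snd x)|lborel. b.\<phi>\<^sub>q (fst p) (fst x) (snd x) z * b i n z)
        \<le> 2 * pi * (\<Sum>z\<in>{z \<in> sq (fst p) (fst x) (snd x). g i z = 0}. real (nat (zorder (g i) z)) * b.\<phi>\<^sub>q (fst p) (fst x) (snd x) z) + \<tau>1)"
      using \<N> by (intro eventually_conj ev1 eventually_ball_finite ballI ev2) auto
    then obtain n where n: "\<epsilon> n < \<mu>" and nz: "\<And>N A i x y. (N, A) \<in> \<N> \<Longrightarrow> i \<in> {1..q} \<Longrightarrow> (x, y) \<in> A \<Longrightarrow>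
        (LINT z:sq N x y|lborel. b.\<phi>\<^sub>q N x y z * b i n z)
        \<le> 2 * pi * (\<Sum>z\<in>{z \<in> sq N x y. g i z = 0}. real (nat (zorder (g i) z)) * b.\<phi>\<^sub>q N x y z) + \<tau>1"
      by (fastforce dest: eventually_happens'[OF sequentially_bot])
    have \<epsilon>0: "\<epsilon> n > 0" by (simp add: \<epsilon>_def)
    define v where "v i z = ln ((cmod (g i z))\<^sup>2 + (\<epsilon> n)\<^sup>2) / 2" for i z
    define w where "w i z = u z + (- 1 / real (d i)) * v i z + B0" for i z
    define \<beta> where "\<beta> i z = b i n z / real (d i)" for i z
    have lap_v: "laplacian_on UNIV (v i) (b i n)" for i
      unfolding v_def b_def using laplacian_log_regularized[OF hol_g] \<epsilon>0 by simp
    have pos_v: "(cmod (g i z))\<^sup>2 + (\<epsilon> n)\<^sup>2 > 0" for i z using \<epsilon>0 by (simp add: add_nonneg_pos)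
    have pot: "potentials \<psi> \<psi>' \<psi>'' \<omega> q k C S B L w \<beta> \<rho>"
    proof (intro potentials.intro bump potentials_axioms.intro op \<omega> C B)
      show "0 \<le> L" using L L0 by simp
      show "laplacian_on UNIV (w i) (\<lambda>z. \<rho> z - \<beta> i z)" for i
        unfolding w_def[abs_def] by (rule laplacian_on_cong[OF laplacian_on_add_cmult[OF lap_u lap_v]]) (simp add: \<beta>_def)
      show "continuous_on UNIV \<rho>" using laplacian_on_continuous[OF lap_u] by simp
      show "0 \<le> \<rho> z" for z by (simp add: \<rho>_def)
      show "\<rho> z \<le> C * L" if "1/4 \<le> cmod z" "cmod z \<le> 2" for z using bound that by (simp add: \<rho>_def)
      show "continuous_on UNIV (\<beta> i)" for i
        unfolding \<beta>_def divide_inverse by (intro continuous_intros laplacian_on_continuous(2)[OF lap_v])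
      show "0 \<le> \<beta> i z" for i z by (simp add: \<beta>_def b_def)
      show "0 \<le> w i z" if i: "i \<in> {1..q}" and z: "1/4 \<le> cmod z" "cmod z \<le> 2" for i z
      proof -
        have d: "real (d i) > 0" using Q(2)[OF i] by simp
        have "\<epsilon> n \<le> norm (F z) ^ d i" using n \<mu>(2)[OF i z(2)] by simp
        then have "(\<epsilon> n)\<^sup>2 \<le> (norm (F z) ^ d i)\<^sup>2" using \<epsilon>0 by (intro power_mono) auto
        moreover have "(cmod (g i z))\<^sup>2 \<le> (a i * norm (F z) ^ d i)\<^sup>2" using g_up[OF i] by (intro power_mono) auto
        ultimately have le: "(cmod (g i z))\<^sup>2 + (\<epsilon> n)\<^sup>2 \<le> ((a i)\<^sup>2 + 1) * (norm (F z) ^ d i)\<^sup>2"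
          by (simp add: power_mult_distrib algebra_simps)
        have a1: "(a i)\<^sup>2 + 1 > 0" by (simp add: add_nonneg_pos)
        have np: "(norm (F z) ^ d i)\<^sup>2 > 0" using normF[of z] by simp
        have "ln ((cmod (g i z))\<^sup>2 + (\<epsilon> n)\<^sup>2) \<le> ln (((a i)\<^sup>2 + 1) * (norm (F z) ^ d i)\<^sup>2)"
          using le pos_v by (subst ln_le_cancel_iff) (auto intro: mult_pos_pos a1 np)
        also have "\<dots> = ln ((a i)\<^sup>2 + 1) + 2 * real (d i) * u z"
          using a1 np normF[of z] by (simp add: ln_mult ln_realpow u_def)
        finally have "v i z \<le> ln ((a i)\<^sup>2 + 1) / 2 + real (d i) * u z" by (simp add: v_def)
        then have "v i z / real (d i) \<le> (ln ((a i)\<^sup>2 + 1) / 2 + real (d i) * u z) / real (d i)"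
          using d by (intro divide_right_mono) auto
        also have "\<dots> = ln ((a i)\<^sup>2 + 1) / (2 * real (d i)) + u z" using d by (simp add: add_divide_distrib)
        also have "\<dots> \<le> B0 + u z" using B0[OF i] by simp
        finally show ?thesis by (simp add: w_def)
      qed
    next
      fix N x y J
      assume N: "N > 0" and sqw: "sq N x y \<subseteq> \<omega>" and J: "J \<subseteq> {1..q}" "q + 1 \<le> card J + k"
        and big: "\<And>j z. j \<in> J \<Longrightarrow> z \<in> sq N x y \<Longrightarrow> S < w j z"
      have J\<J>: "J \<in> \<J>" using J by (simp add: \<J>_def)
      have e1: "real (e J) \<ge> 1" using e[OF J\<J>] by simp
      have small: "cmod (eval_cpoly (Q j) (F z)) \<le> \<delta> J * norm (F z) ^ d j" if j: "j \<in> J" and z: "z \<in> sq N x y" for j z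
      proof (cases "g j z = 0")
        case True
        then show ?thesis using pos(1)[OF J\<J>] by (simp add: g_def)
      next
        case False
        have jq: "j \<in> {1..q}" using j J by blast
        have d: "real (d j) \<ge> 1" using Q(2)[OF jq] by simp
        have "\<bar>ln (\<delta> J)\<bar> \<le> (\<Sum>J\<in>\<J>. \<bar>ln (\<delta> J)\<bar>)" using J\<J> fin\<J> by (intro member_le_sum) auto
        then have "B0 - S \<le> - \<bar>ln (\<delta> J)\<bar>" by (simp add: S_def)
        then have "v j z / real (d j) < u z - \<bar>ln (\<delta> J)\<bar>" using big[OF j z] by (simp add: w_def)
        then have "v j z < (u z - \<bar>ln (\<delta> J)\<bar>) * real (d j)" using d by (simp add: pos_divide_less_eq)
        also have "\<dots> = real (d j) * u z - \<bar>ln (\<delta> J)\<bar> * real (d j)" by (simp add: algebra_simps)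
        also have "\<dots> \<le> real (d j) * u z - \<bar>ln (\<delta> J)\<bar> * 1" using d by (intro diff_left_mono mult_left_mono) auto
        also have "\<dots> \<le> real (d j) * u z + ln (\<delta> J)" by simp
        also have "\<dots> = ln (\<delta> J * norm (F z) ^ d j)"
          using pos(1)[OF J\<J>] normF[of z] by (simp add: ln_mult ln_realpow u_def)
        finally have "v j z < ln (\<delta> J * norm (F z) ^ d j)" .
        moreover have "ln (cmod (g j z)) \<le> v j z"
        proof -
          have "ln ((cmod (g j z))\<^sup>2) \<le> ln ((cmod (g j z))\<^sup>2 + (\<epsilon> n)\<^sup>2)"
            using False pos_v by (subst ln_le_cancel_iff) auto
          then show ?thesis using False by (simp add: v_def ln_realpow)
        qed
        ultimately have "ln (cmod (g j z)) < ln (\<delta> J * norm (F z) ^ d j)" by simp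
        then show ?thesis using False pos(1)[OF J\<J>] normF[of z] by (simp add: g_def)
      qed
      have lowP: "c J * norm (F z) ^ e J \<le> cmod (eval_cpoly (P J) (F z))" if z: "z \<in> sq N x y" for z
        using F small[OF _ z] by (intro low[OF J\<J>]) auto
      define p where "p z = eval_cpoly (P J) (F z)" for z
      have holp: "p holomorphic_on UNIV" unfolding p_def using hol by (intro holomorphic_eval_cpoly) auto
      have posc: "0 < c J * norm (F z) ^ e J" for z using pos(2)[OF J\<J>] normF[of z] by simp
      have pnz: "p z \<noteq> 0" if "z \<in> sq N x y" for z using lowP[OF that] posc[of z] by (auto simp: p_def)
      \<comment> \<open>\<open>p\<close> has no zeros on the square, so
        \<open>ln (cmod (p z))\<close> is harmonic there and \<open>h\<close> has the same Laplacian
        as \<open>u\<close>. The summand 0 fits the shape of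
        \<open>laplacian_on_add_cmult\<close>.\<close>
      define h where "h z = u z + (- 1 / real (e J)) * ln (cmod (p z)) + 0" for z
      have "laplacian_on (sq N x y) h \<rho>"
        unfolding h_def[abs_def]
        by (rule laplacian_on_cong[OF laplacian_on_add_cmult[OF laplacian_on_subset[OF lap_u] laplacian_log_abs[OF holp pnz]]]) auto
      moreover have "\<bar>h z\<bar> \<le> B" if z: "z \<in> sq N x y" for z
      proof -
        have "ln (c J * norm (F z) ^ e J) \<le> ln (cmod (p z))"
          using lowP[OF z] posc[of z] pnz[OF z] by (subst ln_le_cancel_iff) (auto simp: p_def)
        then have l1: "ln (c J) + real (e J) * u z \<le> ln (cmod (p z))"
          using pos(2)[OF J\<J>] normF[of z] by (simp add: ln_mult ln_realpow u_def)
        have "ln (cmod (p z)) \<le> ln (A J * norm (F z) ^ e J)"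
          using up[OF J\<J>, of "F z"] pnz[OF z] pos(3)[OF J\<J>] normF[of z] by (subst ln_le_cancel_iff) (auto simp: p_def)
        then have l2: "ln (cmod (p z)) \<le> ln (A J) + real (e J) * u z"
          using pos(3)[OF J\<J>] normF[of z] by (simp add: ln_mult ln_realpow u_def)
        have "real (e J) * h z = real (e J) * u z - ln (cmod (p z))" using e1 by (simp add: h_def algebra_simps)
        then have "\<bar>real (e J) * h z\<bar> \<le> \<bar>ln (c J)\<bar> + \<bar>ln (A J)\<bar>" using l1 l2 by linarith
        moreover have "1 * \<bar>h z\<bar> \<le> real (e J) * \<bar>h z\<bar>" using e1 by (intro mult_right_mono) auto
        ultimately have "\<bar>h z\<bar> \<le> \<bar>ln (c J)\<bar> + \<bar>ln (A J)\<bar>" by (simp add: abs_mult)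
        also have "\<dots> \<le> B" unfolding B_def using J\<J> fin\<J> by (intro member_le_sum) auto
        finally show ?thesis .
      qed
      ultimately show "\<exists>h. laplacian_on (sq N x y) h \<rho> \<and> (\<forall>z\<in>sq N x y. \<bar>h z\<bar> \<le> B)" by blast
    qed
    obtain N A where NA: "(N, A) \<in> \<N>" and est: "real k * (LINT z:\<omega>|lborel. \<rho> z) \<le>
          (\<Sum>i\<in>{1..q}. \<Sum>(x, y)\<in>A. (LINT z:sq N x y|lborel. b.\<phi>\<^sub>q N x y z * \<beta> i z)) + \<tau> / 2 * L"
      using core[OF L pot] by blast
    have N: "N > 0" "finite A" "\<And>x y. (x, y) \<in> A \<Longrightarrow> sq N x y \<subseteq> \<omega>" using \<N>(2)[OF NA] by auto
    define Z where "Z i = {z \<in> \<omega>. g i z = 0}" for i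
    have finZ: "finite (Z i)" if "i \<in> {1..q}" for i
    proof (rule finite_subset)
      show "finite {z \<in> cball 0 1. g i z = 0}" by (rule entire_finite_zeros[OF hol_g g_nz[OF that] compact_cball])
      show "Z i \<subseteq> {z \<in> cball 0 1. g i z = 0}" using \<omega> by (auto simp: Z_def)
    qed
    define mu where "mu i z = real (nat (zorder (g i) z))" for i z
    have each: "(\<Sum>(x, y)\<in>A. (LINT z:sq N x y|lborel. b.\<phi>\<^sub>q N x y z * \<beta> i z)) \<le> 2 * pi / real (d i) * (\<Sum>z\<in>Z i. mu i z) + K * \<tau>1"
      if i: "i \<in> {1..q}" for i
    proof -
      have d: "real (d i) \<ge> 1" using Q(2)[OF i] by simp
      have "(\<Sum>(x, y)\<in>A. (LINT z:sq N x y|lborel. b.\<phi>\<^sub>q N x y z * \<beta> i z))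
         = (\<Sum>(x, y)\<in>A. (LINT z:sq N x y|lborel. b.\<phi>\<^sub>q N x y z * b i n z)) / real (d i)"
        by (simp add: \<beta>_def sum_divide_distrib case_prod_beta')
      also have "\<dots> \<le> (\<Sum>(x, y)\<in>A. 2 * pi * (\<Sum>z\<in>{z \<in> sq N x y. g i z = 0}. mu i z * b.\<phi>\<^sub>q N x y z) + \<tau>1) / real (d i)"
        unfolding mu_def using nz[OF NA i] d by (intro divide_right_mono sum_mono) auto
      also have "(\<Sum>(x, y)\<in>A. 2 * pi * (\<Sum>z\<in>{z \<in> sq N x y. g i z = 0}. mu i z * b.\<phi>\<^sub>q N x y z) + \<tau>1)
         = 2 * pi * (\<Sum>(x, y)\<in>A. \<Sum>z\<in>{z \<in> sq N x y. g i z = 0}. mu i z * b.\<phi>\<^sub>q N x y z) + real (card A) * \<tau>1"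
        by (simp add: sum.distrib sum_distrib_left case_prod_beta')
      also have "(\<Sum>(x, y)\<in>A. \<Sum>z\<in>{z \<in> sq N x y. g i z = 0}. mu i z * b.\<phi>\<^sub>q N x y z)
         = (\<Sum>(x, y)\<in>A. \<Sum>z\<in>Z i. mu i z * (indicat_real (sq N x y) z * b.\<phi>\<^sub>q N x y z))"
      proof (intro sum.cong refl, clarify)
        fix x y assume xy: "(x, y) \<in> A"
        have "{z \<in> sq N x y. g i z = 0} = Z i \<inter> sq N x y" using N(3)[OF xy] by (auto simp: Z_def)
        then show "(\<Sum>z\<in>{z \<in> sq N x y. g i z = 0}. mu i z * b.\<phi>\<^sub>q N x y z) = (\<Sum>z\<in>Z i. mu i z * (indicat_real (sq N x y) z * b.\<phi>\<^sub>q N x y z))"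
          unfolding sum.inter_restrict[OF finZ[OF i]] by (simp add: sum.inter_restrict[OF finZ[OF i]]) (intro sum.cong, auto)
      qed
      also have "\<dots> = (\<Sum>z\<in>Z i. \<Sum>(x, y)\<in>A. mu i z * (indicat_real (sq N x y) z * b.\<phi>\<^sub>q N x y z))"
        unfolding case_prod_beta' by (rule sum.swap)
      also have "\<dots> = (\<Sum>z\<in>Z i. mu i z * (\<Sum>(x, y)\<in>A. indicat_real (sq N x y) z * b.\<phi>\<^sub>q N x y z))"
        by (simp add: sum_distrib_left case_prod_beta')
      \<comment> \<open>After exchanging the sums, each zero is weighted by bumps that add up to at
        most 1, so a zero on a common edge of squares is not counted twice.\<close>
      also have "\<dots> \<le> (\<Sum>z\<in>Z i. mu i z * 1)"
      proof (intro sum_mono mult_left_mono)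
        fix z assume "z \<in> Z i"
        then show "(\<Sum>(x, y)\<in>A. indicat_real (sq N x y) z * b.\<phi>\<^sub>q N x y z) \<le> 1"
          using b.sum_\<phi>\<^sub>q_le[OF N, of z] by (simp add: Z_def)
      qed (simp add: mu_def)
      finally have "(\<Sum>(x, y)\<in>A. (LINT z:sq N x y|lborel. b.\<phi>\<^sub>q N x y z * \<beta> i z))
          \<le> (2 * pi * (\<Sum>z\<in>Z i. mu i z * 1) + real (card A) * \<tau>1) / real (d i)"
        using d by (simp add: divide_right_mono)
      also have "\<dots> = 2 * pi / real (d i) * (\<Sum>z\<in>Z i. mu i z) + real (card A) * \<tau>1 / real (d i)"
        by (simp add: add_divide_distrib)
      also have "real (card A) * \<tau>1 / real (d i) \<le> real (card A) * \<tau>1 / 1"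
        using d \<tau>1(1) by (intro divide_left_mono) auto
      also have "real (card A) * \<tau>1 / 1 \<le> K * \<tau>1" using K[OF NA] \<tau>1(1) by (simp add: mult_right_mono)
      finally show ?thesis by simp
    qed
    have "real k * (LINT z:\<omega>|lborel. \<rho> z) \<le> (\<Sum>i\<in>{1..q}. 2 * pi / real (d i) * (\<Sum>z\<in>Z i. mu i z) + K * \<tau>1) + \<tau> / 2 * L"
    proof -
      have "(\<Sum>i\<in>{1..q}. \<Sum>(x, y)\<in>A. (LINT z:sq N x y|lborel. b.\<phi>\<^sub>q N x y z * \<beta> i z))
        \<le> (\<Sum>i\<in>{1..q}. 2 * pi / real (d i) * (\<Sum>z\<in>Z i. mu i z) + K * \<tau>1)"
        by (rule sum_mono) (rule each)
      then show ?thesis using est by linarith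
    qed
    also have "\<dots> = (\<Sum>i\<in>{1..q}. 2 * pi / real (d i) * (\<Sum>z\<in>Z i. mu i z)) + real q * K * \<tau>1 + \<tau> / 2 * L"
      by (simp add: sum.distrib)
    also have "\<dots> \<le> (\<Sum>i\<in>{1..q}. 2 * pi / real (d i) * (\<Sum>z\<in>Z i. mu i z)) + \<tau> / 2 * L + \<tau> / 2 * L"
      using \<tau>1(2) L \<tau> mult_left_mono[of L0 L "\<tau> / 2"] by linarith
    finally show "real k * (LINT z:\<omega>|lborel. 2 * (fs_deriv F z)\<^sup>2) \<le>
       (\<Sum>i\<in>{1..q}. 2 * pi / real (d i) * (\<Sum>z\<in>{z \<in> \<omega>. eval_cpoly (Q i) (F z) = 0}. real (nat (zorder (\<lambda>z. eval_cpoly (Q i) (F z)) z)))) + \<tau> * L"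
      by (simp add: \<rho>_def Z_def mu_def g_def[abs_def] algebra_simps)
  qed
qed

section \<open>Sectors\<close>

lemma angular_domain_eq:
  assumes "0 < \<epsilon>" "\<epsilon> < pi"
  shows "angular_domain \<theta> \<epsilon> = (\<lambda>z. z * exp (- (\<i> * of_real \<theta>))) -` {w. w \<notin> \<real>\<^sub>\<le>\<^sub>0 \<and> \<bar>Arg w\<bar> < \<epsilon>}"
proof (intro equalityI subsetI)
  fix z assume "z \<in> angular_domain \<theta> \<epsilon>"
  then obtain t where z: "z \<noteq> 0" "z = of_real (cmod z) * exp (\<i> * of_real t)" and t: "\<bar>t - \<theta>\<bar> < \<epsilon>"
    by (auto simp: angular_domain_def is_Arg_def abs_less_iff)
  define w where "w = z * exp (- (\<i> * of_real \<theta>))"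
  have w: "w = of_real (cmod z) * exp (\<i> * of_real (t - \<theta>))"
    unfolding w_def by (subst z(2)) (simp add: exp_diff exp_minus divide_inverse algebra_simps)
  have A: "Arg w = t - \<theta>"
    by (rule Arg_unique[of "cmod z"]) (use w z t assms in auto)
  have "w \<notin> \<real>\<^sub>\<le>\<^sub>0"
  proof
    assume "w \<in> \<real>\<^sub>\<le>\<^sub>0"
    moreover have "w \<noteq> 0" using z by (simp add: w_def)
    ultimately have "Arg w = pi" by (auto simp: Arg_eq_pi complex_nonpos_Reals_iff complex_eq_iff)
    then show False using A t assms by simp
  qed
  then show "z \<in> (\<lambda>z. z * exp (- (\<i> * of_real \<theta>))) -` {w. w \<notin> \<real>\<^sub>\<le>\<^sub>0 \<and> \<bar>Arg w\<bar> < \<epsilon>}"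
    using A t by (simp add: w_def)
next
  fix z assume "z \<in> (\<lambda>z. z * exp (- (\<i> * of_real \<theta>))) -` {w. w \<notin> \<real>\<^sub>\<le>\<^sub>0 \<and> \<bar>Arg w\<bar> < \<epsilon>}"
  then have w: "z * exp (- (\<i> * of_real \<theta>)) \<notin> \<real>\<^sub>\<le>\<^sub>0" "\<bar>Arg (z * exp (- (\<i> * of_real \<theta>)))\<bar> < \<epsilon>" by auto
  define s where "s = Arg (z * exp (- (\<i> * of_real \<theta>)))"
  have z0: "z \<noteq> 0" using w(1) by auto
  have "z * exp (- (\<i> * of_real \<theta>)) = of_real (cmod (z * exp (- (\<i> * of_real \<theta>)))) * exp (\<i> * of_real s)"
    unfolding s_def using z0 by (intro Arg_eq) simp
  also have "cmod (z * exp (- (\<i> * of_real \<theta>))) = cmod z" by (simp add: norm_mult)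
  finally have "z * exp (- (\<i> * of_real \<theta>)) * exp (\<i> * of_real \<theta>) = of_real (cmod z) * exp (\<i> * of_real s) * exp (\<i> * of_real \<theta>)"
    by simp
  then have "z = of_real (cmod z) * exp (\<i> * of_real (s + \<theta>))"
    by (simp add: exp_minus distrib_left exp_add mult.assoc)
  then show "z \<in> angular_domain \<theta> \<epsilon>"
    using z0 w(2) unfolding angular_domain_def is_Arg_def s_def[symmetric]
    by (auto intro!: exI[of _ "s + \<theta>"] simp: abs_less_iff)
qed

lemma open_angular_domain:
  assumes "0 < \<epsilon>" "\<epsilon> < pi"
  shows "open (angular_domain \<theta> \<epsilon>)"
proof -
  have "open (- \<real>\<^sub>\<le>\<^sub>0 \<inter> (\<lambda>w. \<bar>Arg w\<bar>) -` {..<\<epsilon>})"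
    by (rule continuous_open_preimage) (auto intro!: continuous_intros)
  moreover have "{w. w \<notin> \<real>\<^sub>\<le>\<^sub>0 \<and> \<bar>Arg w\<bar> < \<epsilon>} = - \<real>\<^sub>\<le>\<^sub>0 \<inter> (\<lambda>w. \<bar>Arg w\<bar>) -` {..<\<epsilon>}" by auto
  ultimately show ?thesis
    unfolding angular_domain_eq[OF assms] by (intro open_vimage) (auto intro!: continuous_intros)
qed

lemma angular_domain_scale:
  assumes "t > 0"
  shows "t *\<^sub>R z \<in> angular_domain \<theta> \<epsilon> \<longleftrightarrow> z \<in> angular_domain \<theta> \<epsilon>"
  using assms by (simp add: angular_domain_def is_Arg_def scaleR_conv_of_real norm_mult)

lemma fs_deriv_nonneg: "0 \<le> fs_deriv F z"
  unfolding fs_deriv_def by (intro real_sqrt_ge_zero divide_nonneg_nonneg sum_nonneg) auto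

lemma fs_deriv_scale:
  fixes F :: "complex \<Rightarrow> complex ^ ('n::{finite,linorder})"
  assumes hol: "\<And>j. (\<lambda>z. F z $ j) holomorphic_on UNIV" and t: "t > 0"
  shows "fs_deriv (\<lambda>z. F (t *\<^sub>R z)) z = t * fs_deriv F (t *\<^sub>R z)"
proof -
  have d: "deriv (\<lambda>w. F (t *\<^sub>R w) $ i) z = of_real t * deriv (\<lambda>w. F w $ i) (t *\<^sub>R z)" for i
  proof (rule DERIV_imp_deriv)
    have d1: "((\<lambda>w. F w $ i) has_field_derivative deriv (\<lambda>w. F w $ i) (t *\<^sub>R z)) (at (t *\<^sub>R z))"
      by (rule holomorphic_derivI[OF hol]) auto
    have d2: "((\<lambda>w. t *\<^sub>R w) has_field_derivative of_real t) (at z)"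
      unfolding scaleR_conv_of_real by (auto intro!: derivative_eq_intros)
    show "((\<lambda>w. F (t *\<^sub>R w) $ i) has_field_derivative of_real t * deriv (\<lambda>w. F w $ i) (t *\<^sub>R z)) (at z)"
      unfolding mult.commute[of "of_real t"] by (rule DERIV_chain2[OF d1 d2])
  qed
  have n: "cmod (of_real t * a * b - c * (of_real t * e)) = t * cmod (a * b - c * e)" for a b c e
  proof -
    have "of_real t * a * b - c * (of_real t * e) = of_real t * (a * b - c * e)" by (simp add: algebra_simps)
    then show ?thesis using t by (simp add: norm_mult)
  qed
  show ?thesis
    unfolding fs_deriv_def d n power_mult_distrib case_prod_beta' sum_distrib_left[symmetric]
    using t by (simp add: real_sqrt_mult[symmetric] real_sqrt_divide real_sqrt_mult)
qed

text \<open>The continuous density is integrable over a bounded set. This matters because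
  \<open>measure\<close> is 0 by convention where \<open>emeasure\<close> is infinite.\<close>

lemma riesz_measure_eq:
  fixes F :: "complex \<Rightarrow> complex ^ ('n::{finite,linorder})"
  assumes hol: "\<And>j. (\<lambda>z. F z $ j) holomorphic_on UNIV" and nz: "\<And>z. F z \<noteq> 0"
    and S [measurable]: "S \<in> sets borel" and bd: "bounded S"
  shows "set_integrable lborel S (\<lambda>z. (fs_deriv F z)\<^sup>2)"
    and "measure (riesz_measure F) S = (LINT z:S|lborel. (fs_deriv F z)\<^sup>2) / pi"
proof -
  have "continuous_on UNIV (\<lambda>z. 2 * (fs_deriv F z)\<^sup>2)"
    by (rule laplacian_on_continuous(2)[OF laplacian_log_norm_vec[OF hol nz]])
  from continuous_on_mult_left[OF this, of "1/2"] have c: "continuous_on UNIV (\<lambda>z. (fs_deriv F z)\<^sup>2)" by simp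
  then have [measurable]: "(\<lambda>z. (fs_deriv F z)\<^sup>2) \<in> borel_measurable borel" by (rule borel_measurable_continuous_onI)
  obtain p q where pq: "S \<subseteq> cbox p q" using bounded_subset_cbox_symmetric[OF bd] by blast
  have "set_integrable lborel (cbox p q) (\<lambda>z. (fs_deriv F z)\<^sup>2)"
    using c by (intro set_integrable_continuous_cbox) (auto intro: continuous_on_subset)
  then show int: "set_integrable lborel S (\<lambda>z. (fs_deriv F z)\<^sup>2)"
    by (rule set_integrable_subset) (use pq in auto)
  have "emeasure (riesz_measure F) S = (\<integral>\<^sup>+z. ennreal ((fs_deriv F z)\<^sup>2 / pi) * indicator S z \<partial>lborel)"
    unfolding riesz_measure_def by (subst emeasure_density) auto
  also have "\<dots> = (\<integral>\<^sup>+z. ennreal (indicator S z *\<^sub>R ((fs_deriv F z)\<^sup>2) / pi) \<partial>lborel)"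
    by (intro nn_integral_cong) (auto simp: indicator_def)
  also have "\<dots> = ennreal (\<integral>z. indicator S z *\<^sub>R ((fs_deriv F z)\<^sup>2) / pi \<partial>lborel)"
    using int unfolding set_integrable_def by (intro nn_integral_eq_integral integrable_divide_zero) auto
  finally have "emeasure (riesz_measure F) S = ennreal ((LINT z:S|lborel. (fs_deriv F z)\<^sup>2) / pi)"
    by (simp add: set_lebesgue_integral_def)
  moreover have "0 \<le> (LINT z:S|lborel. (fs_deriv F z)\<^sup>2)"
    unfolding set_lebesgue_integral_def by (intro Bochner_Integration.integral_nonneg) simp
  ultimately show "measure (riesz_measure F) S = (LINT z:S|lborel. (fs_deriv F z)\<^sup>2) / pi"
    by (simp add: measure_def)
qed

lemma AE_cmod_neq: "AE z in lborel. cmod z \<noteq> r"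
proof -
  have "negligible (sphere (0::complex) r)" by (rule negligible_sphere)
  then have "sphere (0::complex) r \<in> null_sets (completion lborel)" by (simp add: negligible_iff_null_sets)
  then have "sphere (0::complex) r \<in> null_sets lborel" by (simp add: null_sets_completion_iff)
  then have "AE z in lborel. z \<notin> sphere (0::complex) r" by (rule AE_not_in)
  then show ?thesis by (rule eventually_mono) auto
qed

section \<open>From annuli to discs\<close>

text \<open>Passing from \<open>t\<close> to \<open>t / 2\<close> until the radius is at most
  \<open>T\<close> collects a geometric series of ratio \<open>2 powr (- s)\<close>, which is less
  than 1 because \<open>s > 0\<close>. For \<open>s = 2 * \<sigma> + 2\<close> this is the condition
  \<open>\<sigma> > - 1\<close>.\<close>

lemma halving_bound:
  fixes b :: "real \<Rightarrow> real"
  assumes s: "s > 0" and \<tau>: "\<tau> > 0" and T: "T > 0"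
    and step: "\<And>t. T \<le> t \<Longrightarrow> b t \<le> b (t / 2) + \<tau> * t powr s"
    and base: "\<And>t. 0 < t \<Longrightarrow> t \<le> T \<Longrightarrow> b t \<le> K"
    and t: "t > 0"
  shows "b t \<le> K + \<tau> / (1 - 2 powr (- s)) * t powr s"
proof -
  have p: "0 < 1 - 2 powr (- s)" using s powr_less_cancel_iff[of 2 "-s" 0] by simp
  \<comment> \<open>The sum \<open>c = x / (1 - y)\<close> of the series satisfies
    \<open>c * y + x = c\<close>.\<close>
  have alg: "x / (1 - y) * (y * z) + x * z = x / (1 - y) * z" if "1 - y \<noteq> 0" for x y z :: real
    using that by (simp add: divide_simps) (simp add: algebra_simps)
  have "t \<le> 2 ^ n * T \<Longrightarrow> t > 0 \<Longrightarrow> b t \<le> K + \<tau> / (1 - 2 powr (- s)) * t powr s" for n t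
  proof (induction n arbitrary: t)
    case 0
    then have "b t \<le> K" by (intro base) auto
    moreover have "0 \<le> \<tau> / (1 - 2 powr (- s)) * t powr s" using \<tau> p by simp
    ultimately show ?case by linarith
  next
    case (Suc n)
    show ?case
    proof (cases "t \<le> T")
      case True
      then have "b t \<le> K" using Suc by (intro base) auto
      moreover have "0 \<le> \<tau> / (1 - 2 powr (- s)) * t powr s" using \<tau> p by simp
      ultimately show ?thesis by linarith
    next
      case False
      have "b t \<le> b (t / 2) + \<tau> * t powr s" using False by (intro step) simp
      also have "b (t / 2) \<le> K + \<tau> / (1 - 2 powr (- s)) * (t / 2) powr s" using Suc by (intro Suc.IH) auto
      also have "(t / 2) powr s = 2 powr (- s) * t powr s" by (simp add: powr_divide powr_minus_divide)
      also have "K + \<tau> / (1 - 2 powr (- s)) * (2 powr (- s) * t powr s) + \<tau> * t powr s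
         = K + \<tau> / (1 - 2 powr (- s)) * t powr s"
        using alg[OF less_imp_neq[OF p, symmetric], of \<tau> "t powr s"] by linarith
      finally show ?thesis by simp
    qed
  qed
  moreover obtain n where "t \<le> 2 ^ n * T"
  proof -
    obtain n :: nat where "t / T < 2 ^ n" using real_arch_pow[of 2 "t / T"] by auto
    then show ?thesis using that[of n] T by (simp add: pos_divide_less_eq)
  qed
  ultimately show ?thesis using t by blast
qed

lemma mono_over_id_integrable:
  fixes f :: "real \<Rightarrow> real"
  assumes f: "mono f" "\<And>t. 0 \<le> f t" and c: "c > 0" "\<And>t. t < c \<Longrightarrow> a \<le> t \<Longrightarrow> f t = 0"
  shows "(\<lambda>t. f t / t) integrable_on {a..b}"
proof -
  have [measurable]: "f \<in> borel_measurable borel" using f(1) by (rule borel_measurable_mono)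
  have "set_integrable lborel {a..b} (\<lambda>t. f t / t)"
  proof (rule set_integrable_bound)
    show "set_integrable lborel {a..b} (\<lambda>t. f b / c)" by (intro borel_integrable_atLeastAtMost') auto
    show "set_borel_measurable lborel {a..b} (\<lambda>t. f t / t)"
      unfolding set_borel_measurable_def by measurable
    show "AE t in lborel. t \<in> {a..b} \<longrightarrow> norm (f t / t) \<le> norm (f b / c)"
    proof (rule always_eventually, intro allI impI)
      fix t assume t: "t \<in> {a..b}"
      show "norm (f t / t) \<le> norm (f b / c)"
      proof (cases "t < c")
        case True then show ?thesis using c(2) t by simp
      next
        case False
        have "f t / t \<le> f b / c"
          using False c(1) t f monoD[OF f(1), of t b] by (intro frac_le) auto
        then show ?thesis using False c(1) f(2)[of t] f(2)[of b] by simp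
      qed
    qed
  qed
  then show ?thesis by (rule set_borel_integral_eq_integral(1))
qed

text \<open>The factor \<open>t\<^sup>2\<close> from the change of area cancels the one from the
  chain rule for \<open>fs_deriv\<close>; \<open>2 * pi\<close> is the ratio of the Laplacian to the
  Riesz density.\<close>

lemma riesz_measure_scale:
  fixes F :: "complex \<Rightarrow> complex ^ ('n::{finite,linorder})"
  assumes hol: "\<And>j. (\<lambda>z. F z $ j) holomorphic_on UNIV" and nz: "\<And>z. F z \<noteq> 0"
    and S [measurable]: "S \<in> sets borel" and bd: "bounded S" and t: "t > 0"
    and \<omega>: "\<And>z. t *\<^sub>R z \<in> S \<longleftrightarrow> z \<in> \<omega>"
  shows "(LINT z:\<omega>|lborel. 2 * (fs_deriv (\<lambda>z. F (t *\<^sub>R z)) z)\<^sup>2) = 2 * pi * measure (riesz_measure F) S"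
proof -
  have "set_integrable lborel S (\<lambda>z. (fs_deriv F z)\<^sup>2)" by (rule riesz_measure_eq(1)[OF hol nz S bd])
  then have meas: "(\<lambda>z. indicator S z *\<^sub>R (fs_deriv F z)\<^sup>2) \<in> borel_measurable borel"
    unfolding set_integrable_def by (auto dest: borel_measurable_integrable)
  have "pi * measure (riesz_measure F) S = (LINT z|lborel. indicator S z *\<^sub>R (fs_deriv F z)\<^sup>2)"
    unfolding riesz_measure_eq(2)[OF hol nz S bd] set_lebesgue_integral_def by simp
  also have "\<dots> = t\<^sup>2 * (LINT z|lborel. indicator S (0 + t *\<^sub>R z) *\<^sub>R (fs_deriv F (0 + t *\<^sub>R z))\<^sup>2)"
    by (rule lborel_integral_affine_complex[OF meas]) (use t in simp)
  also have "\<dots> = t\<^sup>2 * (LINT z:\<omega>|lborel. (fs_deriv F (t *\<^sub>R z))\<^sup>2)"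
    by (simp add: set_lebesgue_integral_def \<omega> indicator_def)
  finally have 1: "pi * measure (riesz_measure F) S = t\<^sup>2 * (LINT z:\<omega>|lborel. (fs_deriv F (t *\<^sub>R z))\<^sup>2)" .
  have "(LINT z:\<omega>|lborel. 2 * (fs_deriv (\<lambda>z. F (t *\<^sub>R z)) z)\<^sup>2) = (LINT z:\<omega>|lborel. 2 * t\<^sup>2 * (fs_deriv F (t *\<^sub>R z))\<^sup>2)"
    by (simp add: fs_deriv_scale[OF hol t] power_mult_distrib mult.assoc)
  also have "\<dots> = 2 * t\<^sup>2 * (LINT z:\<omega>|lborel. (fs_deriv F (t *\<^sub>R z))\<^sup>2)" by (rule set_integral_mult_right)
  finally show ?thesis using 1 by simp
qed

lemma finite_zeros_in:
  fixes g :: "complex \<Rightarrow> complex"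
  assumes "g holomorphic_on UNIV" "\<exists>z. g z \<noteq> 0"
  shows "finite {z \<in> \<Omega>. cmod z < t \<and> g z = 0}"
  by (rule finite_subset[OF _ entire_finite_zeros[OF assms compact_cball[of 0 t]]]) auto

text \<open>Zeros with \<open>cmod z = t / 2\<close> belong to neither term on the left, hence an
  inequality, in the direction that suits the estimate.\<close>

lemma zero_count_halving:
  fixes g :: "complex \<Rightarrow> complex"
  assumes g: "g holomorphic_on UNIV" "\<exists>z. g z \<noteq> 0" and t: "t > 0"
    and \<omega>: "\<And>z. z \<in> \<omega> \<longleftrightarrow> t *\<^sub>R z \<in> \<Omega> \<and> 1/2 < cmod z \<and> cmod z < 1"
  shows "real (zero_count g \<Omega> (t / 2)) + (\<Sum>z\<in>{z \<in> \<omega>. g (t *\<^sub>R z) = 0}. real (nat (zorder (\<lambda>z. g (t *\<^sub>R z)) z)))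
     \<le> real (zero_count g \<Omega> t)"
proof -
  define Z where "Z = {z \<in> \<omega>. g (t *\<^sub>R z) = 0}"
  have zo: "zorder (\<lambda>z. g (t *\<^sub>R z)) z = zorder g (t *\<^sub>R z)" for z
    unfolding scaleR_conv_of_real
  proof (rule Meromorphic.zorder_scale)
    show "g meromorphic_on {of_real t * z}"
      using g(1) by (intro analytic_on_imp_meromorphic_on) (auto simp: analytic_on_holomorphic)
  qed (use t in auto)
  have inj: "inj_on (\<lambda>z. t *\<^sub>R z) Z" using t by (auto simp: inj_on_def)
  have "(\<Sum>z\<in>Z. real (nat (zorder (\<lambda>z. g (t *\<^sub>R z)) z))) = (\<Sum>z\<in>(\<lambda>z. t *\<^sub>R z) ` Z. real (nat (zorder g z)))"
    by (simp add: sum.reindex[OF inj] zo)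
  moreover have "real (zero_count g \<Omega> (t / 2)) + (\<Sum>z\<in>(\<lambda>z. t *\<^sub>R z) ` Z. real (nat (zorder g z)))
     = (\<Sum>z\<in>{z \<in> \<Omega>. cmod z < t / 2 \<and> g z = 0} \<union> (\<lambda>z. t *\<^sub>R z) ` Z. real (nat (zorder g z)))"
  proof -
    have sub: "(\<lambda>z. t *\<^sub>R z) ` Z \<subseteq> {z \<in> \<Omega>. cmod z < t \<and> g z = 0}"
      using t by (auto simp: Z_def \<omega>)
    have dis: "{z \<in> \<Omega>. cmod z < t / 2 \<and> g z = 0} \<inter> (\<lambda>z. t *\<^sub>R z) ` Z = {}"
      using t by (auto simp: Z_def \<omega>)
    show ?thesis
      unfolding zero_count_def of_nat_sum
      by (rule sum.union_disjoint[symmetric, OF finite_zeros_in[OF g] finite_subset[OF sub finite_zeros_in[OF g]] dis])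
  qed
  moreover have "\<dots> \<le> (\<Sum>z\<in>{z \<in> \<Omega>. cmod z < t \<and> g z = 0}. real (nat (zorder g z)))"
    using t by (intro sum_mono2 finite_zeros_in[OF g]) (auto simp: Z_def \<omega>)
  ultimately show ?thesis by (simp add: Z_def zero_count_def)
qed

lemma zero_count_mono:
  fixes g :: "complex \<Rightarrow> complex"
  assumes g: "g holomorphic_on UNIV" "\<exists>z. g z \<noteq> 0"
  shows "mono (\<lambda>t. real (zero_count g \<Omega> t))"
proof (rule monoI)
  fix s t :: real assume "s \<le> t"
  then show "real (zero_count g \<Omega> s) \<le> real (zero_count g \<Omega> t)"
    unfolding zero_count_def of_nat_sum by (intro sum_mono2 finite_zeros_in[OF g]) auto
qed

text \<open>Since 0 lies outside \<open>\<Omega>\<close>, the finitely many zeros counted in the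
  unit disc keep a positive distance \<open>c\<close> from 0, and the count vanishes near the pole
  of \<open>1 / t\<close>.\<close>

lemma zero_count_integral:
  fixes g :: "complex \<Rightarrow> complex"
  assumes g: "g holomorphic_on UNIV" "\<exists>z. g z \<noteq> 0" and \<Omega>: "0 \<notin> \<Omega>"
  shows "(\<lambda>t. real (zero_count g \<Omega> t) / t) integrable_on {0..r}"
    and "(\<lambda>t. real (zero_count g \<Omega> t) / t) integrable_on {1..r}"
    and "integral {1..r} (\<lambda>t. real (zero_count g \<Omega> t) / t) \<le> integral {0..r} (\<lambda>t. real (zero_count g \<Omega> t) / t)"
proof -
  define Z where "Z = {z \<in> \<Omega>. cmod z < 1 \<and> g z = 0}"
  have fZ: "finite Z" unfolding Z_def by (rule finite_zeros_in[OF g])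
  define c where "c = Min (insert 1 (cmod ` Z))"
  have c: "c > 0" unfolding c_def using fZ \<Omega> by (subst Min_gr_iff) (auto simp: Z_def)
  have cle: "c \<le> 1" "\<And>z. z \<in> Z \<Longrightarrow> c \<le> cmod z" unfolding c_def using fZ by auto
  have zero: "real (zero_count g \<Omega> t) = 0" if "t < c" for t
  proof -
    have "{z \<in> \<Omega>. cmod z < t \<and> g z = 0} = {}"
      using that cle by (fastforce simp: Z_def)
    then show ?thesis by (simp only: zero_count_def sum.empty of_nat_0)
  qed
  show i0: "(\<lambda>t. real (zero_count g \<Omega> t) / t) integrable_on {0..r}"
    and i1: "(\<lambda>t. real (zero_count g \<Omega> t) / t) integrable_on {1..r}"
    using zero by (intro mono_over_id_integrable[OF zero_count_mono[OF g] _ c]; simp)+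
  show "integral {1..r} (\<lambda>t. real (zero_count g \<Omega> t) / t) \<le> integral {0..r} (\<lambda>t. real (zero_count g \<Omega> t) / t)"
    by (rule integral_subset_le[OF _ i1 i0]) auto
qed

text \<open>The extreme value is at 2 or at 1/4 according to the sign of \<open>\<sigma>\<close>,
  and the right side dominates both.\<close>

lemma powr_annulus_bound:
  fixes x \<sigma> :: real
  assumes "1/4 \<le> x" "x \<le> 2"
  shows "x powr (2 * \<sigma>) \<le> 4 powr (2 * \<bar>\<sigma>\<bar>)"
proof (cases "\<sigma> \<ge> 0")
  case True
  then show ?thesis using assms by (simp add: powr_mono2)
next
  case False
  have "x powr (2 * \<sigma>) \<le> (1/4) powr (2 * \<sigma>)" using False assms by (intro powr_mono2') auto
  also have "\<dots> = 4 powr (2 * \<bar>\<sigma>\<bar>)" using False by (simp add: powr_divide powr_minus_divide[of 4 "2 * \<bar>\<sigma>\<bar>"] flip: powr_minus_divide)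
  finally show ?thesis .
qed

text \<open>\<open>annulus_estimate\<close> is applied to the curve \<open>F (t *\<^sub>R z)\<close>
  with \<open>L = t powr s\<close>: rescaling multiplies the derivative by \<open>t\<close>, so its
  square is of order \<open>t^2 * t powr (2 * \<sigma>)\<close>. Each \<open>t\<close> gives a
  different curve, which is why the estimate has to be uniform. The increments from
  \<open>t / 2\<close> to \<open>t\<close> are then summed by \<open>halving_bound\<close>.\<close>

lemma sector_estimate:
  fixes V :: "('n::{finite,linorder}) pspace set" and Q :: "nat \<Rightarrow> 'n cpoly" and d :: "nat \<Rightarrow> nat"
    and F :: "complex \<Rightarrow> complex ^ ('n::{finite,linorder})" and \<sigma> \<theta> \<epsilon> :: real
  assumes V: "palgebraic V"
    and Q: "\<And>i. i \<in> {1..q} \<Longrightarrow> homogeneous (d i) (Q i)" "\<And>i. i \<in> {1..q} \<Longrightarrow> d i \<ge> 1"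
    and gap: "\<And>J. J \<subseteq> {1..q} \<Longrightarrow> q + 1 \<le> card J + k \<Longrightarrow>
        \<exists>e P. e \<ge> 1 \<and> homogeneous e P \<and> V \<inter> (\<Inter>j\<in>J. pzeros (Q j)) \<inter> pzeros P = {}"
    and hol: "\<And>j. (\<lambda>z. F z $ j) holomorphic_on UNIV" and F: "\<And>z. F z \<noteq> 0" "\<And>z. proj (F z) \<in> V"
    and nz: "\<And>i. i \<in> {1..q} \<Longrightarrow> \<exists>z. eval_cpoly (Q i) (F z) \<noteq> 0"
    and \<sigma>: "\<sigma> > - 1" and growth: "fs_deriv F \<in> O[at_infinity](\<lambda>z. cmod z powr \<sigma>)"
    and \<epsilon>: "0 < \<epsilon>" "\<epsilon> < pi" and \<tau>: "\<tau> > 0"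
  defines "\<Omega> \<equiv> angular_domain \<theta> \<epsilon>"
  shows "\<exists>K\<ge>0. \<forall>t>0. real k * measure (riesz_measure F) (\<Omega> \<inter> ball 0 t)
       - (\<Sum>i\<in>{1..q}. 1 / real (d i) * real (zero_count (\<lambda>z. eval_cpoly (Q i) (F z)) \<Omega> t)) \<le> K + \<tau> * t powr (2 * \<sigma> + 2)"
proof -
  define s where "s = 2 * \<sigma> + 2"
  have s: "s > 0" using \<sigma> by (simp add: s_def)
  have p2: "1 - 2 powr (- s) > 0" using s powr_less_cancel_iff[of 2 "-s" 0] by simp
  \<comment> \<open>The geometric series will divide by \<open>1 - 2 powr (- s)\<close>, which
    restores \<open>\<tau>\<close>.\<close>
  define \<tau>0 where "\<tau>0 = \<tau> * (1 - 2 powr (- s))"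
  have \<tau>0: "\<tau>0 > 0" using \<tau> p2 by (simp add: \<tau>0_def)
  define g where "g i z = eval_cpoly (Q i) (F z)" for i z
  have hol_g: "g i holomorphic_on UNIV" for i unfolding g_def by (rule holomorphic_eval_cpoly[OF hol])
  have g_nz: "\<exists>z. g i z \<noteq> 0" if "i \<in> {1..q}" for i using nz[OF that] by (simp add: g_def)
  have op\<Omega>: "open \<Omega>" unfolding \<Omega>_def by (rule open_angular_domain[OF \<epsilon>])
  define \<omega> where "\<omega> = \<Omega> \<inter> {z. 1/2 < cmod z \<and> cmod z < 1}"
  have op: "open \<omega>" unfolding \<omega>_def by (intro open_Int op\<Omega> open_Collect_conj open_Collect_less continuous_intros)
  obtain c where c: "c > 0" "\<forall>\<^sub>F z in at_infinity. norm (fs_deriv F z) \<le> c * norm (cmod z powr \<sigma>)"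
    using landau_o.bigE[OF growth] by blast
  then obtain R where R: "\<And>z. R \<le> cmod z \<Longrightarrow> fs_deriv F z \<le> c * cmod z powr \<sigma>"
    by (auto simp: eventually_at_infinity fs_deriv_nonneg)
  define C where "C = 2 * c\<^sup>2 * 4 powr (2 * \<bar>\<sigma>\<bar>)"
  have C: "0 \<le> C" by (simp add: C_def)
  have \<tau>p: "2 * pi * \<tau>0 > 0" using \<tau>0 by simp
  have \<omega>sub: "\<omega> \<subseteq> {z. 1/2 < cmod z \<and> cmod z < 1}" by (auto simp: \<omega>_def)
  have "\<exists>L0>0. \<forall>L\<ge>L0. \<forall>F. (\<forall>j. (\<lambda>z. F z $ j) holomorphic_on UNIV) \<longrightarrow> (\<forall>z. F z \<noteq> 0 \<and> proj (F z) \<in> V) \<longrightarrow>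
     (\<forall>i\<in>{1..q}. \<exists>z. eval_cpoly (Q i) (F z) \<noteq> 0) \<longrightarrow>
     (\<forall>z. 1/4 \<le> cmod z \<longrightarrow> cmod z \<le> 2 \<longrightarrow> 2 * (fs_deriv F z)\<^sup>2 \<le> C * L) \<longrightarrow>
     real k * (LINT z:\<omega>|lborel. 2 * (fs_deriv F z)\<^sup>2) \<le>
       (\<Sum>i\<in>{1..q}. 2 * pi / real (d i) * (\<Sum>z\<in>{z \<in> \<omega>. eval_cpoly (Q i) (F z) = 0}. real (nat (zorder (\<lambda>z. eval_cpoly (Q i) (F z)) z)))) + 2 * pi * \<tau>0 * L"
    by (rule annulus_estimate[where q = q and k = k, OF V Q gap op \<omega>sub \<tau>p C])
  then obtain L0 where L0: "L0 > 0" and est: "\<forall>L\<ge>L0. \<forall>F. (\<forall>j. (\<lambda>z. F z $ j) holomorphic_on UNIV) \<longrightarrow> (\<forall>z. F z \<noteq> 0 \<and> proj (F z) \<in> V) \<longrightarrow>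
     (\<forall>i\<in>{1..q}. \<exists>z. eval_cpoly (Q i) (F z) \<noteq> 0) \<longrightarrow>
     (\<forall>z. 1/4 \<le> cmod z \<longrightarrow> cmod z \<le> 2 \<longrightarrow> 2 * (fs_deriv F z)\<^sup>2 \<le> C * L) \<longrightarrow>
     real k * (LINT z:\<omega>|lborel. 2 * (fs_deriv F z)\<^sup>2) \<le>
       (\<Sum>i\<in>{1..q}. 2 * pi / real (d i) * (\<Sum>z\<in>{z \<in> \<omega>. eval_cpoly (Q i) (F z) = 0}. real (nat (zorder (\<lambda>z. eval_cpoly (Q i) (F z)) z)))) + 2 * pi * \<tau>0 * L"
    by (elim exE conjE) (rule that)
  \<comment> \<open>For \<open>t \<ge> T\<close>, points with \<open>1/4 \<le> cmod z\<close> are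
    sent to modulus at least \<open>\<bar>R\<bar>\<close>, where the growth bound holds, and
    \<open>t powr s\<close> reaches the threshold \<open>L0\<close>.\<close>
  define T where "T = max 1 (max (4 * \<bar>R\<bar>) (L0 powr (1 / s)))"
  have T: "T \<ge> 1" "T \<ge> 4 * \<bar>R\<bar>" "T \<ge> L0 powr (1 / s)" by (auto simp: T_def)
  define \<mu> where "\<mu> t = measure (riesz_measure F) (\<Omega> \<inter> ball 0 t)" for t
  define Rt where "Rt t = \<Omega> \<inter> {z. t / 2 < cmod z \<and> cmod z < t}" for t
  have [measurable]: "\<Omega> \<in> sets borel" using op\<Omega> by simp
  have Rt_sets [measurable]: "Rt t \<in> sets borel" for t
    unfolding Rt_def by (intro borel_open open_Int op\<Omega> open_Collect_conj open_Collect_less continuous_intros)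
  have Rt_bd: "bounded (Rt t)" for t by (rule bounded_subset[OF bounded_ball[of 0 t]]) (auto simp: Rt_def)
  have B_bd: "bounded (\<Omega> \<inter> ball 0 t)" for t by (rule bounded_subset[OF bounded_ball[of 0 t]]) auto
  have B_sets: "\<Omega> \<inter> ball 0 t \<in> sets borel" for t by simp
  note mB = riesz_measure_eq[OF hol F(1) B_sets B_bd]
  note mR = riesz_measure_eq[OF hol F(1) Rt_sets Rt_bd]
  have split: "\<mu> t = \<mu> (t / 2) + measure (riesz_measure F) (Rt t)" if t: "t > 0" for t
  proof -
    let ?f = "\<lambda>z. (fs_deriv F z)\<^sup>2"
    have dis: "(\<Omega> \<inter> ball 0 (t / 2)) \<inter> Rt t = {}" by (auto simp: Rt_def)
    have intU: "set_integrable lborel (\<Omega> \<inter> ball 0 (t / 2) \<union> Rt t) ?f"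
      by (rule set_integrable_Un[OF mB(1) mR(1)]) auto
    \<comment> \<open>The circle of radius \<open>t / 2\<close>, which belongs to neither part, is a
      null set.\<close>
    have "(LINT z:\<Omega> \<inter> ball 0 t|lborel. ?f z) = (LINT z:\<Omega> \<inter> ball 0 (t / 2) \<union> Rt t|lborel. ?f z)"
    proof (rule set_integral_cong_set)
      show "set_borel_measurable lborel (\<Omega> \<inter> ball 0 (t / 2) \<union> Rt t) ?f"
        using intU unfolding set_borel_measurable_def set_integrable_def by (rule borel_measurable_integrable)
      show "set_borel_measurable lborel (\<Omega> \<inter> ball 0 t) ?f"
        using mB(1) unfolding set_borel_measurable_def set_integrable_def by (rule borel_measurable_integrable)
      show "AE z in lborel. z \<in> \<Omega> \<inter> ball 0 (t / 2) \<union> Rt t \<longleftrightarrow> z \<in> \<Omega> \<inter> ball 0 t"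
        using AE_cmod_neq[of "t / 2"] by eventually_elim (use t in \<open>auto simp: Rt_def\<close>)
    qed
    also have "\<dots> = (LINT z:\<Omega> \<inter> ball 0 (t / 2)|lborel. ?f z) + (LINT z:Rt t|lborel. ?f z)"
      by (rule set_integral_Un[OF dis mB(1) mR(1)])
    finally show ?thesis unfolding \<mu>_def mB(2) mR(2) by (simp add: add_divide_distrib)
  qed
  define b where "b t = real k * \<mu> t - (\<Sum>i\<in>{1..q}. 1 / real (d i) * real (zero_count (g i) \<Omega> t))" for t
  have step: "b t \<le> b (t / 2) + \<tau>0 * t powr s" if t: "T \<le> t" for t
  proof -
    have t0: "t > 0" using t T by simp
    have tL: "L0 \<le> t powr s"
    proof -
      have "L0 = (L0 powr (1 / s)) powr s" using L0 s by (simp add: powr_powr)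
      also have "\<dots> \<le> t powr s" using t T s by (intro powr_mono2) auto
      finally show ?thesis .
    qed
    define Ft where "Ft z = F (t *\<^sub>R z)" for z
    have holt: "(\<lambda>z. Ft z $ j) holomorphic_on UNIV" for j
    proof -
      have "(\<lambda>z. F z $ j) \<circ> (\<lambda>z. t *\<^sub>R z) holomorphic_on UNIV"
        by (rule holomorphic_on_compose[OF _ holomorphic_on_subset[OF hol]])
           (auto simp: scaleR_conv_of_real intro!: holomorphic_intros)
      then show ?thesis by (simp add: Ft_def o_def)
    qed
    have nzt: "\<exists>z. eval_cpoly (Q i) (Ft z) \<noteq> 0" if "i \<in> {1..q}" for i
    proof -
      from nz[OF that] obtain z where "eval_cpoly (Q i) (F z) \<noteq> 0" by blast
      then show ?thesis using t0 by (intro exI[of _ "(1/t) *\<^sub>R z"]) (simp add: Ft_def)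
    qed
    have bd: "2 * (fs_deriv Ft z)\<^sup>2 \<le> C * t powr s" if z: "1/4 \<le> cmod z" "cmod z \<le> 2" for z
    proof -
      have ct: "cmod (t *\<^sub>R z) = t * cmod z" using t0 by simp
      have "4 * \<bar>R\<bar> * (1/4) \<le> t * cmod z" using t T z by (intro mult_mono) auto
      then have "R \<le> cmod (t *\<^sub>R z)" unfolding ct by linarith
      then have "fs_deriv F (t *\<^sub>R z) \<le> c * (t * cmod z) powr \<sigma>" using R[of "t *\<^sub>R z"] unfolding ct by simp
      then have "(fs_deriv F (t *\<^sub>R z))\<^sup>2 \<le> (c * (t * cmod z) powr \<sigma>)\<^sup>2"
        using fs_deriv_nonneg by (intro power_mono) auto
      also have "\<dots> = c\<^sup>2 * (t * cmod z) powr (2 * \<sigma>)"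
        by (simp add: power_mult_distrib power2_eq_square flip: powr_add)
      also have "(t * cmod z) powr (2 * \<sigma>) = t powr (2 * \<sigma>) * cmod z powr (2 * \<sigma>)" using t0 by (simp add: powr_mult)
      also have "c\<^sup>2 * (t powr (2 * \<sigma>) * cmod z powr (2 * \<sigma>)) \<le> c\<^sup>2 * (t powr (2 * \<sigma>) * 4 powr (2 * \<bar>\<sigma>\<bar>))"
        by (intro mult_left_mono powr_annulus_bound z) auto
      finally have "2 * t\<^sup>2 * (fs_deriv F (t *\<^sub>R z))\<^sup>2 \<le> 2 * t\<^sup>2 * (c\<^sup>2 * (t powr (2 * \<sigma>) * 4 powr (2 * \<bar>\<sigma>\<bar>)))"
        by (intro mult_left_mono) auto
      also have "\<dots> = C * (t powr (2 * \<sigma>) * t\<^sup>2)" by (simp add: C_def)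
      also have "t powr (2 * \<sigma>) * t\<^sup>2 = t powr s" using t0 by (simp add: s_def powr_add powr_numeral)
      finally show ?thesis
        unfolding Ft_def fs_deriv_scale[OF hol t0] power_mult_distrib by (simp add: mult.assoc)
    qed
    have \<omega>R: "t *\<^sub>R z \<in> Rt t \<longleftrightarrow> z \<in> \<omega>" for z
    proof -
      have "t *\<^sub>R z \<in> \<Omega> \<longleftrightarrow> z \<in> \<Omega>" unfolding \<Omega>_def by (rule angular_domain_scale[OF t0])
      moreover have "t / 2 < cmod (t *\<^sub>R z) \<longleftrightarrow> 1/2 < cmod z" "cmod (t *\<^sub>R z) < t \<longleftrightarrow> cmod z < 1"
        using t0 by (simp_all add: field_simps)
      ultimately show ?thesis by (simp add: Rt_def \<omega>_def)
    qed
    have \<omega>Z: "z \<in> \<omega> \<longleftrightarrow> t *\<^sub>R z \<in> \<Omega> \<and> 1/2 < cmod z \<and> cmod z < 1" for z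
      unfolding \<Omega>_def angular_domain_scale[OF t0] \<omega>_def by simp
    define n where "n i = (\<Sum>z\<in>{z \<in> \<omega>. g i (t *\<^sub>R z) = 0}. real (nat (zorder (\<lambda>z. g i (t *\<^sub>R z)) z)))" for i
    have "real k * (LINT z:\<omega>|lborel. 2 * (fs_deriv Ft z)\<^sup>2) \<le>
       (\<Sum>i\<in>{1..q}. 2 * pi / real (d i) * (\<Sum>z\<in>{z \<in> \<omega>. eval_cpoly (Q i) (Ft z) = 0}. real (nat (zorder (\<lambda>z. eval_cpoly (Q i) (Ft z)) z)))) + 2 * pi * \<tau>0 * t powr s"
      by (rule est[rule_format, OF tL]) (use holt F nzt bd in \<open>auto simp: Ft_def\<close>)
    then have "real k * (2 * pi * measure (riesz_measure F) (Rt t)) \<le> (\<Sum>i\<in>{1..q}. 2 * pi / real (d i) * n i) + 2 * pi * \<tau>0 * t powr s"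
      unfolding Ft_def riesz_measure_scale[OF hol F(1) Rt_sets Rt_bd t0 \<omega>R] n_def g_def .
    then have "2 * pi * (real k * measure (riesz_measure F) (Rt t)) \<le> 2 * pi * ((\<Sum>i\<in>{1..q}. 1 / real (d i) * n i) + \<tau>0 * t powr s)"
      by (simp add: sum_distrib_left distrib_left mult_ac)
    then have main: "real k * measure (riesz_measure F) (Rt t) \<le> (\<Sum>i\<in>{1..q}. 1 / real (d i) * n i) + \<tau>0 * t powr s"
      by (rule mult_left_le_imp_le) simp
    have "(\<Sum>i\<in>{1..q}. 1 / real (d i) * real (zero_count (g i) \<Omega> (t / 2))) + (\<Sum>i\<in>{1..q}. 1 / real (d i) * n i)
        \<le> (\<Sum>i\<in>{1..q}. 1 / real (d i) * real (zero_count (g i) \<Omega> t))"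
      unfolding sum.distrib[symmetric] distrib_left[symmetric] n_def
      by (intro sum_mono mult_left_mono zero_count_halving[OF hol_g g_nz t0 \<omega>Z]) auto
    moreover have "real k * \<mu> t = real k * \<mu> (t / 2) + real k * measure (riesz_measure F) (Rt t)"
      by (simp add: split[OF t0] distrib_left)
    ultimately show ?thesis using main unfolding b_def by linarith
  qed
  have \<mu>0: "0 \<le> \<mu> t" for t by (simp add: \<mu>_def)
  have base: "b t \<le> real k * \<mu> T" if "0 < t" "t \<le> T" for t
  proof -
    have "\<mu> t \<le> \<mu> T"
      unfolding \<mu>_def mB(2)
    proof (intro divide_right_mono)
      show "(LINT z:\<Omega> \<inter> ball 0 t|lborel. (fs_deriv F z)\<^sup>2) \<le> (LINT z:\<Omega> \<inter> ball 0 T|lborel. (fs_deriv F z)\<^sup>2)"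
        unfolding set_lebesgue_integral_def
        by (rule integral_mono'[OF mB(1)[unfolded set_integrable_def]]) (use that in \<open>auto simp: indicator_def\<close>)
    qed simp
    then have "real k * \<mu> t \<le> real k * \<mu> T" by (intro mult_left_mono) auto
    moreover have "0 \<le> (\<Sum>i\<in>{1..q}. 1 / real (d i) * real (zero_count (g i) \<Omega> t))" by (intro sum_nonneg) auto
    ultimately show ?thesis by (simp add: b_def)
  qed
  have "b t \<le> real k * \<mu> T + \<tau>0 / (1 - 2 powr (- s)) * t powr s" if "t > 0" for t
    by (rule halving_bound[OF s \<tau>0 _ step base that]) (use T in auto)
  moreover have "\<tau>0 / (1 - 2 powr (- s)) = \<tau>" using p2 s by (simp add: \<tau>0_def)
  ultimately have fin: "b t \<le> real k * \<mu> T + \<tau> * t powr s" if "t > 0" for t using that by simp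
  have "0 \<le> real k * \<mu> T" using \<mu>0 by simp
  then show ?thesis using fin unfolding b_def \<mu>_def s_def g_def by blast
qed

section \<open>Integration over the radius\<close>

lemma ln_powr_bound:
  fixes s c K :: real
  assumes "s > 0" "c > 0"
  shows "\<forall>\<^sub>F r in at_top. K * ln r \<le> c * r powr s"
proof -
  have "(\<lambda>r::real. K * ln r) \<in> o(\<lambda>r. r powr s)" using assms by real_asymp
  from landau_o.smallD[OF this assms(2)] show ?thesis
    by (rule eventually_mono) (auto simp: abs_le_iff)
qed

text \<open>Integrating the bound of \<open>sector_estimate\<close> against \<open>dt / t\<close>
  turns \<open>K + \<tau> * t powr s\<close> into at most
  \<open>K * ln r + \<tau> / s * r powr s\<close>, which for suitable \<open>\<tau>\<close> is
  eventually below any given positive multiple of \<open>r powr s\<close>. The real number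
  \<open>a\<close> accommodates coefficients that may be negative, whereas \<open>k\<close> counts
  indices.\<close>

lemma main_estimate:
  fixes V :: "('n::{finite,linorder}) pspace set" and Q :: "nat \<Rightarrow> 'n cpoly" and d :: "nat \<Rightarrow> nat"
    and F :: "complex \<Rightarrow> complex ^ ('n::{finite,linorder})" and \<sigma> \<theta> \<epsilon> :: real
  assumes V: "palgebraic V"
    and Q: "\<And>i. i \<in> {1..q} \<Longrightarrow> homogeneous (d i) (Q i)" "\<And>i. i \<in> {1..q} \<Longrightarrow> d i \<ge> 1"
    and gap: "\<And>J. J \<subseteq> {1..q} \<Longrightarrow> q + 1 \<le> card J + k \<Longrightarrow>
        \<exists>e P. e \<ge> 1 \<and> homogeneous e P \<and> V \<inter> (\<Inter>j\<in>J. pzeros (Q j)) \<inter> pzeros P = {}"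
    and hol: "\<And>j. (\<lambda>z. F z $ j) holomorphic_on UNIV" and F: "\<And>z. F z \<noteq> 0" "\<And>z. proj (F z) \<in> V"
    and \<sigma>: "\<sigma> > - 1" and growth: "fs_deriv F \<in> O[at_infinity](\<lambda>z. cmod z powr \<sigma>)"
    and \<epsilon>: "0 < \<epsilon>" "\<epsilon> < pi" and a: "a \<le> real k"
  shows "\<exists>e\<in>o(\<lambda>r::real. r powr (2 * \<sigma> + 2)). \<forall>\<^sub>F r in at_top.
           ereal (a * char_T F (angular_domain \<theta> \<epsilon>) r)
           \<le> (\<Sum>i=1..q. ereal (1 / real (d i)) * counting_N F (angular_domain \<theta> \<epsilon>) (Q i) r) + ereal (e r)"
proof -
  define \<Omega> where "\<Omega> = angular_domain \<theta> \<epsilon>"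
  define g where "g i z = eval_cpoly (Q i) (F z)" for i z
  define s where "s = 2 * \<sigma> + 2"
  have s: "s > 0" using \<sigma> by (simp add: s_def)
  have \<Omega>0: "0 \<notin> \<Omega>" by (simp add: \<Omega>_def angular_domain_def)
  have op\<Omega>: "open \<Omega>" unfolding \<Omega>_def by (rule open_angular_domain[OF \<epsilon>])
  have hol_g: "g i holomorphic_on UNIV" for i unfolding g_def by (rule holomorphic_eval_cpoly[OF hol])
  define N where "N i r = integral {0..r} (\<lambda>t. real (zero_count (g i) \<Omega> t) / t)" for i r
  have cN: "counting_N F \<Omega> (Q i) r = (if \<forall>z. g i z = 0 then \<infinity> else ereal (N i r))" for i r
    using \<Omega>0 by (simp add: counting_N_def zero_count0_def g_def[abs_def] N_def Let_def)
  show ?thesis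
  proof (cases "\<forall>i\<in>{1..q}. \<exists>z. g i z \<noteq> 0")
    \<comment> \<open>If some \<open>Q i\<close> vanishes along the whole curve, its counting
      function is infinite and so is the right side.\<close>
    case False
    then obtain i where i: "i \<in> {1..q}" "\<forall>z. g i z = 0" by blast
    have inf: "(\<Sum>i=1..q. ereal (1 / real (d i)) * counting_N F \<Omega> (Q i) r) = \<infinity>" for r
    proof -
      have "ereal (1 / real (d i)) * counting_N F \<Omega> (Q i) r = \<infinity>"
        using i Q(2)[OF i(1)] by (simp add: cN)
      then show ?thesis using i(1) by (subst sum_Pinfty) auto
    qed
    have "(\<lambda>_. 0) \<in> o(\<lambda>r::real. r powr (2 * \<sigma> + 2))" by simp
    then show ?thesis unfolding \<Omega>_def[symmetric] inf by (rule bexI[rotated]) simp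
  next
    case True
    then have g_nz: "\<exists>z. g i z \<noteq> 0" if "i \<in> {1..q}" for i using that by blast
    define \<mu> where "\<mu> t = measure (riesz_measure F) (\<Omega> \<inter> ball 0 t)" for t
    have \<mu>0: "0 \<le> \<mu> t" for t by (simp add: \<mu>_def)
    have mono_\<mu>: "mono \<mu>"
    proof (rule monoI)
      fix x y :: real assume xy: "x \<le> y"
      have B_bd: "bounded (\<Omega> \<inter> ball 0 t)" for t by (rule bounded_subset[OF bounded_ball[of 0 t]]) auto
      have B_sets: "\<Omega> \<inter> ball 0 t \<in> sets borel" for t using op\<Omega> by simp
      note mB = riesz_measure_eq[OF hol F(1) B_sets B_bd]
      show "\<mu> x \<le> \<mu> y"
        unfolding \<mu>_def mB(2) set_lebesgue_integral_def
        by (intro divide_right_mono integral_mono'[OF mB(1)[unfolded set_integrable_def]]) (use xy in \<open>auto simp: indicator_def\<close>)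
    qed
    have int_\<mu>: "(\<lambda>t. \<mu> t / t) integrable_on {1..r}" for r
      by (rule mono_over_id_integrable[OF mono_\<mu> \<mu>0, of 1]) auto
    define T where "T r = integral {1..r} (\<lambda>t. \<mu> t / t)" for r
    have T: "char_T F \<Omega> r = T r" for r by (simp add: char_T_def T_def \<mu>_def)
    have T0: "0 \<le> T r" for r
      unfolding T_def by (rule integral_nonneg[OF int_\<mu>]) (simp add: \<mu>0)
    \<comment> \<open>The truncation at 0 is essential: the difference may be very negative, and
      then it would not be \<open>o(r powr s)\<close>.\<close>
    define e where "e r = max 0 (real k * T r - (\<Sum>i\<in>{1..q}. 1 / real (d i) * N i r))" for r
    have "e \<in> o(\<lambda>r. r powr s)"
    proof (rule landau_o.smallI)
      fix c :: real assume c: "c > 0"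
      \<comment> \<open>The factor \<open>s\<close> cancels the \<open>1 / s\<close> from
        integrating \<open>t powr (s - 1)\<close>; the other half of \<open>c\<close> is kept for
        \<open>K * ln r\<close>.\<close>
      define \<tau> where "\<tau> = c / 2 * s"
      have \<tau>: "\<tau> > 0" using c s by (simp add: \<tau>_def)
      have "\<exists>K\<ge>0. \<forall>t>0. real k * measure (riesz_measure F) (angular_domain \<theta> \<epsilon> \<inter> ball 0 t)
         - (\<Sum>i\<in>{1..q}. 1 / real (d i) * real (zero_count (\<lambda>z. eval_cpoly (Q i) (F z)) (angular_domain \<theta> \<epsilon>) t)) \<le> K + \<tau> * t powr (2 * \<sigma> + 2)"
        by (rule sector_estimate[OF V Q gap hol F _ \<sigma> growth \<epsilon> \<tau>]) (use g_nz in \<open>auto simp: g_def\<close>)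
      then obtain K where K: "K \<ge> 0" "\<And>t. t > 0 \<Longrightarrow> real k * \<mu> t - (\<Sum>i\<in>{1..q}. 1 / real (d i) * real (zero_count (g i) \<Omega> t)) \<le> K + \<tau> * t powr s"
        unfolding \<mu>_def \<Omega>_def g_def s_def by blast
      have bound: "e r \<le> K * ln r + c / 2 * r powr s" if r: "r \<ge> 1" for r
      proof -
        define m where "m i t = real (zero_count (g i) \<Omega> t) / t" for i t
        have im: "m i integrable_on {1..r}" "integral {1..r} (m i) \<le> N i r" if "i \<in> {1..q}" for i
          using zero_count_integral[OF hol_g g_nz[OF that] \<Omega>0, of r] unfolding m_def[abs_def] N_def by auto
        have D: "((\<lambda>t. K * ln t + \<tau> / s * t powr s) has_vector_derivative K / t + \<tau> * t powr (s - 1)) (at t within {1..r})"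
          if "t \<in> {1..r}" for t
        proof -
          have "((\<lambda>t. K * ln t + \<tau> / s * t powr s) has_real_derivative K * (1 / t) + \<tau> / s * (s * t powr (s - 1))) (at t within {1..r})"
            using that by (auto intro!: derivative_eq_intros)
          then show ?thesis using s by (simp add: has_real_derivative_iff_has_vector_derivative)
        qed
        have hi: "((\<lambda>t. K / t + \<tau> * t powr (s - 1)) has_integral (K * ln r + \<tau> / s * r powr s) - (K * ln 1 + \<tau> / s * 1 powr s)) {1..r}"
          by (rule fundamental_theorem_of_calculus[OF r D])
        have isum: "(\<lambda>t. \<Sum>i\<in>{1..q}. 1 / real (d i) * m i t) integrable_on {1..r}"
          by (intro integrable_sum integrable_on_mult_right im(1)) auto
        have "integral {1..r} (\<lambda>t. real k * (\<mu> t / t) - (\<Sum>i\<in>{1..q}. 1 / real (d i) * m i t))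
           \<le> integral {1..r} (\<lambda>t. K / t + \<tau> * t powr (s - 1))"
        proof (rule integral_le)
          show "(\<lambda>t. real k * (\<mu> t / t) - (\<Sum>i\<in>{1..q}. 1 / real (d i) * m i t)) integrable_on {1..r}"
            by (intro integrable_diff isum integrable_on_mult_right int_\<mu>)
          show "(\<lambda>t. K / t + \<tau> * t powr (s - 1)) integrable_on {1..r}" using hi by blast
          fix t assume t: "t \<in> {1..r}"
          have "(real k * \<mu> t - (\<Sum>i\<in>{1..q}. 1 / real (d i) * real (zero_count (g i) \<Omega> t))) / t \<le> (K + \<tau> * t powr s) / t"
            using K(2)[of t] t by (intro divide_right_mono) auto
          then show "real k * (\<mu> t / t) - (\<Sum>i\<in>{1..q}. 1 / real (d i) * m i t) \<le> K / t + \<tau> * t powr (s - 1)"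
            using t by (simp add: m_def diff_divide_distrib add_divide_distrib sum_divide_distrib powr_diff)
        qed
        also have "\<dots> = (K * ln r + \<tau> / s * r powr s) - (K * ln 1 + \<tau> / s * 1 powr s)" by (rule integral_unique[OF hi])
        also have "\<dots> \<le> K * ln r + \<tau> / s * r powr s" using \<tau> s by simp
        also have "\<tau> / s = c / 2" using s by (simp add: \<tau>_def)
        finally have 1: "integral {1..r} (\<lambda>t. real k * (\<mu> t / t) - (\<Sum>i\<in>{1..q}. 1 / real (d i) * m i t)) \<le> K * ln r + c / 2 * r powr s" .
        have "integral {1..r} (\<lambda>t. real k * (\<mu> t / t) - (\<Sum>i\<in>{1..q}. 1 / real (d i) * m i t))
           = integral {1..r} (\<lambda>t. real k * (\<mu> t / t)) - integral {1..r} (\<lambda>t. \<Sum>i\<in>{1..q}. 1 / real (d i) * m i t)"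
          by (intro Henstock_Kurzweil_Integration.integral_diff isum integrable_on_mult_right int_\<mu>)
        also have "integral {1..r} (\<lambda>t. real k * (\<mu> t / t)) = real k * T r"
          unfolding T_def by (rule integral_mult_right)
        also have "integral {1..r} (\<lambda>t. \<Sum>i\<in>{1..q}. 1 / real (d i) * m i t) = (\<Sum>i\<in>{1..q}. integral {1..r} (\<lambda>t. 1 / real (d i) * m i t))"
          by (rule Henstock_Kurzweil_Integration.integral_sum) (simp, rule integrable_on_mult_right, rule im(1))
        also have "\<dots> = (\<Sum>i\<in>{1..q}. 1 / real (d i) * integral {1..r} (m i))"
          by (intro sum.cong refl integral_mult_right)
        finally have 2: "integral {1..r} (\<lambda>t. real k * (\<mu> t / t) - (\<Sum>i\<in>{1..q}. 1 / real (d i) * m i t))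
           = real k * T r - (\<Sum>i\<in>{1..q}. 1 / real (d i) * integral {1..r} (m i))" .
        have "(\<Sum>i\<in>{1..q}. 1 / real (d i) * integral {1..r} (m i)) \<le> (\<Sum>i\<in>{1..q}. 1 / real (d i) * N i r)"
          by (intro sum_mono mult_left_mono im(2)) auto
        then have "real k * T r - (\<Sum>i\<in>{1..q}. 1 / real (d i) * N i r) \<le> K * ln r + c / 2 * r powr s" using 1 2 by linarith
        moreover have "0 \<le> K * ln r + c / 2 * r powr s" using K(1) r c by simp
        ultimately show ?thesis by (simp add: e_def)
      qed
      have "\<forall>\<^sub>F r in at_top. K * ln r \<le> c / 2 * r powr s" using s c by (intro ln_powr_bound) auto
      then show "\<forall>\<^sub>F r in at_top. norm (e r) \<le> c * norm (r powr s)"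
        using eventually_ge_at_top[of 1]
      proof eventually_elim
        fix r :: real assume "K * ln r \<le> c / 2 * r powr s" "1 \<le> r"
        then have "e r \<le> c * r powr s" using bound[of r] by simp
        moreover have "0 \<le> e r" by (simp add: e_def)
        ultimately show "norm (e r) \<le> c * norm (r powr s)" by simp
      qed
    qed
    moreover have "ereal (a * char_T F \<Omega> r) \<le> (\<Sum>i=1..q. ereal (1 / real (d i)) * counting_N F \<Omega> (Q i) r) + ereal (e r)" for r
    proof -
      have "(\<Sum>i=1..q. ereal (1 / real (d i)) * counting_N F \<Omega> (Q i) r) = (\<Sum>i=1..q. ereal (1 / real (d i) * N i r))"
        using g_nz by (intro sum.cong refl) (auto simp: cN)
      also have "\<dots> = ereal (\<Sum>i=1..q. 1 / real (d i) * N i r)" by (rule sum_ereal)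
      finally have eq: "(\<Sum>i=1..q. ereal (1 / real (d i)) * counting_N F \<Omega> (Q i) r) + ereal (e r) = ereal ((\<Sum>i=1..q. 1 / real (d i) * N i r) + e r)"
        by simp
      have "a * T r \<le> real k * T r" using a T0 by (intro mult_right_mono)
      also have "\<dots> \<le> (\<Sum>i=1..q. 1 / real (d i) * N i r) + e r" by (simp add: e_def)
      finally show ?thesis unfolding eq T by simp
    qed
    ultimately show ?thesis unfolding \<Omega>_def s_def by (intro bexI[of _ e] always_eventually allI)
  qed
qed

section \<open>The values of \<open>k\<close> in the three cases\<close>

lemma gap_of_pdim_nonpos:
  fixes X :: "('n::{finite,linorder}) pspace set"
  assumes "palgebraic X" "pdim X \<le> 0"
  shows "\<exists>e P. e \<ge> 1 \<and> homogeneous e P \<and> X \<inter> pzeros P = {}"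
proof -
  obtain a where "X \<inter> pzeros (linear_form a) = {}"
    using linear_form_avoiding_finite[OF finite_if_pdim_nonpos[OF assms]] by blast
  then show ?thesis using homogeneous_linear_form by blast
qed

theorem theorem4:
  fixes V :: "('n::{finite,linorder}) pspace set"
    and f :: "complex \<Rightarrow> 'n pspace"
    and F :: "complex \<Rightarrow> complex ^ ('n::{finite,linorder})"
    and \<sigma> \<theta> \<epsilon> :: real
    and q :: nat
    and d :: "nat \<Rightarrow> nat"
    and Q :: "nat \<Rightarrow> 'n cpoly"
  assumes "palgebraic V"
    and "homogeneous_rep F f"
    and "range f \<subseteq> V"
    and "\<sigma> > - 1"
    and "fs_deriv F \<in> O[at_infinity](\<lambda>z. cmod z powr \<sigma>)"
    and "\<And>i. i \<in> {1..q} \<Longrightarrow> hypersurface_eq (d i) (Q i)"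
    and "0 \<le> \<theta>" and "\<theta> \<le> 2 * pi"
    and "0 < \<epsilon>" and "\<epsilon> < pi"
  shows
    "(\<forall>m::nat. pdim V \<le> ereal (real m) \<and> subgeneral_position m V q Q \<longrightarrow>
        (\<exists>e\<in>o(\<lambda>r::real. r powr (2 * \<sigma> + 2)). \<forall>\<^sub>F r in at_top.
           ereal ((real q - real m + 1) * char_T F (angular_domain \<theta> \<epsilon>) r)
           \<le> (\<Sum>i=1..q. ereal (1 / real (d i)) * counting_N F (angular_domain \<theta> \<epsilon>) (Q i) r)
              + ereal (e r)))
     \<and> (V \<inter> (\<Inter>i\<in>{1..q}. pzeros (Q i)) = {} \<longrightarrow>
        (\<exists>e\<in>o(\<lambda>r::real. r powr (2 * \<sigma> + 2)). \<forall>\<^sub>F r in at_top.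
           ereal (2 * char_T F (angular_domain \<theta> \<epsilon>) r)
           \<le> (\<Sum>i=1..q. ereal (1 / real (d i)) * counting_N F (angular_domain \<theta> \<epsilon>) (Q i) r)
              + ereal (e r)))
     \<and> (pdim (V \<inter> (\<Inter>i\<in>{1..q}. pzeros (Q i))) = 0 \<longrightarrow>
        (\<exists>e\<in>o(\<lambda>r::real. r powr (2 * \<sigma> + 2)). \<forall>\<^sub>F r in at_top.
           ereal (char_T F (angular_domain \<theta> \<epsilon>) r)
           \<le> (\<Sum>i=1..q. ereal (1 / real (d i)) * counting_N F (angular_domain \<theta> \<epsilon>) (Q i) r)
              + ereal (e r)))"
proof -
  have V: "palgebraic V" by fact
  have Q: "homogeneous (d i) (Q i)" "d i \<ge> 1" if "i \<in> {1..q}" for i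
    using assms(6)[OF that] by (auto simp: hypersurface_eq_def)
  have hol: "(\<lambda>z. F z $ j) holomorphic_on UNIV" for j
    using assms(2) by (simp add: homogeneous_rep_def)
  have F: "F z \<noteq> 0" "proj (F z) \<in> V" for z
    using assms(2,3) by (auto simp: homogeneous_rep_def)
  have alg: "palgebraic (V \<inter> (\<Inter>i\<in>I. pzeros (Q i)))" if "I \<subseteq> {1..q}" for I
  proof -
    have "palgebraic (\<Inter>(insert V ((\<lambda>i. pzeros (Q i)) ` I)))"
      using V palgebraic_pzeros[OF Q(1)] that by (intro palgebraic_Inter) auto
    then show ?thesis by simp
  qed
  note main = main_estimate[OF V Q _ hol F assms(4,5,9,10)]
  show ?thesis
  proof (intro conjI allI impI)
    fix m :: nat
    assume m: "pdim V \<le> ereal (real m) \<and> subgeneral_position m V q Q"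
    show "\<exists>e\<in>o(\<lambda>r::real. r powr (2 * \<sigma> + 2)). \<forall>\<^sub>F r in at_top.
           ereal ((real q - real m + 1) * char_T F (angular_domain \<theta> \<epsilon>) r)
           \<le> (\<Sum>i=1..q. ereal (1 / real (d i)) * counting_N F (angular_domain \<theta> \<epsilon>) (Q i) r) + ereal (e r)"
    \<comment> \<open>This \<open>k\<close> leaves at least \<open>m\<close> indices in
      \<open>J\<close>. For \<open>m > q + 1\<close> truncated subtraction gives
      \<open>k = 0\<close>, while the coefficient on the left is negative.\<close>
    proof (rule main[where k = "q + 1 - m"])
      fix J assume J: "J \<subseteq> {1..q}" "q + 1 \<le> card J + (q + 1 - m)"
      have finJ: "finite J" using J(1) finite_subset by blast
      have "card J \<le> q" using card_mono[OF _ J(1)] by simp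
      then have "m \<le> card J" using J(2) by linarith
      then obtain I where I: "I \<subseteq> J" "card I = m" using obtain_subset_with_card_n by metis
      have "pdim (V \<inter> (\<Inter>i\<in>I. pzeros (Q i))) \<le> 0"
      \<comment> \<open>Subgeneral position speaks of nonempty \<open>I\<close>; for
        \<open>m = 0\<close> the bound on \<open>pdim V\<close> takes its place.\<close>
      proof (cases "m = 0")
        case True
        then have "I = {}" using I finJ finite_subset by fastforce
        then show ?thesis using m True by (simp add: zero_ereal_def)
      next
        case False
        then have "I \<noteq> {}" "I \<subseteq> {1..q}" "card I \<le> m + 1" using I J by auto
        then have "pdim ((\<Inter>i\<in>I. pzeros (Q i)) \<inter> V) \<le> ereal (real m - real (card I))"
          using m unfolding subgeneral_position_def by blast
        then show ?thesis using I by (simp add: Int_commute zero_ereal_def)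
      qed
      then obtain e P where "e \<ge> 1" "homogeneous e P" "V \<inter> (\<Inter>i\<in>I. pzeros (Q i)) \<inter> pzeros P = {}"
        using gap_of_pdim_nonpos[OF alg] I J by (meson order_trans)
      then show "\<exists>e P. e \<ge> 1 \<and> homogeneous e P \<and> V \<inter> (\<Inter>j\<in>J. pzeros (Q j)) \<inter> pzeros P = {}"
        using I(1) by (intro exI[of _ e] exI[of _ P]) blast
    next
      show "real q - real m + 1 \<le> real (q + 1 - m)"
        by (cases "m \<le> q + 1") (simp_all add: of_nat_diff)
    qed
  next
    assume empty: "V \<inter> (\<Inter>i\<in>{1..q}. pzeros (Q i)) = {}"
    have "q \<noteq> 0"
    proof
      assume "q = 0"
      then show False using empty F(2)[of 0] by simp
    qed
    then have q1: "1 \<in> {1..q}" by simp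
    show "\<exists>e\<in>o(\<lambda>r::real. r powr (2 * \<sigma> + 2)). \<forall>\<^sub>F r in at_top.
           ereal (2 * char_T F (angular_domain \<theta> \<epsilon>) r)
           \<le> (\<Sum>i=1..q. ereal (1 / real (d i)) * counting_N F (angular_domain \<theta> \<epsilon>) (Q i) r) + ereal (e r)"
    proof (rule main[where k = 2])
      fix J assume J: "J \<subseteq> {1..q}" "q + 1 \<le> card J + 2"
      have finJ: "finite J" using J(1) finite_subset by blast
      \<comment> \<open>At most one index is missing from \<open>J\<close>, and its form serves as
        \<open>P\<close>. If none is missing, any index will do; there is one because
        \<open>V\<close> contains \<open>proj (F 0)\<close>.\<close>
      have "\<exists>i\<in>{1..q}. {1..q} \<subseteq> insert i J"
      proof (cases "J = {1..q}")
        case True then show ?thesis using q1 by blast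
      next
        case False
        have "card ({1..q} - J) = q - card J" using J(1) finJ by (simp add: card_Diff_subset)
        also have "\<dots> \<le> 1" using J(2) by simp
        finally have "card ({1..q} - J) \<le> 1" .
        moreover have "{1..q} - J \<noteq> {}" using False J(1) by blast
        ultimately have "card ({1..q} - J) = 1" by (metis One_nat_def card_gt_0_iff finite_Diff finite_atLeastAtMost le_antisym Suc_leI)
        then obtain i where "{1..q} - J = {i}" by (rule card_1_singletonE)
        then show ?thesis by blast
      qed
      then obtain i where i: "i \<in> {1..q}" "{1..q} \<subseteq> insert i J" by blast
      then have "V \<inter> (\<Inter>j\<in>J. pzeros (Q j)) \<inter> pzeros (Q i) = {}" using empty by blast
      then show "\<exists>e P. e \<ge> 1 \<and> homogeneous e P \<and> V \<inter> (\<Inter>j\<in>J. pzeros (Q j)) \<inter> pzeros P = {}"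
        using Q[OF i(1)] by blast
    qed auto
  next
    assume dim0: "pdim (V \<inter> (\<Inter>i\<in>{1..q}. pzeros (Q i))) = 0"
    have "\<exists>e\<in>o(\<lambda>r::real. r powr (2 * \<sigma> + 2)). \<forall>\<^sub>F r in at_top.
           ereal (1 * char_T F (angular_domain \<theta> \<epsilon>) r)
           \<le> (\<Sum>i=1..q. ereal (1 / real (d i)) * counting_N F (angular_domain \<theta> \<epsilon>) (Q i) r) + ereal (e r)"
    proof (rule main[where k = 1])
      fix J assume J: "J \<subseteq> {1..q}" "q + 1 \<le> card J + 1"
      \<comment> \<open>For \<open>k = 1\<close> no form is left out, and \<open>P\<close> is a
        linear form avoiding the finitely many common points in \<open>V\<close>.\<close>
      then have "J = {1..q}" by (intro card_subset_eq) (auto intro: antisym card_mono[of "{1..q}" J, simplified])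
      then show "\<exists>e P. e \<ge> 1 \<and> homogeneous e P \<and> V \<inter> (\<Inter>j\<in>J. pzeros (Q j)) \<inter> pzeros P = {}"
        using gap_of_pdim_nonpos[OF alg] dim0 by simp
    qed auto
    then show "\<exists>e\<in>o(\<lambda>r::real. r powr (2 * \<sigma> + 2)). \<forall>\<^sub>F r in at_top.
           ereal (char_T F (angular_domain \<theta> \<epsilon>) r)
           \<le> (\<Sum>i=1..q. ereal (1 / real (d i)) * counting_N F (angular_domain \<theta> \<epsilon>) (Q i) r) + ereal (e r)"
      by simp
  qed
qed

end
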